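(* Let $n\ge 3$ and $m\in\mathbb{N}$, $m\geq 1$. For $\varepsilon\in(0,\frac{4}{n-2})$ let $u_\varepsilon$ be a radial solution of $$-\Delta u_\varepsilon=|u_\varepsilon|^{\frac{4}{n-2}-\varepsilon}u_\varepsilon\ \text{ in }B,\qquad u_\varepsilon=0\ \text{ on }\partial B,$$ with $m-1$ interior zeros. Let $(\delta_{k,\varepsilon})_{k=1}^m$ be the decreasing sequence of all the critical points of $u_\varepsilon$ in $[0,1]$ and $(\rho_{k,\varepsilon})_{k=1}^m$ the decreasing sequence of all the zeros of $u_\varepsilon$ in $[0,1]$. Then $$0=\delta_{m,\varepsilon}<\rho_{m,\varepsilon}<\delta_{m-1,\varepsilon}<\rho_{m-1,\varepsilon}<\ldots<\delta_{1,\varepsilon}<\rho_{1,\varepsilon}=1$$ and \begin{align*} \lim_{\varepsilon\to0}|u_\varepsilon(\delta_{k,\varepsilon})|\,(\kappa_n\varepsilon)^{\frac{2k-1}{2}}&=D(k,m) &&\text{for }k\in\{1,\ldots,m\},\\ \lim_{\varepsilon\to0}\delta_{k,\varepsilon}\,(\kappa_n\varepsilon)^{-\frac{2(kn-1)}{n(n-2)}}&=d(k,m) &&\text{for }k\in\{1,\ldots,m-1\}\text{ if }m\ge2,\\ \lim_{\varepsilon\to0}|u_\varepsilon'(\rho_{k,\varepsilon})|\,(\kappa_n\varepsilon)^{\frac{2kn-3n+2}{2(n-2)}}&=Z(k,m) &&\text{for }k\in\{1,\ldots,m\},\\ \lim_{\varepsilon\to0}\rho_{k,\varepsilon}\,(\kappa_n\varepsilon)^{-\frac{2(k-1)}{n-2}}&=z(k,m)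 &&\text{for }k\in\{2,\ldots,m\}\text{ if }m\ge2; \end{align*} in particular (for the same respective ranges of $k$), $$u_\varepsilon(\delta_{k,\varepsilon})\sim\varepsilon^{-\frac12-(k-1)},\quad \delta_{k,\varepsilon}\sim\varepsilon^{\frac{2(n-1)}{n(n-2)}+\frac{2}{n-2}(k-1)},\quad u_\varepsilon'(\rho_{k,\varepsilon})\sim\varepsilon^{\frac12-\frac{n}{n-2}(k-1)},\quad \rho_{k,\varepsilon}\sim\varepsilon^{\frac{2}{n-2}(k-1)}.$$ The coefficients are given by \begin{align*} D(k,m)&=(n(n-2))^{\frac{n-2}{4}}\frac{\Gamma(m-k+1)}{m^{\frac12}\Gamma(m)},\\ d(k,m)&=(m-k)^{\frac1n}\left(\frac{m^{\frac12}\Gamma(m)}{\Gamma(m-k+1)}\right)^{\frac{2}{n-2}},\\ Z(k,m)&=n^{\frac{n-2}{4}}(n-2)^{\frac{n+2}{4}}(m-k+1)^{\frac{n-1}{n-2}}\left(\frac{\Gamma(m-k+1)}{m^{\frac12}\Gamma(m)}\right)^{\frac{n}{n-2}},\\ z(k,m)&=(m-k+1)^{-\frac{1}{n-2}}\left(\frac{m^{\frac12}\Gamma(m)}{\Gamma(m-k+1)}\right)^{\frac{2}{n-2}}. \end{align*}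
   Context: $B\subset\mathbb{R}^n$ is the open unit ball centered at the origin; solutions are classical. A radial function $w$ is identified with the function $r\mapsto w(r)$, $w(r)=w(x)$ for $|x|=r$; zeros, critical points and $'$ refer to this function of $r\in[0,1]$. "$w$ has $k$ interior zeros" means that $r\mapsto w(r)$ has exactly $k$ zeros in $(0,1)$. For every $m\ge1$ the radial Dirichlet solution with exactly $m-1$ interior zeros exists and is unique up to a sign. $\Gamma$ is the Gamma function and $\kappa_n:=\frac{n-2}{4}\frac{\Gamma(n/2)^2}{\Gamma(n)}$. The notation $a_\varepsilon\sim b_\varepsilon$ (with $b_\varepsilon>0$) means that $|a_\varepsilon|/b_\varepsilon$ converges to a positive finite constant as $\varepsilon\to0$. *)

theory Defs
  imports "HOL-Analysis.Analysis"
begin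

text \<open>The classes \<open>C\<^sup>1\<close> and \<open>C\<^sup>2\<close> are only meant for open sets \<open>S\<close>, where the unrestricted
  \<open>at x\<close> is the right filter.\<close>

definition C1_on :: "'a::euclidean_space set \<Rightarrow> ('a \<Rightarrow> real) \<Rightarrow> bool" where
  "C1_on S f \<longleftrightarrow> (\<forall>x\<in>S. f differentiable (at x)) \<and>
     (\<forall>b\<in>Basis. continuous_on S (\<lambda>x. frechet_derivative f (at x) b))"

definition C2_on :: "'a::euclidean_space set \<Rightarrow> ('a \<Rightarrow> real) \<Rightarrow> bool" where
  "C2_on S f \<longleftrightarrow> C1_on S f \<and> (\<forall>b\<in>Basis. C1_on S (\<lambda>x. frechet_derivative f (at x) b))"

definition laplacian :: "('a::euclidean_space \<Rightarrow> real) \<Rightarrow> 'a \<Rightarrow> real" where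
  "laplacian f x =
     (\<Sum>b\<in>Basis. frechet_derivative (\<lambda>y. frechet_derivative f (at y) b) (at x) b)"

text \<open>Classical solution, in \<open>C\<^sup>2(B) \<inter> C(closure B)\<close>, of \<open>- \<Delta>u = |u|\<^sup>q u\<close> in the open unit ball \<open>B\<close>
  with \<open>u = 0\<close> on the boundary. Values outside the closed ball are irrelevant.\<close>

definition dirichlet_solution :: "real \<Rightarrow> ('a::euclidean_space \<Rightarrow> real) \<Rightarrow> bool" where
  "dirichlet_solution q u \<longleftrightarrow>
     C2_on (ball 0 1) u \<and> continuous_on (cball 0 1) u \<and>
     (\<forall>x\<in>ball 0 1. - laplacian u x = \<bar>u x\<bar> powr q * u x) \<and>
     (\<forall>x\<in>sphere 0 1. u x = 0)"

definition radial :: "('a::euclidean_space \<Rightarrow> real) \<Rightarrow> bool" where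
  "radial u \<longleftrightarrow> (\<forall>x\<in>cball 0 1. \<forall>y\<in>cball 0 1. norm x = norm y \<longrightarrow> u x = u y)"

text \<open>The function \<open>r \<mapsto> u(r)\<close> of a radial \<open>u\<close>; meaningful for \<open>r \<in> [0,1]\<close>. Its derivative is
  accordingly taken within \<open>[0,1]\<close>, hence one-sided at the end points.\<close>

definition profile :: "('a::euclidean_space \<Rightarrow> real) \<Rightarrow> real \<Rightarrow> real" where
  "profile u r = (THE c. \<forall>x. norm x = r \<longrightarrow> u x = c)"

definition profile_deriv :: "('a::euclidean_space \<Rightarrow> real) \<Rightarrow> real \<Rightarrow> real" where
  "profile_deriv u r = vector_derivative (profile u) (at r within {0..1})"

definition zeros :: "('a::euclidean_space \<Rightarrow> real) \<Rightarrow> real set" where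
  "zeros u = {r\<in>{0..1}. profile u r = 0}"

definition crit_points :: "('a::euclidean_space \<Rightarrow> real) \<Rightarrow> real set" where
  "crit_points u = {r\<in>{0..1}. (profile u has_real_derivative 0) (at r within {0..1})}"

definition has_interior_zeros :: "('a::euclidean_space \<Rightarrow> real) \<Rightarrow> nat \<Rightarrow> bool" where
  "has_interior_zeros u k \<longleftrightarrow>
     finite (zeros u \<inter> {0<..<1}) \<and> card (zeros u \<inter> {0<..<1}) = k"

text \<open>The \<open>k\<close>-th largest element of a finite set, \<open>1 \<le> k \<le> card S\<close>.\<close>

definition kth_largest :: "real set \<Rightarrow> nat \<Rightarrow> real" where
  "kth_largest S k = rev (sorted_list_of_set S) ! (k - 1)"

definition crit_pt :: "('a::euclidean_space \<Rightarrow> real) \<Rightarrow> nat \<Rightarrow> real" where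
  "crit_pt u k = kth_largest (crit_points u) k"

definition zero_pt :: "('a::euclidean_space \<Rightarrow> real) \<Rightarrow> nat \<Rightarrow> real" where
  "zero_pt u k = kth_largest (zeros u) k"

text \<open>\<open>a\<^sub>\<epsilon> \<sim> b\<^sub>\<epsilon>\<close> as \<open>\<epsilon> \<rightarrow> 0+\<close>: the limit of \<open>|a\<^sub>\<epsilon>| / b\<^sub>\<epsilon>\<close> is an arbitrary positive constant, unlike the
  limit \<open>1\<close> required by \<open>asymp_equiv\<close>.\<close>

definition same_rate :: "(real \<Rightarrow> real) \<Rightarrow> (real \<Rightarrow> real) \<Rightarrow> bool" where
  "same_rate a b \<longleftrightarrow> (\<exists>c>0. ((\<lambda>\<epsilon>. \<bar>a \<epsilon>\<bar> / b \<epsilon>) \<longlongrightarrow> c) (at_right 0))"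

definition kappa :: "nat \<Rightarrow> real" where
  "kappa n = (real n - 2) / 4 * ((Gamma (real n / 2))\<^sup>2 / Gamma (real n))"

definition coeff_D :: "nat \<Rightarrow> nat \<Rightarrow> nat \<Rightarrow> real" where
  "coeff_D n k m = (real n * (real n - 2)) powr ((real n - 2) / 4) *
     (Gamma (real m - real k + 1) / (real m powr (1/2) * Gamma (real m)))"

definition coeff_d :: "nat \<Rightarrow> nat \<Rightarrow> nat \<Rightarrow> real" where
  "coeff_d n k m = (real m - real k) powr (1 / real n) *
     (real m powr (1/2) * Gamma (real m) / Gamma (real m - real k + 1)) powr (2 / (real n - 2))"

definition coeff_Z :: "nat \<Rightarrow> nat \<Rightarrow> nat \<Rightarrow> real" where
  "coeff_Z n k m = real n powr ((real n - 2) / 4) * (real n - 2) powr ((real n + 2) / 4) *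
     (real m - real k + 1) powr ((real n - 1) / (real n - 2)) *
     (Gamma (real m - real k + 1) / (real m powr (1/2) * Gamma (real m)))
       powr (real n / (real n - 2))"

definition coeff_z :: "nat \<Rightarrow> nat \<Rightarrow> nat \<Rightarrow> real" where
  "coeff_z n k m = (real m - real k + 1) powr (- 1 / (real n - 2)) *
     (real m powr (1/2) * Gamma (real m) / Gamma (real m - real k + 1)) powr (2 / (real n - 2))"

end

theory Submission
  imports Defs
begin

text \<open>In the variable \<open>t = b r\<^bsup>2-n\<^esup>\<close>, for a suitable constant \<open>b\<close>, and after division by \<open>\<plusminus> \<alpha>\<close>, where
  \<open>\<alpha> = \<bar>u\<^sub>\<epsilon>(0)\<bar>\<close>, the radial equation becomes the Emden--Fowler equation
  \<open>y'' = - (1 + a) t\<^bsup>-2-a\<^esup> \<bar>y\<bar>\<^bsup>2a-\<epsilon>\<^esup> y\<close> on \<open>[b, \<infinity>)\<close> with \<open>a = 2 / (n - 2)\<close> and \<open>y(\<infinity>) = 1\<close>. The origin of the ball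
  is moved to \<open>t = \<infinity>\<close>, the boundary to \<open>t = b\<close>, and the constant \<open>b\<close> is tied to \<open>\<alpha>\<close> by
  \<open>b\<^bsup>a\<^esup> = n (n - 2) \<alpha>\<^bsup>-(2a-\<epsilon>)\<^esup>\<close>. Between two zeros the function \<open>\<bar>y\<bar>\<close> is concave, and for \<open>\<epsilon> = 0\<close>
  there is the explicit solution \<open>y\<^bsup>-a\<^esup> = 1 + t\<^bsup>-a\<^esup>\<close>, the bubble.

  Two functions govern one hump. The Pohozaev function \<open>N = t y'\<^sup>2 - y y' + t\<^bsup>-1-a\<^esup> \<bar>y\<bar>\<^bsup>2+2a-\<epsilon>\<^esup>\<close> has the
  derivative \<open>- \<epsilon> t\<^bsup>-1-a\<^esup> \<bar>y\<bar>\<^bsup>2a-\<epsilon>\<^esup> y y'\<close> (\<open>deriv_N\<close>), so it changes by \<open>O(\<epsilon>)\<close> only. The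
  ratio \<open>G = t\<^bsup>1+a\<^esup> y' y\<^bsup>-1-a\<^esup>\<close> is \<open>1\<close> on the bubble and its derivative is a multiple of \<open>N\<close> (\<open>deriv_G\<close>), so it
  stays close to \<open>1\<close>. Hence the part of a hump where \<open>\<bar>y\<bar>\<close> increases in \<open>t\<close> converges, after rescaling to height
  one, to the bubble; the slope at its zero tends to \<open>1\<close> (\<open>slope_lim\<close>) and \<open>N\<close> gains \<open>\<kappa>\<^sub>n \<epsilon>\<close> on it (\<open>N_gain\<close>,
  \<open>bubble_action_eq_kappa\<close>). The part where \<open>\<bar>y\<bar>\<close> decreases is almost a straight line, and \<open>N\<close> changes on it by
  \<open>o(\<epsilon>)\<close> only (\<open>falling_family\<close>).

  Let \<open>h\<^sub>j\<close> be the height of the hump between the zeros \<open>T\<^sub>j\<^sub>+\<^sub>1 < T\<^sub>j\<close>, counted from infinity with \<open>h\<^sub>0 = 1\<close>, and let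
  \<open>\<sigma>\<^sub>j = \<bar>y'(T\<^sub>j)\<bar>\<close>. As \<open>N = T\<^sub>j \<sigma>\<^sub>j\<^sup>2\<close> at a zero, undoing the rescaling gives
  \<open>\<sigma>\<^sub>j\<^sub>+\<^sub>1 h\<^sub>j \<rightarrow> 1\<close>, \<open>T\<^sub>j \<sigma>\<^sub>j\<^sup>2 \<approx> j \<kappa>\<^sub>n \<epsilon>\<close> and \<open>h\<^sub>j \<approx> \<sigma>\<^sub>j T\<^sub>j\<close>, whence \<open>h\<^sub>j\<^sub>+\<^sub>1 \<approx> (j + 1) \<kappa>\<^sub>n \<epsilon> h\<^sub>j\<close> and
  \<open>h\<^sub>j \<approx> j! (\<kappa>\<^sub>n \<epsilon>)\<^bsup>j\<^esup>\<close> (\<open>nodal_limits\<close>). The powers \<open>h\<^bsup>c \<epsilon>\<^esup>\<close> that the rescaling leaves behind because the exponent is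
  not exactly critical tend to \<open>1\<close>, since \<open>h\<close> is at least a power of \<open>\<epsilon>\<close> (\<open>falling_step\<close>). Finally \<open>T\<^sub>m = b\<close> determines \<open>\<alpha>\<close>
  (\<open>rate_\<alpha>\<close>), and going back to the variable \<open>r\<close> all the claimed limits are products of powers of those
  already found.

  The order of zeros and critical points for fixed \<open>\<epsilon>\<close> follows from the concavity of \<open>\<bar>y\<bar>\<close> and
  from the simplicity of the zeros (\<open>nodal_structure\<close>).\<close>

section \<open>Arcs of constant sign of the Emden--Fowler equation\<close>

lemma nondecreasing_by_derivative:
  fixes f f' :: "real \<Rightarrow> real"
  assumes "continuous_on {A..B} f" "A \<le> s" "s \<le> t" "t \<le> B"
    and "\<And>x. A < x \<Longrightarrow> x < B \<Longrightarrow> (f has_real_derivative f' x) (at x)"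
    and "\<And>x. s < x \<Longrightarrow> x < t \<Longrightarrow> f' x \<ge> 0"
  shows "f s \<le> f t"
proof (rule DERIV_nonneg_imp_increasing_open[of s t f])
  show "continuous_on {s..t} f" using assms(1) by (rule continuous_on_subset) (use assms in auto)
qed (use assms in \<open>force+\<close>)

lemma nonincreasing_by_derivative:
  fixes f f' :: "real \<Rightarrow> real"
  assumes "continuous_on {A..B} f" "A \<le> s" "s \<le> t" "t \<le> B"
    and "\<And>x. A < x \<Longrightarrow> x < B \<Longrightarrow> (f has_real_derivative f' x) (at x)"
    and "\<And>x. s < x \<Longrightarrow> x < t \<Longrightarrow> f' x \<le> 0"
  shows "f t \<le> f s"
proof (rule DERIV_nonpos_imp_decreasing_open[of s t f])
  show "continuous_on {s..t} f" using assms(1) by (rule continuous_on_subset) (use assms in auto)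
qed (use assms in \<open>force+\<close>)

lemma deriv_powr:
  fixes x :: real
  shows "0 < x \<Longrightarrow> d = c - 1 \<Longrightarrow> ((\<lambda>x. x powr c) has_real_derivative c * x powr d) (at x)"
  using has_real_derivative_powr[of x c] by simp

text \<open>The equation is \<open>y'' = - (1 + a) t\<^bsup>-2-a\<^esup> y\<^bsup>1+2a-e\<^esup>\<close>, with \<open>w\<close> standing for \<open>y'\<close>. At \<open>e = 0\<close> it is solved by
  the bubble \<open>y\<^bsup>-a\<^esup> = 1 + t\<^bsup>-a\<^esup>\<close>, that is, the Aubin--Talenti function in the variable \<open>t = const r\<^bsup>2-n\<^esup>\<close>.
  The function \<open>pohozaev\<close> is the integrand of the Pohozaev identity in these variables. It vanishes
  on the bubble and at a zero of \<open>y\<close> it equals \<open>t w\<^sup>2\<close>, so it transports the slope from one zero to the next.\<close>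
definition pohozaev :: "real \<Rightarrow> real \<Rightarrow> (real \<Rightarrow> real) \<Rightarrow> (real \<Rightarrow> real) \<Rightarrow> real \<Rightarrow> real" where
  "pohozaev a e y w t = t * (w t)\<^sup>2 - y t * w t + t powr (- 1 - a) * y t powr (2 + 2 * a - e)"

text \<open>The slope of \<open>y\<^bsup>-a\<^esup>\<close> measured against that of \<open>t\<^bsup>-a\<^esup>\<close>; it is identically \<open>1\<close> on the bubble.\<close>
definition bubble_ratio :: "real \<Rightarrow> (real \<Rightarrow> real) \<Rightarrow> (real \<Rightarrow> real) \<Rightarrow> real \<Rightarrow> real" where
  "bubble_ratio a y w t = t powr (1 + a) * w t * y t powr (- 1 - a)"

text \<open>The differential equation is only required inside the interval, since \<open>y\<close> may vanish at the end
  points, where the power of \<open>y\<close> need not be differentiable.\<close>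
locale positive_arc =
  fixes a e :: real and y w :: "real \<Rightarrow> real" and A B :: real
  assumes a_pos: "0 < a" and e_nonneg: "0 \<le> e" and e_less: "e < 2 * a"
    and A_pos: "0 < A" and A_less_B: "A < B"
    and cont_y: "continuous_on {A..B} y" and cont_w: "continuous_on {A..B} w"
    and deriv_y: "\<And>t. A < t \<Longrightarrow> t < B \<Longrightarrow> (y has_real_derivative w t) (at t)"
    and deriv_w: "\<And>t. A < t \<Longrightarrow> t < B \<Longrightarrow>
      (w has_real_derivative - ((1 + a) * (t powr (- 2 - a) * y t powr (1 + 2 * a - e)))) (at t)"
    and y_pos: "\<And>t. A < t \<Longrightarrow> t < B \<Longrightarrow> 0 < y t"
begin

abbreviation "N \<equiv> pohozaev a e y w"

abbreviation "G \<equiv> bubble_ratio a y w"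

lemma y_nonneg: "A \<le> t \<Longrightarrow> t \<le> B \<Longrightarrow> 0 \<le> y t"
proof -
  assume t: "A \<le> t" "t \<le> B"
  have "closure {A<..<B} = {A..B}" using A_less_B by (simp add: closure_greaterThanLessThan)
  then show "0 \<le> y t"
    using continuous_ge_on_closure[of "{A<..<B}" y t 0] cont_y t y_pos by fastforce
qed

lemma w_antimono: "A \<le> s \<Longrightarrow> s \<le> t \<Longrightarrow> t \<le> B \<Longrightarrow> w t \<le> w s"
  by (rule nonincreasing_by_derivative[OF cont_w _ _ _ deriv_w])
     (use a_pos in \<open>auto\<close>)

lemma w_strict_antimono: "A \<le> s \<Longrightarrow> s < t \<Longrightarrow> t \<le> B \<Longrightarrow> w t < w s"
proof (rule DERIV_neg_imp_decreasing_open[of s t w])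
  assume *: "A \<le> s" "s < t" "t \<le> B"
  show "continuous_on {s..t} w" using cont_w by (rule continuous_on_subset) (use * in auto)
  fix x assume "s < x" "x < t"
  with * have x: "A < x" "x < B" by auto
  have "0 < (1 + a) * (x powr (- 2 - a) * y x powr (1 + 2 * a - e))"
    using x a_pos A_pos y_pos[OF x] by simp
  then show "\<exists>d. (w has_real_derivative d) (at x) \<and> d < 0"
    using deriv_w[OF x] by (intro exI conjI) auto
qed

lemma continuous_intros_arc:
  "continuous_on {A..B} (\<lambda>t. t powr c)"
  "0 < c \<Longrightarrow> continuous_on {A..B} (\<lambda>t. y t powr c)"
  using A_pos y_nonneg by (auto intro!: continuous_intros continuous_on_powr' cont_y)

lemma subarc: "A \<le> A' \<Longrightarrow> A' < B' \<Longrightarrow> B' \<le> B \<Longrightarrow> positive_arc a e y w A' B'"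
  using a_pos e_nonneg e_less A_pos deriv_y deriv_w y_pos
  by unfold_locales (auto intro: continuous_on_subset[OF cont_y] continuous_on_subset[OF cont_w])

lemma cont_N: "continuous_on {A..B} N"
  unfolding pohozaev_def[abs_def] using A_pos e_less
  by (intro continuous_intros continuous_intros_arc cont_y cont_w) auto

text \<open>All terms cancel except the one that measures the distance \<open>e\<close> from the critical exponent: this is
  why the Pohozaev function moves by \<open>O(e)\<close> only.\<close>
lemma deriv_N:
  assumes t: "A < t" "t < B"
  shows "(N has_real_derivative - e * t powr (- 1 - a) * y t powr (1 + 2 * a - e) * w t) (at t)"
proof -
  have t0: "0 < t" and y0: "0 < y t" using A_pos t y_pos by auto
  have 1: "y t powr (2 + 2 * a - e) = y t * y t powr (1 + 2 * a - e)"
    using y0 powr_add[of "y t" 1 "1 + 2 * a - e"] by (simp add: algebra_simps)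
  have 2: "t powr (- 1 - a) = t * t powr (- 2 - a)"
    using t0 powr_add[of "t" 1 "- 2 - a"] by (simp add: algebra_simps)
  have "(N has_real_derivative
      (w t)\<^sup>2 + t * (2 * w t * - ((1 + a) * (t powr (- 2 - a) * y t powr (1 + 2 * a - e))))
      - (w t * w t + y t * - ((1 + a) * (t powr (- 2 - a) * y t powr (1 + 2 * a - e))))
      + ((- 1 - a) * t powr (- 2 - a) * y t powr (2 + 2 * a - e)
         + t powr (- 1 - a) * ((2 + 2 * a - e) * y t powr (1 + 2 * a - e) * w t))) (at t)"
    unfolding pohozaev_def[abs_def]
    by (rule derivative_eq_intros deriv_y[OF t] deriv_w[OF t] refl t0 y0
        has_real_derivative_powr' | simp add: add_diff_eq)+
  then show ?thesis
    unfolding 1 2 by (rule DERIV_cong) (simp add: power2_eq_square algebra_simps)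
qed

text \<open>The deviation from the bubble is driven by the Pohozaev function alone, which is \<open>O(e)\<close>.\<close>
lemma deriv_G:
  assumes t: "A < t" "t < B"
  shows "(G has_real_derivative - ((1 + a) * t powr a * y t powr (- 2 - a) * N t)) (at t)"
proof -
  have t0: "0 < t" and y0: "0 < y t" using A_pos t y_pos by auto
  have p1: "t powr (1 + a) = t * t powr a" "t powr (- 1 - a) = inverse (t * t powr a)"
    "t powr (- 2 - a) = inverse (t * t * t powr a)"
    using t0 powr_add[of t 1 a] powr_minus[of t "1 + a"] powr_minus[of t "2 + a"]
      powr_add[of t 2 a] by (simp_all add: power2_eq_square)
  have p2: "y t powr (2 + 2 * a - e) = y t * y t powr (1 + 2 * a - e)"
     "y t powr (- 1 - a) = y t * y t powr (- 2 - a)"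
    using y0 powr_add[of "y t" 1 "1 + 2 * a - e"] powr_add[of "y t" 1 "- 2 - a"]
    by (simp_all add: algebra_simps)
  have "(G has_real_derivative
      ((1 + a) * t powr a * w t + t powr (1 + a) *
         - ((1 + a) * (t powr (- 2 - a) * y t powr (1 + 2 * a - e)))) * y t powr (- 1 - a)
      + t powr (1 + a) * w t * ((- 1 - a) * y t powr (- 2 - a) * w t)) (at t)"
    unfolding bubble_ratio_def[abs_def]
    by (rule derivative_eq_intros deriv_y[OF t] deriv_w[OF t] refl t0 y0
        has_real_derivative_powr' | simp)+
  then show ?thesis
    by (rule DERIV_cong) (use t0 in \<open>unfold pohozaev_def p1 p2, simp add: power2_eq_square field_simps\<close>)
qed

lemma deriv_y_powr:
  assumes t: "A < t" "t < B"
  shows "((\<lambda>t. y t powr - a) has_real_derivative - (a * t powr (- 1 - a) * G t)) (at t)"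
proof -
  have t0: "0 < t" and y0: "0 < y t" using A_pos t y_pos by auto
  have "t powr (- 1 - a) * t powr (1 + a) = 1"
    using t0 powr_add[of t "- 1 - a" "1 + a"] by simp
  then have "t powr (- 1 - a) * G t = w t * y t powr (- 1 - a)"
    unfolding bubble_ratio_def by (metis mult.assoc mult.left_neutral)
  moreover have "((\<lambda>t. y t powr - a) has_real_derivative - a * y t powr (- a - 1) * w t) (at t)"
    by (rule derivative_eq_intros deriv_y[OF t] refl t0 y0
        has_real_derivative_powr' | simp)+
  moreover have "- a - 1 = - 1 - a" by simp
  ultimately show ?thesis by (simp add: mult_ac)
qed

end

text \<open>The part of a hump on which \<open>y\<close> increases. The right end point \<open>B\<close> is meant to be either the maximum,
  normalised to \<open>1\<close>, or a far away point at which \<open>y\<close> is nearly \<open>1\<close> and nearly flat.\<close>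
locale rising_arc = positive_arc +
  assumes w_end: "0 \<le> w B" and y_end: "y B \<le> 1"
begin

lemma w_nonneg: "A \<le> t \<Longrightarrow> t \<le> B \<Longrightarrow> 0 \<le> w t"
  using w_antimono[of t B] w_end by auto

lemma w_pos: "A \<le> t \<Longrightarrow> t < B \<Longrightarrow> 0 < w t"
  using w_strict_antimono[of t B] w_end by auto

lemma y_mono: "A \<le> s \<Longrightarrow> s \<le> t \<Longrightarrow> t \<le> B \<Longrightarrow> y s \<le> y t"
  by (rule nondecreasing_by_derivative[OF cont_y _ _ _ deriv_y]) (auto intro: w_nonneg)

lemma y_le_1: "A \<le> t \<Longrightarrow> t \<le> B \<Longrightarrow> y t \<le> 1"
  using y_mono[of t B] y_end by auto

lemma y_less_1: 
  assumes "A \<le> t" "t < B" shows "y t < 1"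
proof -
  have "y t < y B"
  proof (rule DERIV_pos_imp_increasing_open[of t B y])
    show "continuous_on {t..B} y" using cont_y by (rule continuous_on_subset) (use assms in auto)
    show "\<exists>d. (y has_real_derivative d) (at x) \<and> 0 < d" if "t < x" "x < B" for x
      using deriv_y[of x] w_pos[of x] that assms by auto
  qed (use assms in auto)
  then show ?thesis using y_end by simp
qed

lemma y_powr_le_1: "A \<le> t \<Longrightarrow> t \<le> B \<Longrightarrow> y t powr (1 + 2 * a - e) \<le> 1"
  using y_nonneg y_le_1 e_less by (intro powr_le1) auto

lemma y_pos': "A < t \<Longrightarrow> t \<le> B \<Longrightarrow> 0 < y t"
  using y_mono[of "(A + t) / 2" t] y_pos[of "(A + t) / 2"] by auto

text \<open>The next three bounds only use that \<open>y\<close> increases with values in \<open>[0, 1]\<close>; they integrate the equation from the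
  right end point. Far to the right they pin \<open>y\<close> and \<open>w\<close> down without any use of the bubble.\<close>
lemma w_le:
  assumes t: "A \<le> t" "t \<le> B"
  shows "w t \<le> w B + t powr (- 1 - a)"
proof -
  have "w t - t powr (- 1 - a) \<le> w B - B powr (- 1 - a)"
  proof (rule nondecreasing_by_derivative[of A B "(\<lambda>t. w t - t powr (- 1 - a))"])
    show "continuous_on {A..B} (\<lambda>t. w t - t powr (- 1 - a))"
      by (intro continuous_intros cont_w continuous_intros_arc)
    show "((\<lambda>t. w t - t powr (- 1 - a)) has_real_derivative
       (1 + a) * (x powr (- 2 - a) * (1 - y x powr (1 + 2 * a - e)))) (at x)" if x: "A < x" "x < B" for x
    proof -
      have p: "((\<lambda>t. t powr (- 1 - a)) has_real_derivative (- 1 - a) * x powr (- 2 - a)) (at x)"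
        using x A_pos by (intro deriv_powr) auto
      show ?thesis
        by (rule p deriv_w[OF x] derivative_eq_intros refl)+ (simp add: algebra_simps)
    qed
    show "0 \<le> (1 + a) * (x powr (- 2 - a) * (1 - y x powr (1 + 2 * a - e)))" if x: "t < x" "x < B" for x
      using y_powr_le_1[of x] x t a_pos by auto
  qed (use t in auto)
  moreover have "0 \<le> B powr (- 1 - a)" by simp
  ultimately show ?thesis by linarith
qed

lemma y_ge:
  assumes t: "A \<le> t" "t \<le> B"
  shows "y B - B * w B - t powr - a / a \<le> y t"
proof -
  have "y B + B powr - a / a - w B * B \<le> y t + t powr - a / a - w B * t"
  proof (rule nonincreasing_by_derivative[of A B "(\<lambda>t. y t + t powr - a / a - w B * t)"])
    show "continuous_on {A..B} (\<lambda>t. y t + t powr - a / a - w B * t)"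
      using a_pos by (intro continuous_intros cont_y continuous_intros_arc) auto
    show "((\<lambda>t. y t + t powr - a / a - w B * t) has_real_derivative
       w x - x powr (- 1 - a) - w B) (at x)" if x: "A < x" "x < B" for x
    proof -
      have p: "((\<lambda>t. t powr - a) has_real_derivative (- a) * x powr (- 1 - a)) (at x)"
        using x A_pos by (intro deriv_powr) auto
      show ?thesis using a_pos
        by - (rule p deriv_y[OF x] derivative_eq_intros refl | simp)+
    qed
    show "w x - x powr (- 1 - a) - w B \<le> 0" if x: "t < x" "x < B" for x
      using w_le[of x] x t by auto
  qed (use t in auto)
  moreover have "0 \<le> B powr - a / a" "0 \<le> w B * t" using a_pos w_end A_pos t by auto
  ultimately show ?thesis by (simp add: mult.commute)
qed

lemma w_ge:
  assumes t: "A \<le> t" "t \<le> B"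
  shows "y t powr (1 + 2 * a - e) * t powr (- 1 - a) - B powr (- 1 - a) \<le> w t"
proof -
  define K where "K = y t powr (1 + 2 * a - e)"
  have "w B - K * B powr (- 1 - a) \<le> w t - K * t powr (- 1 - a)"
  proof (rule nonincreasing_by_derivative[of A B "(\<lambda>t. w t - K * t powr (- 1 - a))"])
    show "continuous_on {A..B} (\<lambda>t. w t - K * t powr (- 1 - a))"
      by (intro continuous_intros cont_w continuous_intros_arc)
    show "((\<lambda>t. w t - K * t powr (- 1 - a)) has_real_derivative
       (1 + a) * (x powr (- 2 - a) * (K - y x powr (1 + 2 * a - e)))) (at x)" if x: "A < x" "x < B" for x
    proof -
      have p: "((\<lambda>t. t powr (- 1 - a)) has_real_derivative (- 1 - a) * x powr (- 2 - a)) (at x)"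
        using x A_pos by (intro deriv_powr) auto
      show ?thesis
        by (rule p deriv_w[OF x] derivative_eq_intros refl)+ (simp add: algebra_simps)
    qed
    show "(1 + a) * (x powr (- 2 - a) * (K - y x powr (1 + 2 * a - e))) \<le> 0" if x: "t < x" "x < B" for x
    proof -
      have "y t powr (1 + 2 * a - e) \<le> y x powr (1 + 2 * a - e)"
        using y_mono[of t x] x t y_nonneg[of t] e_less by (intro powr_mono2) auto
      then show ?thesis using a_pos by (auto simp: K_def mult_le_0_iff)
    qed
  qed (use t in auto)
  moreover have "K * B powr (- 1 - a) \<le> B powr (- 1 - a)"
    using mult_right_mono[OF y_powr_le_1[OF t], of "B powr (- 1 - a)"] by (simp add: K_def)
  ultimately show ?thesis using w_end by (simp add: K_def)
qed

lemma N_antimono: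
  assumes "A \<le> s" "s \<le> t" "t \<le> B" shows "N t \<le> N s"
  by (rule nonincreasing_by_derivative[OF cont_N assms deriv_N])
     (use assms e_nonneg w_nonneg in auto)

lemma N_le:
  assumes t: "A \<le> t" "t \<le> B"
  shows "N t \<le> N B + e * t powr (- 1 - a)"
proof -
  define K where "K = t powr (- 1 - a)"
  have "N t + e * K * y t \<le> N B + e * K * y B"
  proof (rule nondecreasing_by_derivative[of A B "(\<lambda>t. N t + e * K * y t)"])
    show "continuous_on {A..B} (\<lambda>t. N t + e * K * y t)"
      by (intro continuous_intros cont_N cont_y)
    show "((\<lambda>t. N t + e * K * y t) has_real_derivative
       e * w x * (K - x powr (- 1 - a) * y x powr (1 + 2 * a - e))) (at x)" if x: "A < x" "x < B" for x
      by (rule derivative_eq_intros deriv_N[OF x] deriv_y[OF x] refl | simp add: algebra_simps)+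
    show "0 \<le> e * w x * (K - x powr (- 1 - a) * y x powr (1 + 2 * a - e))" if x: "t < x" "x < B" for x
    proof -
      have "x powr (- 1 - a) * y x powr (1 + 2 * a - e) \<le> x powr (- 1 - a) * 1"
        using y_powr_le_1[of x] x t by (intro mult_left_mono) auto
      also have "\<dots> \<le> K" unfolding K_def
        using x t A_pos a_pos by (simp add: powr_mono2')
      finally show ?thesis using e_nonneg w_nonneg[of x] x t by auto
    qed
  qed (use t in auto)
  moreover have "e * K * (y B - y t) \<le> e * K * 1"
    using y_end y_nonneg[OF t] e_nonneg by (intro mult_left_mono) (auto simp: K_def)
  ultimately show ?thesis by (simp add: K_def algebra_simps)
qed

lemma cont_G: assumes "A < s" shows "continuous_on {s..B} G"
proof -
  have "continuous_on {s..B} y" "continuous_on {s..B} w"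
    using assms by (auto intro: continuous_on_subset[OF cont_y] continuous_on_subset[OF cont_w])
  then show ?thesis
    unfolding bubble_ratio_def[abs_def] using assms A_pos y_pos'
    by (intro continuous_intros) (auto simp: less_imp_neq[symmetric])
qed

lemma cont_y_powr: assumes "A < s" shows "continuous_on {s..B} (\<lambda>t. y t powr c)"
proof -
  have "continuous_on {s..B} y"
    using assms by (auto intro: continuous_on_subset[OF cont_y])
  then show ?thesis
    using assms y_pos'
    by (intro continuous_intros) (auto simp: less_imp_neq[symmetric])
qed

lemma G_antimono:
  assumes "0 \<le> N B" "A < s" "s \<le> t" "t \<le> B" shows "G t \<le> G s"
proof (rule nonincreasing_by_derivative[OF cont_G[of s], of s t])
  fix x assume "s < x" "x < B"
  then show "(G has_real_derivative - ((1 + a) * x powr a * y x powr (- 2 - a) * N x)) (at x)"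
    using assms by (intro deriv_G) auto
next
  fix x assume "s < x" "x < t"
  then show "- ((1 + a) * x powr a * y x powr (- 2 - a) * N x) \<le> 0"
    using assms a_pos N_antimono[of x B] by auto
qed (use assms in auto)

text \<open>Quantitative converse of \<open>G_antimono\<close>: away from the zero of \<open>y\<close>, a small Pohozaev function
  forces \<open>G\<close> to be nearly constant.\<close>
lemma G_growth:
  assumes "0 \<le> N B" "A < s" "s \<le> t" "t \<le> B"
  shows "G s \<le> G t + (1 + a) * t powr a * y s powr (- 2 - a) * N s * (t - s)"
proof -
  define K where "K = (1 + a) * t powr a * y s powr (- 2 - a) * N s"
  have "G s + K * s \<le> G t + K * t"
  proof (rule nondecreasing_by_derivative[of s B "(\<lambda>t. G t + K * t)"])
    show "continuous_on {s..B} (\<lambda>t. G t + K * t)"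
      using assms by (intro continuous_intros cont_G)
    show "((\<lambda>t. G t + K * t) has_real_derivative
        K - (1 + a) * x powr a * y x powr (- 2 - a) * N x) (at x)" if "s < x" "x < B" for x
      using assms that by (auto intro!: derivative_eq_intros deriv_G)
    show "0 \<le> K - (1 + a) * x powr a * y x powr (- 2 - a) * N x" if x: "s < x" "x < t" for x
    proof -
      have "0 \<le> N x" "N x \<le> N s" using N_antimono[of x B] N_antimono[of s x] x assms by auto
      moreover have "x powr a \<le> t powr a" using x assms A_pos a_pos by (intro powr_mono2) auto
      moreover have "y x powr (- 2 - a) \<le> y s powr (- 2 - a)"
        using x assms a_pos y_mono[of s x] y_pos'[of s] by (intro powr_mono2') auto
      ultimately show ?thesis unfolding K_def
        using a_pos by (auto intro!: mult_mono)
    qed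
  qed (use assms in auto)
  then show ?thesis unfolding K_def by (simp add: algebra_simps)
qed

text \<open>Bounds on \<open>G\<close> integrate to bounds on \<open>y\<^bsup>-a\<^esup>\<close>, because \<open>(y\<^bsup>-a\<^esup>)' = G (t\<^bsup>-a\<^esup>)'\<close>.\<close>
lemma y_powr_ge:
  assumes "A < s" "s \<le> t" "t \<le> B" and g: "\<And>x. s < x \<Longrightarrow> x < t \<Longrightarrow> g \<le> G x"
  shows "y t powr - a + g * (s powr - a - t powr - a) \<le> y s powr - a"
proof -
  have "y t powr - a - g * t powr - a \<le> y s powr - a - g * s powr - a"
  proof (rule nonincreasing_by_derivative[of s B "(\<lambda>t. y t powr - a - g * t powr - a)"])
    show "continuous_on {s..B} (\<lambda>t. y t powr - a - g * t powr - a)"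
      using assms A_pos by (intro continuous_intros cont_y_powr) auto
    show "((\<lambda>t. y t powr - a - g * t powr - a) has_real_derivative
       - (a * x powr (- 1 - a) * (G x - g))) (at x)" if x: "s < x" "x < B" for x
    proof -
      have x': "A < x" "x < B" using x assms by auto
      have p: "((\<lambda>t. t powr - a) has_real_derivative (- a) * x powr (- 1 - a)) (at x)"
        using x' A_pos by (intro deriv_powr) auto
      show ?thesis
        by (rule p deriv_y_powr[OF x'] derivative_eq_intros refl)+ (simp add: algebra_simps)
    qed
    show "- (a * x powr (- 1 - a) * (G x - g)) \<le> 0" if x: "s < x" "x < t" for x
      using g[OF x] a_pos by simp
  qed (use assms in auto)
  then show ?thesis by (simp add: algebra_simps)
qed

lemma y_powr_le:
  assumes "A < s" "s \<le> t" "t \<le> B" and g: "\<And>x. s < x \<Longrightarrow> x < t \<Longrightarrow> G x \<le> g"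
  shows "y s powr - a \<le> y t powr - a + g * (s powr - a - t powr - a)"
proof -
  have "y s powr - a - g * s powr - a \<le> y t powr - a - g * t powr - a"
  proof (rule nondecreasing_by_derivative[of s B "(\<lambda>t. y t powr - a - g * t powr - a)"])
    show "continuous_on {s..B} (\<lambda>t. y t powr - a - g * t powr - a)"
      using assms A_pos by (intro continuous_intros cont_y_powr) auto
    show "((\<lambda>t. y t powr - a - g * t powr - a) has_real_derivative
       - (a * x powr (- 1 - a) * (G x - g))) (at x)" if x: "s < x" "x < B" for x
    proof -
      have x': "A < x" "x < B" using x assms by auto
      have p: "((\<lambda>t. t powr - a) has_real_derivative (- a) * x powr (- 1 - a)) (at x)"
        using x' A_pos by (intro deriv_powr) auto
      show ?thesis
        by (rule p deriv_y_powr[OF x'] derivative_eq_intros refl)+ (simp add: algebra_simps)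
    qed
    show "0 \<le> - (a * x powr (- 1 - a) * (G x - g))" if x: "s < x" "x < t" for x
      using g[OF x] a_pos by (simp add: mult_nonneg_nonpos)
  qed (use assms in auto)
  then show ?thesis by (simp add: algebra_simps)
qed

lemma y_ge_tangent:
  assumes "y A = 0" "A \<le> s" "s \<le> B" shows "w s * (s - A) \<le> y s"
proof -
  have "y A - w s * A \<le> y s - w s * s"
    by (rule nondecreasing_by_derivative[of A B _ A s "\<lambda>x. w x - w s"])
       (use assms w_antimono in \<open>auto intro!: continuous_intros derivative_eq_intros cont_y deriv_y\<close>)
  then show ?thesis using assms by (simp add: algebra_simps)
qed

lemma y_le_tangent:
  assumes "A \<le> s" "s \<le> t" "t \<le> B" shows "y t \<le> y s + w s * (t - s)"
proof -
  have "y t - w s * t \<le> y s - w s * s"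
    by (rule nonincreasing_by_derivative[of A B _ s t "\<lambda>x. w x - w s"])
       (use assms w_antimono in \<open>auto intro!: continuous_intros derivative_eq_intros cont_y deriv_y\<close>)
  then show ?thesis using assms by (simp add: algebra_simps)
qed

lemma y_ge_chord:
  assumes "y A = 0" "A \<le> s" "s \<le> t" "t \<le> B" shows "y t * (s - A) \<le> y s * (t - A)"
proof -
  have "y t * (s - A) \<le> (y s + w s * (t - s)) * (s - A)"
    using assms by (intro mult_right_mono y_le_tangent) auto
  also have "\<dots> = y s * (s - A) + (w s * (s - A)) * (t - s)" by (simp add: algebra_simps)
  also have "\<dots> \<le> y s * (s - A) + y s * (t - s)"
    using assms by (intro add_left_mono mult_right_mono y_ge_tangent) auto
  finally show ?thesis by (simp add: algebra_simps)
qed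

text \<open>A linear bound on \<open>y\<close> controls the gain of slope near the zero: \<open>t\<^bsup>-2-a\<^esup> t\<^bsup>1+2a-e\<^esup>\<close> is integrable at \<open>0\<close>
  as long as \<open>e < a\<close>.\<close>
lemma slope_le:
  assumes "A < t" "t \<le> B" "e < a" "0 \<le> C" and C: "\<And>s. A < s \<Longrightarrow> s < t \<Longrightarrow> y s \<le> C * s"
  shows "w A \<le> w t + (1 + a) * C powr (1 + 2 * a - e) * t powr (a - e) / (a - e)"
proof -
  define K where "K = (1 + a) * C powr (1 + 2 * a - e)"
  have "w A + K * (A powr (a - e) / (a - e)) \<le> w t + K * (t powr (a - e) / (a - e))"
  proof (rule nondecreasing_by_derivative[of A B "(\<lambda>t. w t + K * (t powr (a - e) / (a - e)))"])
    show "continuous_on {A..B} (\<lambda>t. w t + K * (t powr (a - e) / (a - e)))"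
      using assms by (intro continuous_intros cont_w continuous_intros_arc) auto
    show "((\<lambda>t. w t + K * (t powr (a - e) / (a - e))) has_real_derivative
       K * x powr (a - e - 1) - (1 + a) * (x powr (- 2 - a) * y x powr (1 + 2 * a - e))) (at x)"
       if x: "A < x" "x < B" for x
    proof -
      have p: "((\<lambda>t. t powr (a - e)) has_real_derivative (a - e) * x powr (a - e - 1)) (at x)"
        using x A_pos by (intro deriv_powr) auto
      show ?thesis using assms
        by - (rule p deriv_w[OF x] derivative_eq_intros refl | simp)+
    qed
    show "0 \<le> K * x powr (a - e - 1) - (1 + a) * (x powr (- 2 - a) * y x powr (1 + 2 * a - e))"
      if x: "A < x" "x < t" for x
    proof -
      have "y x powr (1 + 2 * a - e) \<le> (C * x) powr (1 + 2 * a - e)"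
        using C[OF x] y_nonneg[of x] x assms e_less by (intro powr_mono2) auto
      also have "\<dots> = C powr (1 + 2 * a - e) * x powr (1 + 2 * a - e)"
        by (simp add: powr_mult)
      finally have "x powr (- 2 - a) * y x powr (1 + 2 * a - e)
          \<le> x powr (- 2 - a) * (C powr (1 + 2 * a - e) * x powr (1 + 2 * a - e))"
        by (intro mult_left_mono) auto
      also have "\<dots> = C powr (1 + 2 * a - e) * x powr (a - e - 1)"
        using powr_add[of x "- 2 - a" "1 + 2 * a - e"] by (simp add: mult_ac)
      finally show ?thesis unfolding K_def using a_pos
        by (simp add: mult.assoc)
    qed
  qed (use assms in auto)
  moreover have "0 \<le> K * (A powr (a - e) / (a - e))"
    using assms a_pos by (auto simp: K_def)
  ultimately show ?thesis by (simp add: K_def)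
qed

end

section \<open>The action of the bubble\<close>

definition action_kernel :: "real \<Rightarrow> real \<Rightarrow> real" where
  "action_kernel a s = s powr (1 / a) * (1 - s) powr (1 + 1 / a)"

text \<open>Along the bubble, \<open>bubble_action a y\<close> is the integral of \<open>t\<^bsup>-1-a\<^esup> y\<^bsup>1+2a\<^esup> y'\<close> from \<open>0\<close> to \<open>t\<close>, expressed by
  the value of \<open>y\<close> and rewritten with the substitution \<open>s = y\<^bsup>a\<^esup>\<close>, which makes it an incomplete Beta
  integral.\<close>
definition bubble_action :: "real \<Rightarrow> real \<Rightarrow> real" where
  "bubble_action a x = integral {0..x powr a} (action_kernel a) / a"

lemma continuous_action_kernel: "0 < a \<Longrightarrow> continuous_on {0..1} (action_kernel a)"
  unfolding action_kernel_def
  by (intro continuous_on_mult continuous_on_powr' continuous_intros) (auto simp: add_pos_pos)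

lemma continuous_integral_kernel:
  "0 < a \<Longrightarrow> continuous_on {0..1} (\<lambda>v. integral {0..v} (action_kernel a))"
  by (intro indefinite_integral_continuous_1 integrable_continuous_real continuous_action_kernel)

lemma continuous_bubble_action: assumes a_pos: "0 < a" shows "continuous_on {0..1} (bubble_action a)"
proof -
  have "continuous_on {0..1} ((\<lambda>v. integral {0..v} (action_kernel a)) \<circ> (\<lambda>x. x powr a))"
    using a_pos
    by (intro continuous_on_compose continuous_on_powr' continuous_intros
          continuous_on_subset[OF continuous_integral_kernel[OF a_pos]]) (auto intro!: powr_le1)
  then show ?thesis using a_pos
    unfolding bubble_action_def comp_def by (intro continuous_intros) auto
qed

lemma deriv_bubble_action:
  assumes a_pos: "0 < a" and x: "0 < x" "x < 1"
  shows "(bubble_action a has_real_derivative x powr a * (1 - x powr a) powr (1 + 1 / a)) (at x)"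
proof -
  have v: "0 < x powr a" "x powr a < 1" using x a_pos powr_less_mono2[of a x 1] by auto
  have "((\<lambda>v. integral {0..v} (action_kernel a)) has_real_derivative action_kernel a (x powr a))
      (at (x powr a) within {0..1})"
    using v by (intro integral_has_real_derivative continuous_action_kernel a_pos) auto
  then have "((\<lambda>v. integral {0..v} (action_kernel a)) has_real_derivative action_kernel a (x powr a))
      (at (x powr a))"
    using v at_within_interior[of "x powr a" "{0..1}"] by simp
  moreover have "((\<lambda>x. x powr a) has_real_derivative a * x powr (a - 1)) (at x)"
    using x by (intro deriv_powr) auto
  ultimately have "((\<lambda>x. integral {0..x powr a} (action_kernel a)) has_real_derivative
      action_kernel a (x powr a) * (a * x powr (a - 1))) (at x)"
    by (rule DERIV_chain2)
  then have "(bubble_action a has_real_derivative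
      (action_kernel a (x powr a) * (a * x powr (a - 1))) / a) (at x)"
    unfolding bubble_action_def[abs_def] by (rule DERIV_cdivide)
  moreover have "(action_kernel a (x powr a) * (a * x powr (a - 1))) / a
      = (x powr (1::real) * x powr (a - 1)) * (1 - x powr a) powr (1 + 1 / a)"
    using a_pos x by (simp add: action_kernel_def powr_powr)
  moreover have "x powr (1::real) * x powr (a - 1) = x powr a" by (simp only: powr_add[symmetric]) simp
  ultimately show ?thesis by simp
qed

context rising_arc
begin

text \<open>The idea is to compare derivatives with respect to \<open>y\<close>: the Pohozaev function falls at the rate
  \<open>e t\<^bsup>-1-a\<^esup> y\<^bsup>1+2a-e\<^esup>\<close> while \<open>e bubble_action\<close> grows at the rate that belongs to the bubble. As \<open>y\<close> runs through an interval of
  length at most \<open>1\<close>, a uniform bound on the difference of the two rates suffices, and no passage to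
  the limit under an integral is needed.\<close>
lemma N_drop:
  assumes yA: "y A = 0" and eta: "\<And>t. A < t \<Longrightarrow> t < B \<Longrightarrow>
     \<bar>y t powr a * (1 - y t powr a) powr (1 + 1 / a) - t powr (- 1 - a) * y t powr (1 + 2 * a - e)\<bar> \<le> \<eta>"
  shows "\<bar>N A - N B - e * (bubble_action a (y B) - bubble_action a 0)\<bar> \<le> e * \<eta>"
proof -
  define f where "f t = N t + e * bubble_action a (y t)" for t
  define f' where "f' t = e * w t * (y t powr a * (1 - y t powr a) powr (1 + 1 / a)
       - t powr (- 1 - a) * y t powr (1 + 2 * a - e))" for t
  have "continuous_on {A..B} (bubble_action a \<circ> y)"
    using y_nonneg y_le_1
    by (intro continuous_on_compose cont_y continuous_on_subset[OF continuous_bubble_action[OF a_pos]]) auto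
  then have cont: "continuous_on {A..B} f"
    unfolding f_def comp_def by (intro continuous_intros cont_N)
  have df: "(f has_real_derivative f' t) (at t)" if t: "A < t" "t < B" for t
  proof -
    have "((\<lambda>t. bubble_action a (y t)) has_real_derivative
        (y t powr a * (1 - y t powr a) powr (1 + 1 / a)) * w t) (at t)"
      by (rule DERIV_chain2[OF deriv_bubble_action[OF a_pos] deriv_y]) (use t y_pos y_less_1 in auto)
    then show ?thesis unfolding f_def f'_def
      by (auto intro!: derivative_eq_intros deriv_N t simp: algebra_simps)
  qed
  have bound: "\<bar>f' t\<bar> \<le> e * \<eta> * w t" if t: "A < t" "t < B" for t
  proof -
    have "\<bar>f' t\<bar> = (e * w t) * \<bar>y t powr a * (1 - y t powr a) powr (1 + 1 / a)
       - t powr (- 1 - a) * y t powr (1 + 2 * a - e)\<bar>"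
      using e_nonneg w_nonneg[of t] t by (simp add: f'_def abs_mult)
    also have "\<dots> \<le> (e * w t) * \<eta>"
      using e_nonneg w_nonneg[of t] t eta[OF t] by (intro mult_left_mono) auto
    finally show ?thesis by (simp add: mult_ac)
  qed
  have "f A - e * \<eta> * y A \<ge> f B - e * \<eta> * y B"
  proof (rule nonincreasing_by_derivative[of A B "\<lambda>t. f t - e * \<eta> * y t"])
    show "continuous_on {A..B} (\<lambda>t. f t - e * \<eta> * y t)"
      by (intro continuous_intros cont cont_y)
    show "((\<lambda>t. f t - e * \<eta> * y t) has_real_derivative f' t - e * \<eta> * w t) (at t)"
      if "A < t" "t < B" for t
      using that by (auto intro!: derivative_eq_intros df deriv_y)
    show "f' t - e * \<eta> * w t \<le> 0" if "A < t" "t < B" for t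
      using bound[OF that] by auto
  qed (use A_less_B in auto)
  moreover have "f A + e * \<eta> * y A \<le> f B + e * \<eta> * y B"
  proof (rule nondecreasing_by_derivative[of A B "\<lambda>t. f t + e * \<eta> * y t"])
    show "continuous_on {A..B} (\<lambda>t. f t + e * \<eta> * y t)"
      by (intro continuous_intros cont cont_y)
    show "((\<lambda>t. f t + e * \<eta> * y t) has_real_derivative f' t + e * \<eta> * w t) (at t)"
      if "A < t" "t < B" for t
      using that by (auto intro!: derivative_eq_intros df deriv_y)
    show "0 \<le> f' t + e * \<eta> * w t" if "A < t" "t < B" for t
      using bound[OF that] by auto
  qed (use A_less_B in auto)
  moreover have "e * \<eta> * y B \<le> e * \<eta> * 1"
  proof (intro mult_left_mono mult_nonneg_nonneg e_nonneg y_end)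
    show "0 \<le> \<eta>" using eta[of "(A + B) / 2"] A_less_B by auto
  qed
  ultimately have "\<bar>f A - f B\<bar> \<le> e * \<eta>" using yA by auto
  then show ?thesis by (simp add: f_def yA algebra_simps)
qed

end

lemma bubble_action_1:
  assumes "0 < a"
  shows "bubble_action a 1 = Beta (1 + 1 / a) (2 + 1 / a) / a"
proof -
  have "(action_kernel a has_integral Beta (1 + 1 / a) (2 + 1 / a)) {0..1}"
    unfolding action_kernel_def[abs_def]
    using has_integral_Beta_real[of "1 + 1 / a" "2 + 1 / a"] assms by (simp add: add_pos_pos)
  then show ?thesis by (simp add: bubble_action_def integral_unique)
qed

lemma bubble_action_0: "0 < a \<Longrightarrow> bubble_action a 0 = 0"
  by (simp add: bubble_action_def)

text \<open>This identifies the constant \<open>\<kappa>\<^sub>n\<close>: it is the action of the whole bubble, a complete Beta integral.\<close>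
lemma bubble_action_eq_kappa:
  assumes "n \<ge> 3" and a: "a = 2 / (real n - 2)"
  shows "bubble_action a 1 = kappa n"
proof -
  define x where "x = real n / 2"
  have n: "real n \<ge> 3" using assms by simp
  have x: "1 + 1 / a = x" "2 + 1 / a = x + 1" "1 / a = x - 1" "0 < x" "x + (x + 1) = real n + 1"
    using n by (auto simp: a x_def field_simps)
  have g: "Gamma (x + 1) = x * Gamma x" "Gamma (real n + 1) = real n * Gamma (real n)"
    using Gamma_plus1[of x] Gamma_plus1[of "real n"] x n by (auto simp: nonpos_Ints_def)
  have nz: "Gamma (real n) \<noteq> 0" using n Gamma_real_pos[of "real n"] by linarith
  have "bubble_action a 1 = Beta (1 + 1 / a) (2 + 1 / a) * (1 / a)"
    using bubble_action_1[of a] n by (simp add: a)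
  also have "\<dots> = (x - 1) * (Gamma x * Gamma (x + 1) / Gamma (real n + 1))"
    by (subst x(1), subst x(2), unfold Beta_def x(5) x(3)) (simp add: mult_ac add.commute)
  also have "\<dots> = kappa n"
    unfolding g kappa_def x_def[symmetric] using n nz
    by (simp add: x_def field_simps power2_eq_square)
  finally show ?thesis .
qed

section \<open>Convergence of rising arcs to the bubble\<close>

text \<open>A family of rising arcs with \<open>e \<rightarrow> 0\<close> whose right end point moves off to infinity while the data there
  approach those of the bubble, \<open>y = 1\<close> and \<open>t y' = 0\<close>.\<close>
locale rising_family =
  fixes F :: "'i filter" and a :: real and e :: "'i \<Rightarrow> real" and y w :: "'i \<Rightarrow> real \<Rightarrow> real"
    and A B :: "'i \<Rightarrow> real"
  assumes a_pos: "0 < a"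
    and arcs: "\<forall>\<^sub>F i in F. rising_arc a (e i) (y i) (w i) (A i) (B i)"
    and y_start: "\<forall>\<^sub>F i in F. y i (A i) = 0"
    and N_end: "\<forall>\<^sub>F i in F. 0 \<le> pohozaev a (e i) (y i) (w i) (B i)"
    and e_pos: "\<forall>\<^sub>F i in F. 0 < e i"
    and e_lim: "(e \<longlongrightarrow> 0) F"
    and B_lim: "filterlim B at_top F"
    and y_end_lim: "((\<lambda>i. y i (B i)) \<longlongrightarrow> 1) F"
    and w_end_lim: "((\<lambda>i. B i * w i (B i)) \<longlongrightarrow> 0) F"
begin

abbreviation "NN i \<equiv> pohozaev a (e i) (y i) (w i)"
abbreviation "GG i \<equiv> bubble_ratio a (y i) (w i)"

lemma B_ge: "\<forall>\<^sub>F i in F. c \<le> B i" 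
  using B_lim by (auto simp: filterlim_at_top)

lemma B_gt: "\<forall>\<^sub>F i in F. c < B i"
  using B_ge[of "c + 1"] by eventually_elim auto

lemma y_lower:
  assumes M: "0 < M" "c < 1 - M powr - a / a"
  shows "\<forall>\<^sub>F i in F. A i \<le> M \<longrightarrow> c \<le> y i M"
proof -
  have "((\<lambda>i. y i (B i) - B i * w i (B i) - M powr - a / a) \<longlongrightarrow> 1 - 0 - M powr - a / a) F"
    by (intro tendsto_intros y_end_lim w_end_lim)
  then have "\<forall>\<^sub>F i in F. c < y i (B i) - B i * w i (B i) - M powr - a / a"
    using M by (intro order_tendstoD) auto
  then show ?thesis using arcs B_gt[of M]
  proof eventually_elim
    case (elim i)
    then interpret rising_arc a "e i" "y i" "w i" "A i" "B i" by simp
    show ?case using y_ge[of M] elim by auto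
  qed
qed

lemma start_less:
  assumes M: "0 < M" "M powr - a / a < 1"
  shows "\<forall>\<^sub>F i in F. A i < M"
proof -
  have "((\<lambda>i. y i (B i) - B i * w i (B i) - M powr - a / a) \<longlongrightarrow> 1 - 0 - M powr - a / a) F"
    by (intro tendsto_intros y_end_lim w_end_lim)
  then have "\<forall>\<^sub>F i in F. 0 < y i (B i) - B i * w i (B i) - M powr - a / a"
    by (rule order_tendstoD(1)) (use M in auto)
  then show ?thesis using arcs y_start
  proof eventually_elim
    case (elim i)
    then interpret rising_arc a "e i" "y i" "w i" "A i" "B i" by simp
    show ?case
    proof (rule ccontr)
      assume "\<not> A i < M"
      then have "A i powr - a \<le> M powr - a" using M a_pos by (intro powr_mono2') auto
      then have "A i powr - a / a \<le> M powr - a / a" using a_pos by (simp add: divide_right_mono)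
      then show False using y_ge[of "A i"] elim A_less_B by auto
    qed
  qed
qed

lemma N_end_lim: "((\<lambda>i. NN i (B i)) \<longlongrightarrow> 0) F"
proof (rule tendsto_sandwich[where f = "\<lambda>_. 0" and h = "\<lambda>i. (B i * w i (B i))\<^sup>2 + (B i) powr (- 1 - a)"])
  show "\<forall>\<^sub>F i in F. NN i (B i) \<le> (B i * w i (B i))\<^sup>2 + (B i) powr (- 1 - a)"
    using arcs B_ge[of 1]
  proof eventually_elim
    case (elim i)
    then interpret rising_arc a "e i" "y i" "w i" "A i" "B i" by simp
    have "B i * (w i (B i))\<^sup>2 \<le> B i * (B i * (w i (B i))\<^sup>2)"
      using elim(2) mult_right_mono[of 1 "B i" "B i * (w i (B i))\<^sup>2"] by auto
    moreover have "0 \<le> y i (B i) * w i (B i)" using w_end y_nonneg[of "B i"] A_less_B by auto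
    moreover have "(B i) powr (- 1 - a) * y i (B i) powr (2 + 2 * a - e i) \<le> (B i) powr (- 1 - a) * 1"
      using y_nonneg[of "B i"] A_less_B e_less y_end by (intro mult_left_mono powr_le1) auto
    ultimately show ?case by (simp add: pohozaev_def power2_eq_square mult_ac)
  qed
  have "((\<lambda>i. (B i) powr (- 1 - a)) \<longlongrightarrow> 0) F"
    using a_pos by (intro tendsto_neg_powr B_lim) auto
  then have "((\<lambda>i. (B i * w i (B i))\<^sup>2 + (B i) powr (- 1 - a)) \<longlongrightarrow> 0\<^sup>2 + 0) F"
    by (intro tendsto_add tendsto_power w_end_lim)
  then show "((\<lambda>i. (B i * w i (B i))\<^sup>2 + (B i) powr (- 1 - a)) \<longlongrightarrow> 0) F" by simp
qed (use N_end in auto)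

lemma large_M: 
  assumes "c < (1::real)"
  shows "\<forall>\<^sub>F M in at_top. 0 < M \<and> c < 1 - M powr - a / a"
proof -
  have "((\<lambda>M. 1 - M powr - a / a) \<longlongrightarrow> 1 - 0 / a) at_top"
    using a_pos by (intro tendsto_intros tendsto_neg_powr filterlim_ident) auto
  then have "\<forall>\<^sub>F M in at_top. c < 1 - M powr - a / a" using assms by (intro order_tendstoD) auto
  then show ?thesis using eventually_gt_at_top[of 0] by eventually_elim auto
qed

text \<open>At a zero \<open>A\<close> the Pohozaev function is \<open>A w\<^sup>2\<close>. Concavity keeps the slope \<open>w A\<close> away from \<open>0\<close>, while
  \<open>N_le\<close> makes the Pohozaev function small unless \<open>A\<close> is.\<close>
lemma A_lim: "(A \<longlongrightarrow> 0) F"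
proof (rule tendstoI)
  fix t :: real assume t: "0 < t"
  obtain M where M: "0 < M" "1 / 2 < 1 - M powr - a / a"
    using eventually_happens'[OF _ large_M[of "1/2"]] by auto
  have M1: "M powr - a / a < 1" using M by linarith
  have "((\<lambda>i. NN i (B i) + e i * t powr (- 1 - a)) \<longlongrightarrow> 0 + 0 * t powr (- 1 - a)) F"
    by (intro tendsto_intros N_end_lim e_lim)
  then have "\<forall>\<^sub>F i in F. NN i (B i) + e i * t powr (- 1 - a) < t * (1 / (2 * M))\<^sup>2"
    using t M by (intro order_tendstoD) auto
  then show "\<forall>\<^sub>F i in F. dist (A i) 0 < t"
    using arcs y_start y_lower[OF M] start_less[OF M(1) M1] B_gt[of M]
  proof eventually_elim
    case (elim i)
    then interpret rising_arc a "e i" "y i" "w i" "A i" "B i" by simp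
    have AM: "A i < M" using elim M by auto
    have "y i M \<le> w i (A i) * (M - A i)" using y_le_tangent[of "A i" M] elim AM by auto
    also have "\<dots> \<le> w i (A i) * M" using A_pos w_nonneg[of "A i"] A_less_B by (intro mult_left_mono) auto
    finally have "1 / 2 \<le> w i (A i) * M" using elim AM by auto
    then have w: "1 / (2 * M) \<le> w i (A i)" using M by (simp add: field_simps)
    have NA: "NN i (A i) = A i * (w i (A i))\<^sup>2" using elim e_less by (simp add: pohozaev_def)
    have "A i < t"
    proof (rule ccontr)
      assume "\<not> A i < t"
      then have At: "t \<le> A i" by simp
      have "t * (1 / (2 * M))\<^sup>2 \<le> A i * (w i (A i))\<^sup>2"
        using At w t M by (intro mult_mono power_mono) auto
      also have "\<dots> \<le> NN i (B i) + e i * A i powr (- 1 - a)"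
        using N_le[of "A i"] A_less_B by (simp add: NA)
      also have "\<dots> \<le> NN i (B i) + e i * t powr (- 1 - a)"
        using At t a_pos e_nonneg by (intro add_left_mono mult_left_mono powr_mono2') auto
      finally show False using elim by auto
    qed
    then show ?case using A_pos by auto
  qed
qed

lemma A_less: "0 < t \<Longrightarrow> \<forall>\<^sub>F i in F. A i < t"
  using A_lim by (rule order_tendstoD)

lemma y_lower':
  assumes M: "0 < M" "c < 1 - M powr - a / a"
  shows "\<forall>\<^sub>F i in F. c \<le> y i M"
  using y_lower[OF assms] A_less[OF M(1)] by eventually_elim auto

lemma N_lim: assumes t: "0 < t" shows "((\<lambda>i. NN i t) \<longlongrightarrow> 0) F"
proof (rule tendsto_sandwich[where f = "\<lambda>_. 0" and h = "\<lambda>i. NN i (B i) + e i * t powr (- 1 - a)"])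
  show "\<forall>\<^sub>F i in F. 0 \<le> NN i t"
    using A_less[OF t] B_gt[of t] arcs N_end
  proof eventually_elim
    case (elim i)
    then interpret rising_arc a "e i" "y i" "w i" "A i" "B i" by simp
    show ?case using N_antimono[of t "B i"] elim by auto
  qed
  show "\<forall>\<^sub>F i in F. NN i t \<le> NN i (B i) + e i * t powr (- 1 - a)"
    using A_less[OF t] B_gt[of t] arcs
    by eventually_elim (auto intro: rising_arc.N_le)
  have "((\<lambda>i. NN i (B i) + e i * t powr (- 1 - a)) \<longlongrightarrow> 0 + 0 * t powr (- 1 - a)) F"
    by (intro tendsto_intros N_end_lim e_lim)
  then show "((\<lambda>i. NN i (B i) + e i * t powr (- 1 - a)) \<longlongrightarrow> 0) F" by simp
qed auto

text \<open>Far out, the crude bounds \<open>w_le\<close>, \<open>w_ge\<close> and \<open>y_lower'\<close> already give \<open>G \<approx> 1\<close>, uniformly in the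
  family. This fixes the constant of integration for \<open>G_lim\<close>.\<close>
lemma G_at_large:
  assumes "0 < \<eta>"
  shows "\<forall>\<^sub>F M in at_top. \<forall>\<^sub>F i in F. \<bar>GG i M - 1\<bar> < \<eta>"
proof -
  define c where "c M = 1 - 2 * M powr - a / a - 1 / M" for M
  have cl: "(c \<longlongrightarrow> 1 - 2 * 0 / a - 0) at_top"
    unfolding c_def using a_pos
    by (intro tendsto_intros tendsto_neg_powr filterlim_ident tendsto_divide_0[OF tendsto_const]
       filterlim_at_top_imp_at_infinity) auto
  then have cl: "(c \<longlongrightarrow> 1) at_top" by simp
  have inv: "((\<lambda>M::real. 1 / M) \<longlongrightarrow> 0) at_top"
    by (intro tendsto_divide_0[OF tendsto_const] filterlim_at_top_imp_at_infinity filterlim_ident)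
  have l1: "((\<lambda>M. c M powr (1 + 2 * a) - 1 / M) \<longlongrightarrow> 1 powr (1 + 2 * a) - 0) at_top"
    by (intro tendsto_intros cl inv) auto
  have l2: "((\<lambda>M. (1 + 1 / M) * c M powr (- 1 - a)) \<longlongrightarrow> (1 + 0) * 1 powr (- 1 - a)) at_top"
    by (intro tendsto_intros cl inv) auto
  have "\<forall>\<^sub>F M in at_top. 1 - \<eta> < c M powr (1 + 2 * a) - 1 / M"
    using order_tendstoD(1)[OF l1, of "1 - \<eta>"] assms by simp
  moreover have "\<forall>\<^sub>F M in at_top. (1 + 1 / M) * c M powr (- 1 - a) < 1 + \<eta>"
    using order_tendstoD(2)[OF l2, of "1 + \<eta>"] assms by simp
  moreover have "\<forall>\<^sub>F M in at_top. 1 / 2 < c M"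
    by (intro order_tendstoD[OF cl]) auto
  ultimately show ?thesis using eventually_gt_at_top[of 1]
  proof eventually_elim
    case (elim M)
    then have M: "0 < M" by simp
    have cM: "c M < 1 - M powr - a / a" using M a_pos unfolding c_def by (auto simp: field_simps add_pos_pos)
    have e1: "\<forall>\<^sub>F i in F. M powr (1 + a) * B i powr (- 1 - a) < 1 / M"
    proof -
      have "((\<lambda>i. M powr (1 + a) * B i powr (- 1 - a)) \<longlongrightarrow> M powr (1 + a) * 0) F"
        using a_pos by (intro tendsto_intros tendsto_neg_powr B_lim) auto
      then show ?thesis using M by (intro order_tendstoD) auto
    qed
    have e2: "\<forall>\<^sub>F i in F. M powr (1 + a) * (B i * w i (B i)) < 1 / M"
    proof -
      have "((\<lambda>i. M powr (1 + a) * (B i * w i (B i))) \<longlongrightarrow> M powr (1 + a) * 0) F"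
        by (intro tendsto_intros w_end_lim)
      then show ?thesis using M by (intro order_tendstoD) auto
    qed
    show ?case
      using e1 e2 arcs A_less[OF M] B_gt[of M] B_ge[of 1] y_lower'[OF M cM]
    proof eventually_elim
      case (elim i)
      then interpret rising_arc a "e i" "y i" "w i" "A i" "B i" by simp
      have t: "A i \<le> M" "M \<le> B i" using elim by auto
      have M1: "M powr (1 + a) * M powr (- 1 - a) = 1"
        using M powr_add[of M "1 + a" "- 1 - a"] by simp
      have y0: "0 < y i M" "y i M \<le> 1" using y_le_1[of M] y_pos'[of M] elim by auto
      have w0: "0 \<le> w i M" using w_nonneg[of M] t by auto
      have "M powr (1 + a) * w i M \<le> M powr (1 + a) * (w i (B i) + M powr (- 1 - a))"
        using w_le[OF t] by (intro mult_left_mono) auto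
      also have "\<dots> = M powr (1 + a) * w i (B i) + 1" using M1 by (simp add: algebra_simps)
      also have "\<dots> \<le> M powr (1 + a) * (B i * w i (B i)) + 1"
        using elim w_end by (simp add: mult_left_mono mult_le_cancel_right1)
      also have "\<dots> \<le> 1 + 1 / M" using elim by simp
      finally have up: "M powr (1 + a) * w i M \<le> 1 + 1 / M" .
      have "y i M powr (- 1 - a) \<le> c M powr (- 1 - a)"
        using \<open>1 / 2 < c M\<close> elim a_pos by (intro powr_mono2') auto
      then have "GG i M \<le> (1 + 1 / M) * c M powr (- 1 - a)"
        unfolding bubble_ratio_def using up M by (intro mult_mono) auto
      moreover have "c M powr (1 + 2 * a) - 1 / M \<le> GG i M"
      proof -
        have "c M powr (1 + 2 * a) \<le> y i M powr (1 + 2 * a)"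
          using \<open>1 / 2 < c M\<close> elim a_pos by (intro powr_mono2) auto
        also have "\<dots> \<le> y i M powr (1 + 2 * a - e i)"
          using y0 e_nonneg by (intro powr_mono') auto
        finally have "c M powr (1 + 2 * a) - 1 / M
            \<le> y i M powr (1 + 2 * a - e i) - M powr (1 + a) * B i powr (- 1 - a)"
          using elim by auto
        also have "\<dots> = M powr (1 + a) * (y i M powr (1 + 2 * a - e i) * M powr (- 1 - a) - B i powr (- 1 - a))"
          using M1 by (simp add: algebra_simps)
        also have "\<dots> \<le> M powr (1 + a) * w i M"
          using w_ge[OF t] by (intro mult_left_mono) auto
        also have "\<dots> \<le> M powr (1 + a) * w i M * y i M powr (- 1 - a)"
        proof -
          have "1 powr (- 1 - a) \<le> y i M powr (- 1 - a)" using y0 a_pos by (intro powr_mono2') auto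
          then show ?thesis using w0 mult_left_mono[of 1 "y i M powr (- 1 - a)" "M powr (1 + a) * w i M"]
            by simp
        qed
        finally show ?thesis by (simp add: bubble_ratio_def)
      qed
      ultimately show ?case using \<open>1 - \<eta> < _\<close> \<open>_ < 1 + \<eta>\<close> by linarith
    qed
  qed
qed

text \<open>From the far point \<open>M\<close>, where \<open>G \<approx> 1\<close>, down to \<open>t\<close> the function \<open>G\<close> changes by a multiple of the
  Pohozaev function, which tends to \<open>0\<close>.\<close>
lemma G_lim:
  assumes t: "0 < t"
  shows "((\<lambda>i. GG i t) \<longlongrightarrow> 1) F"
proof (rule tendstoI)
  fix \<eta> :: real assume eta: "0 < \<eta>"
  have "\<forall>\<^sub>F M in at_top. (\<forall>\<^sub>F i in F. \<bar>GG i M - 1\<bar> < \<eta> / 2) \<and> (0 < M \<and> 1 / 2 < 1 - M powr - a / a) \<and> t < M"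
    using G_at_large[of "\<eta> / 2"] eta by (intro eventually_conj large_M eventually_gt_at_top) auto
  then obtain M where M: "\<forall>\<^sub>F i in F. \<bar>GG i M - 1\<bar> < \<eta> / 2" "0 < M" "1 / 2 < 1 - M powr - a / a" "t < M"
    using eventually_happens'[OF trivial_limit_at_top_linorder] by blast
  \<comment> \<open>lower bound for \<open>y t\<close>: the chord from the zero \<open>A < t / 2\<close> to the height \<open>1 / 2\<close> at \<open>M\<close>\<close>
  define y0 where "y0 = t / (4 * M)"
  have y0: "0 < y0" using t M by (auto simp: y0_def)
  define K where "K = (1 + a) * M powr a * y0 powr (- 2 - a) * (M - t)"
  have "((\<lambda>i. K * NN i t) \<longlongrightarrow> K * 0) F" by (intro tendsto_intros N_lim t)
  then have "\<forall>\<^sub>F i in F. K * NN i t < \<eta> / 2" using eta by (intro order_tendstoD) auto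
  then show "\<forall>\<^sub>F i in F. dist (GG i t) 1 < \<eta>"
    using M(1) y_lower'[OF M(2,3)] arcs y_start N_end A_less[OF t] B_gt[of M] A_less[OF half_gt_zero[OF t]]
  proof eventually_elim
    case (elim i)
    then interpret rising_arc a "e i" "y i" "w i" "A i" "B i" by simp
    have "y i M * (t - A i) \<le> y i t * (M - A i)"
      using elim M by (intro y_ge_chord) auto
    also have "\<dots> \<le> y i t * M" using A_pos y_nonneg[of t] elim M by (intro mult_left_mono) auto
    finally have "y i M * (t - A i) \<le> y i t * M" .
    moreover have "1 / 2 * (t / 2) \<le> y i M * (t - A i)" using elim t by (intro mult_mono) auto
    ultimately have y0t: "y0 \<le> y i t" using M by (simp add: y0_def field_simps)
    have "0 \<le> NN i t" using N_antimono[of t "B i"] elim M by auto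
    moreover have "y i t powr (- 2 - a) \<le> y0 powr (- 2 - a)"
      using y0 y0t a_pos by (intro powr_mono2') auto
    ultimately have "(1 + a) * M powr a * y i t powr (- 2 - a) * NN i t * (M - t)
        \<le> (1 + a) * M powr a * y0 powr (- 2 - a) * NN i t * (M - t)"
      using a_pos M by (intro mult_right_mono mult_left_mono) auto
    also have "\<dots> = K * NN i t" by (simp add: K_def)
    finally have "GG i t \<le> GG i M + K * NN i t"
      using G_growth[of t M] elim M by linarith
    moreover have "GG i M \<le> GG i t" using G_antimono[of t M] elim M by auto
    ultimately show ?case using elim unfolding dist_real_def by linarith
  qed
qed

end

lemma powr_at_right_0_lim:
  assumes "0 < c"
  shows "((\<lambda>t::real. t powr c) \<longlongrightarrow> 0) (at_right 0)"
proof -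
  have "((\<lambda>t::real. t powr c) \<longlongrightarrow> 0 powr c) (at_right 0)"
    using assms by (intro tendsto_intros tendsto_powr') (auto intro: eventually_mono[OF eventually_at_right_less])
  then show ?thesis by simp
qed

context rising_family
begin

text \<open>Convergence to the bubble, uniform up to the moving right end point: on \<open>[t0, M]\<close> by integrating
  \<open>G \<approx> 1\<close>, and beyond \<open>M\<close> because both \<open>y\<^bsup>-a\<^esup> - 1\<close> and \<open>t\<^bsup>-a\<^esup>\<close> are small there.\<close>
lemma y_profile_uniform:
  assumes t0: "0 < t0" and eta: "0 < \<eta>"
  shows "\<forall>\<^sub>F i in F. \<forall>t\<in>{t0..B i}. \<bar>y i t powr - a - 1 - t powr - a\<bar> \<le> \<eta>"
proof -
  define \<theta> where "\<theta> = \<eta> / (2 + t0 powr - a)"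
  have th: "0 < \<theta>" using eta by (simp add: \<theta>_def add_pos_nonneg)
  have th_eta: "\<theta> * (2 + t0 powr - a) = \<eta>"
    using add_pos_nonneg[of 2 "t0 powr - a"] by (simp add: \<theta>_def)
  \<comment> \<open>chosen such that \<open>c\<^bsup>-a\<^esup> = 1 + \<theta>\<close>, which turns \<open>c \<le> y\<close> into \<open>y\<^bsup>-a\<^esup> \<le> 1 + \<theta>\<close>\<close>
  define c where "c = (1 + \<theta>) powr (- 1 / a)"
  have c: "0 < c" "c < 1" "c powr - a = 1 + \<theta>"
    using th a_pos powr_less_one[of "1 + \<theta>" "- 1 / a"] by (auto simp: c_def powr_powr)
  have l: "((\<lambda>M. M powr - a) \<longlongrightarrow> 0) at_top"
    using a_pos by (intro tendsto_neg_powr filterlim_ident) auto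
  have "\<forall>\<^sub>F M in at_top. (\<forall>\<^sub>F i in F. \<bar>GG i M - 1\<bar> < \<theta>) \<and> (0 < M \<and> c < 1 - M powr - a / a)
      \<and> t0 < M \<and> M powr - a < \<theta>"
    using G_at_large[OF th] order_tendstoD(2)[OF l th] large_M[OF c(2)]
      eventually_gt_at_top[of t0] by eventually_elim simp
  then obtain M where M: "\<forall>\<^sub>F i in F. \<bar>GG i M - 1\<bar> < \<theta>" "0 < M" "c < 1 - M powr - a / a" "t0 < M"
      "M powr - a < \<theta>"
    using eventually_happens'[OF trivial_limit_at_top_linorder] by blast
  have "\<forall>\<^sub>F i in F. GG i t0 < 1 + \<theta>" using G_lim[OF t0] th by (intro order_tendstoD(2)) auto
  then show ?thesis using M(1) y_lower'[OF M(2,3)] A_less[OF t0] B_gt[of M] arcs N_end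
  proof eventually_elim
    case (elim i)
    then interpret rising_arc a "e i" "y i" "w i" "A i" "B i" by simp
    have yM: "y i M powr - a \<le> 1 + \<theta>" 
      using powr_mono2'[of "- a" c "y i M"] a_pos c elim by auto
    show ?case
    proof
      fix t assume t: "t \<in> {t0..B i}"
      have y01: "0 < y i t" "y i t \<le> 1" using y_le_1[of t] y_pos'[of t] elim t by auto
      have tt: "t powr - a \<le> t0 powr - a" using t t0 a_pos by (intro powr_mono2') auto
      have q0: "1 \<le> y i t powr - a"
        using powr_mono2'[of "- a" "y i t" 1] a_pos y01 by auto
      have main: "\<bar>y i t powr - a - 1 - t powr - a\<bar> \<le> \<theta> * (2 + t0 powr - a)"
      proof (cases "t \<le> M")
        case True
        have d: "0 \<le> t powr - a - M powr - a"
          using True t t0 a_pos powr_mono2'[of "- a" t M] by simp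
        have d': "t powr - a - M powr - a \<le> t0 powr - a"
          using tt powr_ge_zero[of M "- a"] by linarith
        have "GG i x \<le> 1 + \<theta>" if "t < x" "x < M" for x
          using G_antimono[of t0 x] that t elim by auto
        then have up: "y i t powr - a \<le> y i M powr - a + (1 + \<theta>) * (t powr - a - M powr - a)"
          using True t elim by (intro y_powr_le) auto
        have "1 - \<theta> \<le> GG i x" if "t < x" "x < M" for x
          using G_antimono[of x M] that t elim by auto
        then have lo: "y i M powr - a + (1 - \<theta>) * (t powr - a - M powr - a) \<le> y i t powr - a"
          using True t elim by (intro y_powr_ge) auto
        have "1 \<le> y i M powr - a"
          using powr_mono2'[of "- a" "y i M" 1] a_pos y_le_1[of M] y_pos'[of M] elim M by auto
        moreover define D where "D = t powr - a - M powr - a"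
        moreover have "\<theta> * D \<le> \<theta> * t0 powr - a"
          using d' th unfolding D_def by (intro mult_left_mono) auto
        moreover have "0 \<le> M powr - a" by simp
        moreover have "\<theta> * (2 + t0 powr - a) = 2 * \<theta> + \<theta> * t0 powr - a"
          by (simp add: algebra_simps)
        moreover have "y i t powr - a \<le> y i M powr - a + (D + \<theta> * D)"
          using up by (simp only: D_def[symmetric] distrib_right mult_1_left)
        moreover have "y i M powr - a + (D - \<theta> * D) \<le> y i t powr - a"
          using lo by (simp only: D_def[symmetric] left_diff_distrib mult_1_left)
        ultimately show ?thesis using yM M(5) unfolding abs_le_iff by (intro conjI; argo)
      next
        case False
        have "y i t powr - a \<le> y i M powr - a"
          using False t elim a_pos y_mono[of M t] c M by (intro powr_mono2') auto
        moreover have "t powr - a \<le> M powr - a" using False M a_pos by (intro powr_mono2') auto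
        moreover have "\<theta> * 1 \<le> \<theta> * (2 + t0 powr - a)"
          using th powr_ge_zero[of t0 "- a"] by (intro mult_left_mono) linarith+
        ultimately show ?thesis using yM q0 M powr_ge_zero[of t "- a"] by linarith
      qed
      then show "\<bar>y i t powr - a - 1 - t powr - a\<bar> \<le> \<eta>" by (simp add: th_eta)
    qed
  qed
qed

lemma y_powr_lim:
  assumes t: "0 < t"
  shows "((\<lambda>i. y i t powr - a) \<longlongrightarrow> 1 + t powr - a) F"
proof (rule tendstoI)
  fix \<eta> :: real assume "0 < \<eta>"
  then have "0 < \<eta> / 2" by simp
  from y_profile_uniform[OF t this] B_gt[of t]
  show "\<forall>\<^sub>F i in F. dist (y i t powr - a) (1 + t powr - a) < \<eta>"
  proof eventually_elim
    case (elim i)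
    then have "\<bar>y i t powr - a - 1 - t powr - a\<bar> \<le> \<eta> / 2" by auto
    then show ?case using \<open>0 < \<eta>\<close> unfolding dist_real_def by linarith
  qed
qed

lemma w_lim:
  assumes t: "0 < t"
  shows "((\<lambda>i. w i t) \<longlongrightarrow> (1 + t powr a) powr (- (1 + a) / a)) F"
proof -
  have pos: "0 < 1 + t powr - a" "0 < 1 + t powr a" by (simp_all add: add_pos_nonneg)
  have "((\<lambda>i. GG i t * t powr (- 1 - a) * (y i t powr - a) powr (- (1 + a) / a))
      \<longlongrightarrow> 1 * t powr (- 1 - a) * (1 + t powr - a) powr (- (1 + a) / a)) F"
    using pos by (intro tendsto_intros G_lim y_powr_lim t) auto
  moreover have "1 * t powr (- 1 - a) * (1 + t powr - a) powr (- (1 + a) / a)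
      = (1 + t powr a) powr (- (1 + a) / a)"
  proof -
    have "t powr (- 1 - a) = (t powr a) powr (- (1 + a) / a)"
      using a_pos by (simp add: powr_powr)
    moreover have "t powr a * (1 + t powr - a) = 1 + t powr a"
      using t powr_add[of t a "- a"] by (simp add: algebra_simps)
    ultimately show ?thesis
      using powr_mult[of "t powr a" "1 + t powr - a"] by simp
  qed
  moreover have "\<forall>\<^sub>F i in F. GG i t * t powr (- 1 - a) * (y i t powr - a) powr (- (1 + a) / a) = w i t"
    using arcs A_less[OF t] B_gt[of t]
  proof eventually_elim
    case (elim i)
    then interpret rising_arc a "e i" "y i" "w i" "A i" "B i" by simp
    have y0: "0 < y i t" using y_pos'[of t] elim by auto
    have "(y i t powr - a) powr (- (1 + a) / a) = y i t powr (1 + a)"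
      using a_pos by (simp add: powr_powr add.commute)
    moreover have "y i t powr (- 1 - a) * y i t powr (1 + a) = 1" "t powr (1 + a) * t powr (- 1 - a) = 1"
      using y0 powr_add[of "y i t" "- 1 - a" "1 + a"] t powr_add[of t "1 + a" "- 1 - a"] by simp_all
    ultimately show ?case unfolding bubble_ratio_def by (simp add: mult_ac)
  qed
  ultimately show ?thesis using Lim_transform_eventually by fastforce
qed

text \<open>Since \<open>G\<close> decreases, \<open>G \<ge> 1/2\<close> at a single fixed point \<open>t0\<close> gives it at all points to the left, down to the
  zero of \<open>y\<close>; integrated, this is a linear bound without any information on the slope at the zero.\<close>
lemma y_linear_bound:
  assumes t0: "0 < t0"
  shows "\<forall>\<^sub>F i in F. \<forall>s. A i < s \<and> s \<le> t0 \<longrightarrow> y i s \<le> 2 powr (1 / a) * s"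
proof -
  have "\<forall>\<^sub>F i in F. 1 / 2 < GG i t0" using G_lim[OF t0] by (rule order_tendstoD) simp
  moreover have "\<forall>\<^sub>F i in F. t0 powr - a < y i t0 powr - a"
    using y_powr_lim[OF t0] by (rule order_tendstoD) simp
  ultimately show ?thesis
    using arcs A_less[OF t0] B_gt[of t0] N_end
  proof eventually_elim
    case (elim i)
    then interpret rising_arc a "e i" "y i" "w i" "A i" "B i" by simp
    show ?case
    proof (intro allI impI)
      fix s assume s: "A i < s \<and> s \<le> t0"
      then have s0: "0 < s" using A_pos by auto
      have "1 / 2 \<le> GG i x" if "s < x" "x < t0" for x
        using G_antimono[of x t0] that s elim by auto
      then have "y i t0 powr - a + 1 / 2 * (s powr - a - t0 powr - a) \<le> y i s powr - a"
        using s elim by (intro y_powr_ge) auto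
      then have *: "1 / 2 * s powr - a \<le> y i s powr - a"
        using elim powr_ge_zero[of t0 "- a"] by argo
      have "(y i s powr - a) powr (- 1 / a) \<le> (1 / 2 * s powr - a) powr (- 1 / a)"
        using * s0 a_pos by (intro powr_mono2') auto
      also have "\<dots> = (1 / 2) powr (- 1 / a) * s"
        using s0 a_pos by (subst powr_mult) (simp_all add: powr_powr)
      also have "(1 / 2) powr (- 1 / a) = (2::real) powr (1 / a)"
        by (simp add: powr_divide powr_minus_divide)
      also have "(y i s powr - a) powr (- 1 / a) = y i s"
        using y_pos'[of s] s elim a_pos by (simp add: powr_powr)
      finally show "y i s \<le> 2 powr (1 / a) * s" .
    qed
  qed
qed

lemma e_small: "0 < c \<Longrightarrow> \<forall>\<^sub>F i in F. e i < c"
  using e_lim by (rule order_tendstoD)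

text \<open>The bubble has slope \<open>1\<close> at \<open>t = 0\<close>. The linear bound keeps the slope from changing between the zero
  and a small fixed \<open>t\<close>, where \<open>w_lim\<close> applies.\<close>
lemma slope_lim: "((\<lambda>i. w i (A i)) \<longlongrightarrow> 1) F"
proof (rule tendstoI)
  fix \<eta> :: real assume eta: "0 < \<eta>"
  define C where "C = (2::real) powr (1 / a)"
  have C: "1 \<le> C" using a_pos by (simp add: C_def ge_one_powr_ge_zero)
  define K where "K = (1 + a) * C powr (1 + 2 * a)"
  have "((\<lambda>t. (1 + t powr a) powr (- (1 + a) / a)) \<longlongrightarrow> (1 + 0) powr (- (1 + a) / a)) (at_right 0)"
    using a_pos by (intro tendsto_intros powr_at_right_0_lim) auto
  then have l1: "\<forall>\<^sub>F t in at_right 0. dist ((1 + t powr a) powr (- (1 + a) / a)) 1 < \<eta> / 4"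
    using eta by (intro tendstoD) auto
  have "((\<lambda>t. K * t powr (a / 2) / (a / 2)) \<longlongrightarrow> K * 0 / (a / 2)) (at_right 0)"
    using a_pos by (intro tendsto_intros powr_at_right_0_lim) auto
  then have l2: "\<forall>\<^sub>F t in at_right 0. K * t powr (a / 2) / (a / 2) < \<eta> / 4"
    using eta by (intro order_tendstoD(2)) auto
  have "\<forall>\<^sub>F t in at_right 0. dist ((1 + t powr a) powr (- (1 + a) / a)) 1 < \<eta> / 4 \<and>
      K * t powr (a / 2) / (a / 2) < \<eta> / 4 \<and> 0 < t \<and> t < (1::real)"
    using l1 l2 eventually_at_right_real[OF zero_less_one] by eventually_elim auto
  then obtain t where t: "dist ((1 + t powr a) powr (- (1 + a) / a)) 1 < \<eta> / 4"
      "K * t powr (a / 2) / (a / 2) < \<eta> / 4" "0 < t" "t < (1::real)"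
    using eventually_happens'[OF trivial_limit_at_right_real] by blast
  have "\<forall>\<^sub>F i in F. dist (w i t) ((1 + t powr a) powr (- (1 + a) / a)) < \<eta> / 4"
    using w_lim[OF t(3)] eta by (intro tendstoD) auto
  then show "\<forall>\<^sub>F i in F. dist (w i (A i)) 1 < \<eta>"
    using arcs A_less[OF t(3)] B_gt[of t] y_linear_bound[OF t(3)] e_small[OF half_gt_zero[OF a_pos]]
  proof (eventually_elim)
    case (elim i)
    then interpret rising_arc a "e i" "y i" "w i" "A i" "B i" by simp
    have "w i t \<le> w i (A i)" using w_antimono[of "A i" t] elim by auto
    moreover have "w i (A i) \<le> w i t + (1 + a) * C powr (1 + 2 * a - e i) * t powr (a - e i) / (a - e i)"
      using elim C a_pos by (intro slope_le) (auto simp: C_def)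
    moreover have "(1 + a) * C powr (1 + 2 * a - e i) * t powr (a - e i) / (a - e i)
        \<le> K * t powr (a / 2) / (a / 2)"
    proof (rule frac_le)
      show "(1 + a) * C powr (1 + 2 * a - e i) * t powr (a - e i) \<le> K * t powr (a / 2)"
        unfolding K_def using a_pos C e_nonneg t elim
        by (intro mult_mono powr_mono powr_mono') auto
    qed (use elim a_pos in \<open>auto simp: K_def\<close>)
    ultimately show ?case using elim t unfolding dist_real_def by linarith
  qed
qed

text \<open>The hypothesis of \<open>N_drop\<close>. To the left of a small \<open>t0\<close> both terms are small by the linear
  bound. To the right, \<open>q = y\<^bsup>-a\<^esup> - 1\<close> is uniformly close to \<open>t\<^bsup>-a\<^esup>\<close> and the two terms are \<open>y\<^bsup>1+2a\<^esup> q\<^bsup>1+1/a\<^esup>\<close> and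
  \<open>y\<^bsup>1+2a-e\<^esup> (t\<^bsup>-a\<^esup>)\<^bsup>1+1/a\<^esup>\<close>.\<close>
lemma action_kernel_close:
  assumes eta: "0 < \<eta>"
  shows "\<forall>\<^sub>F i in F. \<forall>t. A i < t \<and> t < B i \<longrightarrow>
    \<bar>y i t powr a * (1 - y i t powr a) powr (1 + 1 / a)
       - t powr (- 1 - a) * y i t powr (1 + 2 * a - e i)\<bar> \<le> \<eta>"
proof -
  define C where "C = (2::real) powr (1 / a)"
  have C: "1 \<le> C" using a_pos by (simp add: C_def ge_one_powr_ge_zero)
  have "((\<lambda>t. C powr (1 + 2 * a) * t powr (a / 2)) \<longlongrightarrow> C powr (1 + 2 * a) * 0) (at_right 0)"
    using a_pos by (intro tendsto_intros powr_at_right_0_lim) auto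
  then have "\<forall>\<^sub>F t in at_right 0. C powr (1 + 2 * a) * t powr (a / 2) < \<eta>"
    using eta by (intro order_tendstoD(2)) auto
  then have "\<forall>\<^sub>F t in at_right 0. C powr (1 + 2 * a) * t powr (a / 2) < \<eta> \<and> 0 < t \<and> t < (1::real)"
    using eventually_at_right_real[OF zero_less_one] by eventually_elim auto
  then obtain t0 where t0: "C powr (1 + 2 * a) * t0 powr (a / 2) < \<eta>" "0 < t0" "t0 < (1::real)"
    using eventually_happens'[OF trivial_limit_at_right_real] by blast
  define K where "K = t0 powr - a + 1"
  have K: "1 \<le> K" by (simp add: K_def)
  have "uniformly_continuous_on {0..K} (\<lambda>x::real. x powr (1 + 1 / a))"
    using a_pos by (intro compact_uniformly_continuous continuous_on_powr' continuous_intros)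
      (auto simp: add_pos_pos)
  then obtain d where d: "0 < d" and uc: "\<And>x x'. x \<in> {0..K} \<Longrightarrow> x' \<in> {0..K} \<Longrightarrow> dist x' x < d
      \<Longrightarrow> dist (x' powr (1 + 1 / a)) (x powr (1 + 1 / a)) < \<eta> / 2"
    unfolding uniformly_continuous_on_def using eta by (metis half_gt_zero)
  define d' where "d' = min (d / 2) 1"
  have d': "0 < d'" "d' < d" "d' \<le> 1" using d by (auto simp: d'_def)
  \<comment> \<open>lower bound for \<open>y\<close> on \<open>[t0, B]\<close>, from \<open>y_profile_uniform\<close> with error \<open>d' \<le> 1\<close> at \<open>t0\<close>\<close>
  define y0 where "y0 = (2 + t0 powr - a) powr (- 1 / a)"
  have y0: "0 < y0" unfolding y0_def using add_pos_nonneg[of 2 "t0 powr - a"] by simp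
  have "((\<lambda>i. t0 powr (- 1 - a) * (1 - y0 powr e i)) \<longlongrightarrow> t0 powr (- 1 - a) * (1 - y0 powr 0)) F"
    using y0 by (intro tendsto_intros e_lim) auto
  then have "\<forall>\<^sub>F i in F. t0 powr (- 1 - a) * (1 - y0 powr e i) < \<eta> / 2"
    using eta y0 by (intro order_tendstoD(2)) auto
  then show ?thesis
    using arcs B_gt[of t0] y_profile_uniform[OF t0(2) d'(1)] y_linear_bound[OF t0(2)] e_small[OF half_gt_zero[OF a_pos]]
      A_less[OF t0(2)]
  proof eventually_elim
    case (elim i)
    then interpret rising_arc a "e i" "y i" "w i" "A i" "B i" by simp
    show ?case
    proof (intro allI impI)
      fix t assume t: "A i < t \<and> t < B i"
      have tp: "0 < t" using t A_pos by auto
      have yp: "0 < y i t" "y i t < 1" using t y_pos y_less_1 by auto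
      have pe: "0 \<le> y i t powr a" "y i t powr a \<le> 1" using yp a_pos by (auto intro!: powr_le1)
      define X where "X = y i t powr a * (1 - y i t powr a) powr (1 + 1 / a)"
      define Y where "Y = t powr (- 1 - a) * y i t powr (1 + 2 * a - e i)"
      have "\<bar>X - Y\<bar> \<le> \<eta>"
      proof (cases "t \<le> t0")
        case True
        have yC: "y i t \<le> C * t" using elim True t by (auto simp: C_def)
        have Ct: "t powr a \<le> t0 powr (a / 2)"
        proof -
          have "t powr a \<le> t powr (a / 2)" using tp True t0 a_pos by (intro powr_mono') auto
          also have "\<dots> \<le> t0 powr (a / 2)" using tp True a_pos by (intro powr_mono2) auto
          finally show ?thesis .
        qed
        have "X \<le> y i t powr a * 1"
          unfolding X_def using pe a_pos by (intro mult_left_mono powr_le1) (auto simp: add_nonneg_nonneg)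
        also have "\<dots> \<le> (C * t) powr a" using yC yp a_pos by (simp add: powr_mono2)
        also have "\<dots> = C powr a * t powr a" by (simp add: powr_mult)
        also have "\<dots> \<le> C powr (1 + 2 * a) * t0 powr (a / 2)"
          using C a_pos Ct by (intro mult_mono powr_mono) auto
        finally have X: "X \<le> \<eta>" using t0 by simp
        have "Y \<le> t powr (- 1 - a) * (C * t) powr (1 + 2 * a - e i)"
          unfolding Y_def using yC yp e_less by (intro mult_left_mono powr_mono2) auto
        also have "\<dots> = C powr (1 + 2 * a - e i) * (t powr (- 1 - a) * t powr (1 + 2 * a - e i))"
          by (simp add: powr_mult)
        also have "\<dots> = C powr (1 + 2 * a - e i) * t powr (a - e i)"
          by (simp add: powr_add[symmetric])
        also have "\<dots> \<le> C powr (1 + 2 * a) * t0 powr (a / 2)"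
        proof (intro mult_mono powr_mono)
          have "t powr (a - e i) \<le> t powr (a / 2)" using tp True t0 elim by (intro powr_mono') auto
          also have "\<dots> \<le> t0 powr (a / 2)" using tp True a_pos by (intro powr_mono2) auto
          finally show "t powr (a - e i) \<le> t0 powr (a / 2)" .
        qed (use C e_nonneg in auto)
        finally have Y: "Y \<le> \<eta>" using t0 by simp
        have "0 \<le> X" "0 \<le> Y" unfolding X_def Y_def by auto
        then show ?thesis using X Y by linarith
      next
        case False
        define q where "q = y i t powr - a - 1"
        have q: "\<bar>q - t powr - a\<bar> \<le> d'" using elim False t by (auto simp: q_def)
        have tt: "0 \<le> t powr - a" "t powr - a \<le> t0 powr - a"
          using False t0 a_pos by (auto intro: powr_mono2')
        have q0: "0 \<le> q" using powr_mono2'[of "- a" "y i t" 1] a_pos yp by (auto simp: q_def)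
        have "dist (q powr (1 + 1 / a)) ((t powr - a) powr (1 + 1 / a)) < \<eta> / 2"
          using q q0 tt d' by (intro uc) (auto simp: K_def dist_real_def)
        moreover have "(t powr - a) powr (1 + 1 / a) = t powr (- 1 - a)"
          using a_pos by (simp add: powr_powr algebra_simps)
        ultimately have q2: "\<bar>q powr (1 + 1 / a) - t powr (- 1 - a)\<bar> \<le> \<eta> / 2"
          by (simp add: dist_real_def)
        have X: "X = y i t powr (1 + 2 * a) * q powr (1 + 1 / a)"
        proof -
          have "y i t powr a * q = 1 - y i t powr a"
            using yp powr_add[of "y i t" a "- a"] by (simp add: q_def algebra_simps)
          then have "(1 - y i t powr a) powr (1 + 1 / a) = (y i t powr a) powr (1 + 1 / a) * q powr (1 + 1 / a)"
            by (simp flip: powr_mult)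
          also have "(y i t powr a) powr (1 + 1 / a) = y i t powr (1 + a)"
            using a_pos by (simp add: powr_powr algebra_simps)
          finally show ?thesis unfolding X_def by (simp add: mult.assoc[symmetric] powr_add[symmetric] add.commute)
        qed
        have p1: "y i t powr (1 + 2 * a) \<le> 1" using yp a_pos by (intro powr_le1) auto
        have "\<bar>X - y i t powr (1 + 2 * a) * t powr (- 1 - a)\<bar>
            = y i t powr (1 + 2 * a) * \<bar>q powr (1 + 1 / a) - t powr (- 1 - a)\<bar>"
          unfolding X by (simp add: abs_mult flip: right_diff_distrib)
        also have "\<dots> \<le> 1 * (\<eta> / 2)" using p1 q2 by (intro mult_mono) auto
        finally have 1: "\<bar>X - y i t powr (1 + 2 * a) * t powr (- 1 - a)\<bar> \<le> \<eta> / 2" by simp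
        have ylow: "y0 \<le> y i t"
        proof -
          have "\<bar>y i t0 powr - a - 1 - t0 powr - a\<bar> \<le> d'" using elim by auto
          then have "y i t0 powr - a \<le> 2 + t0 powr - a" using d' by linarith
          then have "y0 \<le> (y i t0 powr - a) powr (- 1 / a)"
            unfolding y0_def using a_pos y_pos'[of t0] elim by (intro powr_mono2') auto
          also have "\<dots> = y i t0" using a_pos y_pos'[of t0] elim by (simp add: powr_powr)
          also have "\<dots> \<le> y i t" using False t elim by (intro y_mono) auto
          finally show ?thesis .
        qed
        have "y i t powr (1 + 2 * a) = y i t powr (1 + 2 * a - e i) * y i t powr e i"
          by (simp add: powr_add[symmetric])
        then have "Y - y i t powr (1 + 2 * a) * t powr (- 1 - a)
            = (t powr (- 1 - a) * y i t powr (1 + 2 * a - e i)) * (1 - y i t powr e i)"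
          by (simp add: Y_def algebra_simps)
        moreover have "\<bar>(t powr (- 1 - a) * y i t powr (1 + 2 * a - e i)) * (1 - y i t powr e i)\<bar> 
             \<le> t0 powr (- 1 - a) * 1 * (1 - y0 powr e i)"
        proof -
          have "y0 powr e i \<le> y i t powr e i" "y i t powr e i \<le> 1"
            using ylow y0 e_nonneg yp by (auto intro: powr_mono2 powr_le1)
          moreover have "t powr (- 1 - a) \<le> t0 powr (- 1 - a)"
            using False t0 a_pos by (intro powr_mono2') auto
          moreover have "y i t powr (1 + 2 * a - e i) \<le> 1" using y_powr_le_1[of t] t by auto
          ultimately have "(t powr (- 1 - a) * y i t powr (1 + 2 * a - e i)) * (1 - y i t powr e i)
              \<le> t0 powr (- 1 - a) * 1 * (1 - y0 powr e i)" by (intro mult_mono) auto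
          then show ?thesis using \<open>y i t powr e i \<le> 1\<close> by (simp add: abs_mult)
        qed
        ultimately have 2: "\<bar>Y - y i t powr (1 + 2 * a) * t powr (- 1 - a)\<bar> \<le> \<eta> / 2"
          using elim(1) by simp
        show ?thesis using 1 2 by linarith
      qed
      then show "\<bar>y i t powr a * (1 - y i t powr a) powr (1 + 1 / a)
          - t powr (- 1 - a) * y i t powr (1 + 2 * a - e i)\<bar> \<le> \<eta>"
        by (simp add: X_def Y_def)
    qed
  qed
qed

text \<open>Across one rising arc the Pohozaev function gains, per unit of \<open>e\<close>, the action of a full bubble.\<close>
lemma N_gain: "((\<lambda>i. (NN i (A i) - NN i (B i)) / e i) \<longlongrightarrow> bubble_action a 1) F"
proof -
  have "((\<lambda>i. bubble_action a (y i (B i))) \<longlongrightarrow> bubble_action a 1) F"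
  proof (rule continuous_on_tendsto_compose[of "{0..1}" "bubble_action a"])
    show "continuous_on {0..1} (bubble_action a)"
      using a_pos by (rule continuous_bubble_action)
    show "\<forall>\<^sub>F i in F. y i (B i) \<in> {0..1}" using arcs
    proof eventually_elim
      case (elim i)
      then interpret rising_arc a "e i" "y i" "w i" "A i" "B i" by simp
      show ?case using y_end y_nonneg[of "B i"] A_less_B by auto
    qed
  qed (use y_end_lim in auto)
  moreover have "((\<lambda>i. (NN i (A i) - NN i (B i)) / e i - bubble_action a (y i (B i))) \<longlongrightarrow> 0) F"
  proof (rule tendstoI)
    fix \<eta> :: real assume eta: "0 < \<eta>"
    then have "0 < \<eta> / 2" by simp
    from action_kernel_close[OF this] arcs y_start e_pos
    show "\<forall>\<^sub>F i in F. dist ((NN i (A i) - NN i (B i)) / e i - bubble_action a (y i (B i))) 0 < \<eta>"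
    proof eventually_elim
      case (elim i)
      then interpret rising_arc a "e i" "y i" "w i" "A i" "B i" by simp
      have "\<bar>NN i (A i) - NN i (B i) - e i * (bubble_action a (y i (B i)) - bubble_action a 0)\<bar>
          \<le> e i * (\<eta> / 2)"
        using elim by (intro N_drop) auto
      also have "\<dots> < e i * \<eta>" using elim eta by simp
      finally have *: "\<bar>NN i (A i) - NN i (B i) - e i * bubble_action a (y i (B i))\<bar> < e i * \<eta>"
        using a_pos by (simp add: bubble_action_0)
      have "\<bar>(NN i (A i) - NN i (B i)) / e i - bubble_action a (y i (B i))\<bar>
         = \<bar>NN i (A i) - NN i (B i) - e i * bubble_action a (y i (B i))\<bar> / e i"
        using elim by (simp add: field_simps)
      also have "\<dots> < \<eta>" using * elim by (simp add: pos_divide_less_eq mult.commute)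
      finally show ?case by (simp add: dist_real_def)
    qed
  qed
  ultimately have "((\<lambda>i. ((NN i (A i) - NN i (B i)) / e i - bubble_action a (y i (B i)))
      + bubble_action a (y i (B i))) \<longlongrightarrow> 0 + bubble_action a 1) F"
    by (intro tendsto_add)
  then show ?thesis by simp
qed

end

section \<open>Falling arcs\<close>

lemma powr_neg_powr_divide:
  fixes a :: real
  assumes "0 < a"
  shows "(x powr (- 1 - a)) powr (c / (1 + a)) = x powr - c"
proof -
  have "(- 1 - a) * (c / (1 + a)) = - ((1 + a) * (c / (1 + a)))" by (simp only: minus_mult_left) simp
  also have "(1 + a) * (c / (1 + a)) = c" using assms by simp
  finally show ?thesis by (simp only: powr_powr)
qed

text \<open>A falling arc runs from the normalised maximum at \<open>A\<close> down to the next zero at \<open>B\<close>. In the regime of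
  interest \<open>A\<close> is large, the nonlinearity acts only near \<open>A\<close>, and \<open>y\<close> is essentially the straight
  line from height \<open>1\<close> to \<open>B\<close>.\<close>
locale falling_arc = positive_arc +
  assumes y_start: "y A = 1" and w_start: "w A = 0" and y_stop: "y B = 0"
begin

lemma w_nonpos: "A \<le> t \<Longrightarrow> t \<le> B \<Longrightarrow> w t \<le> 0"
  using w_antimono[of A t] w_start by auto

lemma slope_pos: "w B < 0"
  using w_strict_antimono[of A B] w_start A_less_B by auto

lemma y_le_1: "A \<le> t \<Longrightarrow> t \<le> B \<Longrightarrow> y t \<le> 1"
  using nonincreasing_by_derivative[OF cont_y _ _ _ deriv_y, of A t] w_nonpos y_start by auto

lemma y_powr_le_1: "A \<le> t \<Longrightarrow> t \<le> B \<Longrightarrow> y t powr (1 + 2 * a - e) \<le> 1"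
  using y_nonneg y_le_1 e_less by (intro powr_le1) auto

lemma y_ge_line:
  assumes t: "A \<le> t" "t \<le> B"
  shows "1 + w B * (t - A) \<le> y t"
proof -
  have "y A - w B * A \<le> y t - w B * t"
    by (rule nondecreasing_by_derivative[of A B "\<lambda>t. y t - w B * t" A t "\<lambda>x. w x - w B"])
       (use t w_antimono in \<open>auto intro!: continuous_intros derivative_eq_intros cont_y deriv_y\<close>)
  then show ?thesis using y_start by (simp add: algebra_simps)
qed

lemma slope_times_length: "1 \<le> - w B * (B - A)"
  using y_ge_line[of B] A_less_B y_stop by (simp add: algebra_simps)

lemma slope_times_end: "1 \<le> - w B * B"
proof -
  have "- w B * (B - A) \<le> - w B * B" using slope_pos A_pos by (intro mult_left_mono) auto
  then show ?thesis using slope_times_length by linarith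
qed

lemma slope_le: "- w B \<le> A powr (- 1 - a)"
proof -
  have "w A - A powr (- 1 - a) \<le> w B - B powr (- 1 - a)"
  proof (rule nondecreasing_by_derivative[of A B "\<lambda>t. w t - t powr (- 1 - a)"])
    show "continuous_on {A..B} (\<lambda>t. w t - t powr (- 1 - a))"
      by (intro continuous_intros cont_w continuous_intros_arc)
    show "((\<lambda>t. w t - t powr (- 1 - a)) has_real_derivative
       (1 + a) * (x powr (- 2 - a) * (1 - y x powr (1 + 2 * a - e)))) (at x)" if x: "A < x" "x < B" for x
    proof -
      have p: "((\<lambda>t. t powr (- 1 - a)) has_real_derivative (- 1 - a) * x powr (- 2 - a)) (at x)"
        using x A_pos by (intro deriv_powr) auto
      show ?thesis
        by (rule p deriv_w[OF x] derivative_eq_intros refl)+ (simp add: algebra_simps)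
    qed
    show "0 \<le> (1 + a) * (x powr (- 2 - a) * (1 - y x powr (1 + 2 * a - e)))" if x: "A < x" "x < B" for x
      using y_powr_le_1[of x] x a_pos by auto
  qed (use A_less_B in auto)
  moreover have "0 \<le> B powr (- 1 - a)" by simp
  ultimately show ?thesis using w_start by linarith
qed

text \<open>On \<open>[A, A + \<theta> / \<bar>w B\<bar>]\<close> the solution stays above \<open>1 - \<theta>\<close>, by concavity; the equation integrated over
  this interval already produces nearly all of the final slope.\<close>
lemma slope_ge:
  assumes th: "0 < \<theta>" "\<theta> < 1"
  shows "(1 - \<theta>) powr (1 + 2 * a) * A powr (- 1 - a) \<le> - w B + (- w B / \<theta>) powr (1 + a)"
proof -
  define s where "s = - w B"
  have s: "0 < s" using slope_pos by (simp add: s_def)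
  define D where "D = A + \<theta> / s"
  have "\<theta> / s \<le> 1 / s" using th s by (simp add: divide_right_mono)
  also have "1 / s \<le> B - A" using slope_times_length s by (simp add: s_def field_simps)
  finally have D: "A < D" "D \<le> B" using th s by (auto simp: D_def)
  define K where "K = (1 - \<theta>) powr (1 + 2 * a)"
  have K: "0 \<le> K" "K \<le> 1" using th a_pos by (auto simp: K_def intro!: powr_le1)
  have "w D - K * D powr (- 1 - a) \<le> w A - K * A powr (- 1 - a)"
  proof (rule nonincreasing_by_derivative[of A B "\<lambda>t. w t - K * t powr (- 1 - a)"])
    show "continuous_on {A..B} (\<lambda>t. w t - K * t powr (- 1 - a))"
      by (intro continuous_intros cont_w continuous_intros_arc)
    show "((\<lambda>t. w t - K * t powr (- 1 - a)) has_real_derivative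
       (1 + a) * (x powr (- 2 - a) * (K - y x powr (1 + 2 * a - e)))) (at x)" if x: "A < x" "x < B" for x
    proof -
      have p: "((\<lambda>t. t powr (- 1 - a)) has_real_derivative (- 1 - a) * x powr (- 2 - a)) (at x)"
        using x A_pos by (intro deriv_powr) auto
      show ?thesis
        by (rule p deriv_w[OF x] derivative_eq_intros refl)+ (simp add: algebra_simps)
    qed
    show "(1 + a) * (x powr (- 2 - a) * (K - y x powr (1 + 2 * a - e))) \<le> 0" if x: "A < x" "x < D" for x
    proof -
      have "s * (x - A) \<le> s * (\<theta> / s)" using x s by (intro mult_left_mono) (auto simp: D_def)
      then have "1 - \<theta> \<le> y x" using y_ge_line[of x] x D s by (simp add: s_def)
      then have "K \<le> y x powr (1 + 2 * a)" unfolding K_def using th a_pos by (intro powr_mono2) auto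
      also have "\<dots> \<le> y x powr (1 + 2 * a - e)"
        using y_nonneg[of x] y_le_1[of x] x D e_nonneg by (intro powr_mono') auto
      finally show ?thesis using a_pos by (auto simp: mult_le_0_iff)
    qed
  qed (use D in auto)
  then have "K * A powr (- 1 - a) \<le> - w D + K * D powr (- 1 - a)" using w_start by simp
  also have "- w D \<le> s" using w_antimono[of D B] D by (auto simp: s_def)
  also have "K * D powr (- 1 - a) \<le> 1 * (\<theta> / s) powr (- 1 - a)"
    using K D A_pos th s a_pos by (intro mult_mono powr_mono2') (auto simp: D_def)
  also have "(\<theta> / s) powr (- 1 - a) = (s / \<theta>) powr (1 + a)"
    using powr_minus[of "\<theta> / s" "1 + a"] th s by (simp add: powr_divide)
  finally show ?thesis by (simp add: K_def s_def)
qed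

text \<open>\<open>y - t w\<close>, the height at which the tangent meets the axis \<open>t = 0\<close>, increases by at most
  \<open>(1 + a) A\<^bsup>-a\<^esup> / a\<close>; at \<open>A\<close> it is \<open>1\<close> and at \<open>B\<close> it is \<open>- B w\<close>.\<close>
lemma slope_times_end_le: "- w B * B \<le> 1 + (1 + a) / a * A powr - a"
proof -
  have "y B - B * w B + (1 + a) / a * B powr - a \<le> y A - A * w A + (1 + a) / a * A powr - a"
  proof (rule nonincreasing_by_derivative[of A B "\<lambda>t. y t - t * w t + (1 + a) / a * t powr - a"])
    show "continuous_on {A..B} (\<lambda>t. y t - t * w t + (1 + a) / a * t powr - a)"
      by (intro continuous_intros cont_w cont_y continuous_intros_arc)
    show "((\<lambda>t. y t - t * w t + (1 + a) / a * t powr - a) has_real_derivative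
       (1 + a) * (x powr (- 1 - a) * (y x powr (1 + 2 * a - e) - 1))) (at x)" if x: "A < x" "x < B" for x
    proof -
      have p: "((\<lambda>t. t powr - a) has_real_derivative (- a) * x powr (- 1 - a)) (at x)"
        using x A_pos by (intro deriv_powr) auto
      have xx: "x powr (- 1 - a) = x * x powr (- 2 - a)"
        using x A_pos powr_add[of x 1 "- 2 - a"] by simp
      have d: "((\<lambda>t. y t - t * w t + (1 + a) / a * t powr - a) has_real_derivative
        w x - (w x + x * - ((1 + a) * (x powr (- 2 - a) * y x powr (1 + 2 * a - e))))
        + (1 + a) / a * ((- a) * x powr (- 1 - a))) (at x)"
        by (rule derivative_eq_intros p deriv_w[OF x] deriv_y[OF x] refl | simp)+
      show ?thesis
        by (rule DERIV_cong[OF d]) (use a_pos in \<open>simp add: xx field_simps\<close>)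
    qed
    show "(1 + a) * (x powr (- 1 - a) * (y x powr (1 + 2 * a - e) - 1)) \<le> 0" if x: "A < x" "x < B" for x
      using y_powr_le_1[of x] x a_pos by (auto simp: mult_le_0_iff)
  qed (use A_less_B in auto)
  moreover have "0 \<le> (1 + a) / a * B powr - a" using a_pos by simp
  ultimately show ?thesis using w_start y_start y_stop by (simp add: mult.commute)
qed

lemma N_start: "N A = A powr (- 1 - a)"
  by (simp add: pohozaev_def w_start y_start)

lemma N_stop: "N B = B * (w B)\<^sup>2"
  using e_less by (simp add: pohozaev_def y_stop)

lemma N_mono: "N A \<le> N B"
  by (rule nondecreasing_by_derivative[OF cont_N _ _ _ deriv_N])
     (use A_less_B e_nonneg w_nonpos in \<open>auto simp: mult_nonneg_nonpos\<close>)

lemma N_rise: "N B - N A \<le> e * A powr (- 1 - a)"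
proof -
  define K where "K = A powr (- 1 - a)"
  have "N B + e * K * y B \<le> N A + e * K * y A"
  proof (rule nonincreasing_by_derivative[of A B "\<lambda>t. N t + e * K * y t"])
    show "continuous_on {A..B} (\<lambda>t. N t + e * K * y t)"
      by (intro continuous_intros cont_N cont_y)
    show "((\<lambda>t. N t + e * K * y t) has_real_derivative
       e * w x * (K - x powr (- 1 - a) * y x powr (1 + 2 * a - e))) (at x)" if x: "A < x" "x < B" for x
      by (rule derivative_eq_intros deriv_N[OF x] deriv_y[OF x] refl | simp add: algebra_simps)+
    show "e * w x * (K - x powr (- 1 - a) * y x powr (1 + 2 * a - e)) \<le> 0" if x: "A < x" "x < B" for x
    proof -
      have "x powr (- 1 - a) * y x powr (1 + 2 * a - e) \<le> x powr (- 1 - a) * 1"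
        using y_powr_le_1[of x] x by (intro mult_left_mono) auto
      also have "\<dots> \<le> K" unfolding K_def
        using x A_pos a_pos by (simp add: powr_mono2')
      finally have "0 \<le> K - x powr (- 1 - a) * y x powr (1 + 2 * a - e)" by simp
      moreover have "e * w x \<le> 0" using e_nonneg w_nonpos[of x] x by (simp add: mult_nonneg_nonpos)
      ultimately show ?thesis by (rule mult_nonpos_nonneg[rotated])
    qed
  qed (use A_less_B in auto)
  then show ?thesis using y_start y_stop by (simp add: K_def)
qed

text \<open>The same bound in terms of data at the zero only, with \<open>A\<close> eliminated through the Pohozaev
  function. It yields the a priori bound on the height of the hump in \<open>falling_step\<close>.\<close>
lemma slope_times_end_le':
  "- w B * B \<le> 1 + (1 + a) / a * (B * (w B)\<^sup>2) powr (a / (1 + a))"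
proof -
  have "A powr - a = (A powr (- 1 - a)) powr (a / (1 + a))"
    using powr_neg_powr_divide[OF a_pos] by simp
  also have "\<dots> \<le> (B * (w B)\<^sup>2) powr (a / (1 + a))"
    using N_mono a_pos unfolding N_start N_stop by (intro powr_mono2) auto
  finally have "(1 + a) / a * A powr - a \<le> (1 + a) / a * (B * (w B)\<^sup>2) powr (a / (1 + a))"
    using a_pos by (intro mult_left_mono) auto
  then show ?thesis using slope_times_end_le by linarith
qed

end

text \<open>That \<open>t w\<^sup>2 \<rightarrow> 0\<close> at the zero is the only smallness assumption: it makes the slope tend to \<open>0\<close> and
  the maximum point tend to infinity.\<close>
locale falling_family =
  fixes F :: "'i filter" and a :: real and e :: "'i \<Rightarrow> real" and y w :: "'i \<Rightarrow> real \<Rightarrow> real"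
    and A B :: "'i \<Rightarrow> real"
  assumes a_pos: "0 < a"
    and arcs: "\<forall>\<^sub>F i in F. falling_arc a (e i) (y i) (w i) (A i) (B i)"
    and e_pos: "\<forall>\<^sub>F i in F. 0 < e i"
    and N_stop_lim: "((\<lambda>i. B i * (w i (B i))\<^sup>2) \<longlongrightarrow> 0) F"
begin

abbreviation "NN i \<equiv> pohozaev a (e i) (y i) (w i)"

lemma slope_lim: "((\<lambda>i. - w i (B i)) \<longlongrightarrow> 0) F"
proof (rule tendsto_sandwich[OF _ _ tendsto_const N_stop_lim])
  show "\<forall>\<^sub>F i in F. 0 \<le> - w i (B i)" using arcs
    by eventually_elim (use falling_arc.slope_pos in force)
  show "\<forall>\<^sub>F i in F. - w i (B i) \<le> B i * (w i (B i))\<^sup>2" using arcs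
  proof eventually_elim
    case (elim i)
    then interpret falling_arc a "e i" "y i" "w i" "A i" "B i" .
    have "- w i (B i) * 1 \<le> - w i (B i) * (- w i (B i) * B i)"
      using slope_times_end slope_pos by (intro mult_left_mono) auto
    then show ?case by (simp add: power2_eq_square mult_ac)
  qed
qed

lemma start_powr_lim: "((\<lambda>i. A i powr (- 1 - a)) \<longlongrightarrow> 0) F"
proof (rule tendsto_sandwich[OF _ _ tendsto_const N_stop_lim])
  show "\<forall>\<^sub>F i in F. A i powr (- 1 - a) \<le> B i * (w i (B i))\<^sup>2" using arcs
    by eventually_elim (metis falling_arc.N_mono falling_arc.N_start falling_arc.N_stop)
qed auto

lemma start_powr_lim': assumes "0 < c" shows "((\<lambda>i. A i powr - c) \<longlongrightarrow> 0) F"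
proof -
  have "((\<lambda>i. (A i powr (- 1 - a)) powr (c / (1 + a))) \<longlongrightarrow> 0 powr (c / (1 + a))) F"
    using a_pos assms by (intro tendsto_powr' start_powr_lim tendsto_const) (auto simp: divide_pos_pos)
  moreover have "(x powr (- 1 - a)) powr (c / (1 + a)) = x powr - c" for x
    by (rule powr_neg_powr_divide[OF a_pos])
  ultimately show ?thesis by simp
qed

lemma start_at_top: "filterlim A at_top F"
proof -
  have "\<forall>\<^sub>F i in F. 0 < A i powr - 1" "\<forall>\<^sub>F i in F. inverse (A i powr - 1) = A i" using arcs
    by (eventually_elim, use positive_arc.A_pos in \<open>force simp: falling_arc_def powr_minus\<close>)+
  then have "filterlim (\<lambda>i. inverse (A i powr - 1)) at_top F" 
    using start_powr_lim'[of 1] by (intro filterlim_inverse_at_top) auto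
  then show ?thesis
    by (rule filterlim_mono_eventually) (use \<open>\<forall>\<^sub>F i in F. inverse (A i powr - 1) = A i\<close> in auto)
qed

lemma slope_times_end_lim: "((\<lambda>i. - w i (B i) * B i) \<longlongrightarrow> 1) F"
proof (rule tendsto_sandwich[OF _ _ tendsto_const])
  show "\<forall>\<^sub>F i in F. 1 \<le> - w i (B i) * B i" using arcs
    by eventually_elim (rule falling_arc.slope_times_end)
  show "\<forall>\<^sub>F i in F. - w i (B i) * B i \<le> 1 + (1 + a) / a * A i powr - a" using arcs
    by eventually_elim (rule falling_arc.slope_times_end_le)
  have "((\<lambda>i. 1 + (1 + a) / a * A i powr - a) \<longlongrightarrow> 1 + (1 + a) / a * 0) F"
    by (intro tendsto_intros start_powr_lim' a_pos)
  then show "((\<lambda>i. 1 + (1 + a) / a * A i powr - a) \<longlongrightarrow> 1) F" by simp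
qed

lemma slope_times_start_lim: "((\<lambda>i. - w i (B i) * A i powr (1 + a)) \<longlongrightarrow> 1) F"
proof (rule order_tendstoI)
  fix c :: real assume "1 < c"
  show "\<forall>\<^sub>F i in F. - w i (B i) * A i powr (1 + a) < c" using arcs
  proof eventually_elim
    case (elim i)
    then interpret falling_arc a "e i" "y i" "w i" "A i" "B i" .
    have "- w i (B i) * A i powr (1 + a) \<le> A i powr (- 1 - a) * A i powr (1 + a)"
      using slope_le by (intro mult_right_mono) auto
    also have "\<dots> = 1" using A_pos powr_add[of "A i" "- 1 - a" "1 + a"] by simp
    finally show ?case using \<open>1 < c\<close> by simp
  qed
next
  fix c :: real assume c: "c < 1"
  have "((\<lambda>\<theta>::real. (1 - \<theta>) powr (1 + 2 * a)) \<longlongrightarrow> (1 - 0) powr (1 + 2 * a)) (at_right 0)"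
    by (intro tendsto_intros) auto
  then have "\<forall>\<^sub>F \<theta> in at_right 0. c < (1 - \<theta>) powr (1 + 2 * a)"
    using c by (intro order_tendstoD(1)) auto
  then have "\<forall>\<^sub>F \<theta> in at_right 0. c < (1 - \<theta>) powr (1 + 2 * a) \<and> 0 < \<theta> \<and> \<theta> < (1::real)"
    using eventually_at_right_real[OF zero_less_one] by eventually_elim auto
  then obtain \<theta> where th: "c < (1 - \<theta>) powr (1 + 2 * a)" "0 < \<theta>" "\<theta> < (1::real)"
    using eventually_happens'[OF trivial_limit_at_right_real] by blast
  define K where "K = (1 - \<theta>) powr (1 + 2 * a)"
  have "((\<lambda>i. (- w i (B i)) powr a) \<longlongrightarrow> 0 powr a) F"
    using a_pos arcs by (intro tendsto_powr' slope_lim tendsto_const)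
       (auto elim!: eventually_mono dest: falling_arc.slope_pos)
  then have "((\<lambda>i. K / (1 + (- w i (B i)) powr a / \<theta> powr (1 + a))) \<longlongrightarrow> K / (1 + 0 / \<theta> powr (1 + a))) F"
    using th by (intro tendsto_intros) auto
  then have "\<forall>\<^sub>F i in F. c < K / (1 + (- w i (B i)) powr a / \<theta> powr (1 + a))"
    using th by (intro order_tendstoD(1)) (auto simp: K_def)
  then show "\<forall>\<^sub>F i in F. c < - w i (B i) * A i powr (1 + a)" using arcs
  proof eventually_elim
    case (elim i)
    then interpret falling_arc a "e i" "y i" "w i" "A i" "B i" by simp
    define s where "s = - w i (B i)"
    have s: "0 < s" using slope_pos by (simp add: s_def)
    define D where "D = 1 + s powr a / \<theta> powr (1 + a)"
    have D: "0 < D" by (simp add: D_def add_pos_nonneg)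
    have "K * A i powr (- 1 - a) \<le> s + (s / \<theta>) powr (1 + a)"
      using slope_ge[OF th(2,3)] by (simp add: K_def s_def)
    also have "\<dots> = s * D"
      using s th by (simp add: D_def powr_divide powr_add field_simps)
    finally have "K * A i powr (- 1 - a) * A i powr (1 + a) \<le> s * D * A i powr (1 + a)"
      by (intro mult_right_mono) auto
    moreover have "A i powr (- 1 - a) * A i powr (1 + a) = 1"
      using A_pos powr_add[of "A i" "- 1 - a" "1 + a"] by simp
    ultimately have "K \<le> (s * A i powr (1 + a)) * D" by (simp add: mult_ac)
    then have "K / D \<le> s * A i powr (1 + a)" using D by (simp add: field_simps)
    then show ?case using elim by (simp add: D_def s_def)
  qed
qed

lemma N_rise_lim: "((\<lambda>i. (NN i (B i) - NN i (A i)) / e i) \<longlongrightarrow> 0) F"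
proof (rule tendsto_sandwich[OF _ _ tendsto_const start_powr_lim])
  show "\<forall>\<^sub>F i in F. 0 \<le> (NN i (B i) - NN i (A i)) / e i" using arcs e_pos
    by eventually_elim (auto dest: falling_arc.N_mono)
  show "\<forall>\<^sub>F i in F. (NN i (B i) - NN i (A i)) / e i \<le> A i powr (- 1 - a)" using arcs e_pos
    by eventually_elim (auto dest!: falling_arc.N_rise simp: field_simps)
qed

end

section \<open>Rescaling a hump to height one\<close>

text \<open>The equation is invariant under \<open>y \<mapsto> y(\<lambda> \<cdot>) / h\<close> with \<open>\<lambda>\<^bsup>a\<^esup> = h\<^bsup>2a-e\<^esup>\<close>. At \<open>e = 0\<close> the Pohozaev function is
  invariant as well; for \<open>e > 0\<close> it picks up the factor \<open>\<lambda> / h\<^sup>2 = h\<^bsup>-e/a\<^esup>\<close>.\<close>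
lemma positive_arc_scale:
  assumes "positive_arc a e y w A B" and h: "0 < h" and lam: "lam = h powr ((2 * a - e) / a)"
  shows "positive_arc a e (\<lambda>s. y (lam * s) / h) (\<lambda>s. lam * w (lam * s) / h) (A / lam) (B / lam)"
proof -
  interpret positive_arc a e y w A B by fact
  have lam0: "0 < lam" using h by (simp add: lam)
  have img: "(\<lambda>s. lam * s) ` {A / lam..B / lam} \<subseteq> {A..B}"
    using lam0 by (auto simp: field_simps)
  have c: "continuous_on {A / lam..B / lam} (\<lambda>s. f (lam * s))" if "continuous_on {A..B} f" for f :: "real \<Rightarrow> real"
    by (rule continuous_on_compose2[OF that _ img]) (intro continuous_intros)
  have key: "lam * (lam * (x * (lam * s) powr (- 2 - a))) / h = s powr (- 2 - a) * (x * h powr - (1 + 2 * a - e))"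
    if "0 < s" for s x
  proof -
    have "lam * lam * lam powr (- 2 - a) = lam powr - a"
      using lam0 powr_add[of lam 2 "- 2 - a"] by (simp add: power2_eq_square)
    also have "\<dots> = h powr - (2 * a - e)" unfolding lam using a_pos by (simp add: powr_powr)
    also have "\<dots> = h * h powr - (1 + 2 * a - e)"
      using h powr_add[of h 1 "- (1 + 2 * a - e)"] by simp
    finally have "lam * lam * lam powr (- 2 - a) = h * h powr - (1 + 2 * a - e)" .
    then have "lam * lam * lam powr (- 2 - a) * (x * s powr (- 2 - a)) / h
       = h * h powr - (1 + 2 * a - e) * (x * s powr (- 2 - a)) / h" by simp
    then show ?thesis using h by (simp add: powr_mult mult_ac)
  qed
  show ?thesis
  proof
    fix s assume s: "A / lam < s" "s < B / lam"
    then have s': "A < lam * s" "lam * s < B" using lam0 by (auto simp: field_simps)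
    have s0: "0 < s" using s A_pos lam0 by (meson divide_pos_pos less_trans)
    show "0 < y (lam * s) / h" using y_pos[OF s'] h by simp
    have l: "((\<lambda>s. lam * s) has_real_derivative lam) (at s)"
      by (auto intro!: derivative_eq_intros)
    note dy = DERIV_chain2[where f = y and g = "\<lambda>s. lam * s", OF deriv_y[OF s'] l]
    note dw = DERIV_chain2[where f = w and g = "\<lambda>s. lam * s", OF deriv_w[OF s'] l]
    show "((\<lambda>s. y (lam * s) / h) has_real_derivative lam * w (lam * s) / h) (at s)"
      using DERIV_cdivide[OF dy, of h] by (simp add: mult.commute)
    have d: "((\<lambda>s. lam * w (lam * s) / h) has_real_derivative
        lam * (- ((1 + a) * ((lam * s) powr (- 2 - a) * y (lam * s) powr (1 + 2 * a - e))) * lam) / h) (at s)"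
      by (rule DERIV_cdivide[OF DERIV_cmult[OF dw]])
    have "lam * (- ((1 + a) * ((lam * s) powr (- 2 - a) * y (lam * s) powr (1 + 2 * a - e))) * lam) / h
       = - ((1 + a) * (lam * (lam * (y (lam * s) powr (1 + 2 * a - e) * (lam * s) powr (- 2 - a))) / h))"
      by (simp add: mult_ac)
    also have "\<dots> = - ((1 + a) * (s powr (- 2 - a) * (y (lam * s) / h) powr (1 + 2 * a - e)))"
      unfolding key[OF s0] powr_minus_divide[of h "1 + 2 * a - e"] by (simp add: powr_divide)
    finally show "((\<lambda>s. lam * w (lam * s) / h) has_real_derivative
        - ((1 + a) * (s powr (- 2 - a) * (y (lam * s) / h) powr (1 + 2 * a - e)))) (at s)"
      using d by simp
  qed (use a_pos e_nonneg e_less A_pos A_less_B lam0 h in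
      \<open>auto intro!: continuous_intros c cont_y cont_w simp: divide_strict_right_mono\<close>)
qed

lemma pohozaev_scale:
  assumes h: "0 < h" and lam: "lam = h powr ((2 * a - e) / a)" and "0 < a" "0 < s"
  shows "pohozaev a e (\<lambda>s. y (lam * s) / h) (\<lambda>s. lam * w (lam * s) / h) s
     = lam / h\<^sup>2 * pohozaev a e y w (lam * s)"
proof -
  have lam0: "0 < lam" using h by (simp add: lam)
  have "lam * lam powr (- 1 - a) = lam powr - a"
    using lam0 powr_add[of lam 1 "- 1 - a"] by simp
  also have "\<dots> = h powr - (2 * a - e)" unfolding lam using assms by (simp add: powr_powr)
  also have "\<dots> = h\<^sup>2 * h powr - (2 + 2 * a - e)"
    using h powr_add[of h 2 "- (2 + 2 * a - e)"] by simp
  finally have *: "lam * lam powr (- 1 - a) / h\<^sup>2 = h powr - (2 + 2 * a - e)" using h by simp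
  have "s powr (- 1 - a) * (y (lam * s) / h) powr (2 + 2 * a - e)
      = s powr (- 1 - a) * (y (lam * s) powr (2 + 2 * a - e) * h powr - (2 + 2 * a - e))"
    unfolding powr_minus_divide[of h "2 + 2 * a - e"] by (simp add: powr_divide)
  also have "\<dots> = lam / h\<^sup>2 * ((lam * s) powr (- 1 - a) * y (lam * s) powr (2 + 2 * a - e))"
    unfolding *[symmetric] by (simp add: powr_mult mult_ac)
  finally show ?thesis
    unfolding pohozaev_def using h by (simp add: field_simps power2_eq_square)
qed

text \<open>Heights of humps behave like powers of \<open>e\<close>, so \<open>e ln h \<rightarrow> 0\<close> and factors \<open>h\<^bsup>c e\<^esup>\<close> disappear in the limit.\<close>
lemma powr_small_exponent_lim:
  fixes h :: "real \<Rightarrow> real"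
  assumes "\<forall>\<^sub>F e in F. 0 < h e" "((\<lambda>e. e * ln (h e)) \<longlongrightarrow> 0) F"
  shows "((\<lambda>e. h e powr (c * e)) \<longlongrightarrow> 1) F"
proof -
  have "((\<lambda>e. exp (c * (e * ln (h e)))) \<longlongrightarrow> exp (c * 0)) F"
    by (intro assms(2) tendsto_exp tendsto_mult_left)
  moreover have "\<forall>\<^sub>F e in F. exp (c * (e * ln (h e))) = h e powr (c * e)"
    using assms(1) by eventually_elim (simp add: powr_def mult_ac)
  ultimately show ?thesis using Lim_transform_eventually by fastforce
qed

lemma scale_factor:
  fixes a h e :: real
  assumes "0 < h" "0 < a"
  shows "h powr ((2 * a - e) / a) / h\<^sup>2 = h powr (- (1 / a) * e)"
proof -
  have "h\<^sup>2 = h powr 2" using assms by simp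
  moreover have "(2 * a - e) / a - 2 = - (1 / a) * e" using assms by (simp add: field_simps)
  ultimately show ?thesis by (simp only: powr_diff[symmetric])
qed

text \<open>Arcs of height \<open>h\<close>, depending on \<open>e\<close>, together with their rescalings \<open>Y\<close>, \<open>W\<close> to height one.\<close>
locale scaled_arcs =
  fixes a :: real and y w :: "real \<Rightarrow> real \<Rightarrow> real" and A B h :: "real \<Rightarrow> real"
  assumes a_pos: "0 < a"
    and arcs: "\<forall>\<^sub>F e in at_right 0. positive_arc a e (y e) (w e) (A e) (B e)"
    and h_pos: "\<forall>\<^sub>F e in at_right 0. 0 < h e"
begin

definition lam :: "real \<Rightarrow> real" where "lam e = h e powr ((2 * a - e) / a)"

definition Y :: "real \<Rightarrow> real \<Rightarrow> real" where "Y e s = y e (lam e * s) / h e"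

definition W :: "real \<Rightarrow> real \<Rightarrow> real" where "W e s = lam e * w e (lam e * s) / h e"

definition c :: "real \<Rightarrow> real" where "c e = h e powr (- (1 / a) * e)"

abbreviation "N e \<equiv> pohozaev a e (y e) (w e)"

abbreviation "NS e \<equiv> pohozaev a e (Y e) (W e)"

lemma lam_pos: "\<forall>\<^sub>F e in at_right 0. 0 < lam e"
  using h_pos by eventually_elim (simp add: lam_def)

lemma c_pos: "\<forall>\<^sub>F e in at_right 0. 0 < c e"
  using h_pos by eventually_elim (simp add: c_def)

lemma c_eq: "\<forall>\<^sub>F e in at_right 0. lam e / (h e)\<^sup>2 = c e"
  using h_pos by eventually_elim (unfold lam_def c_def, rule scale_factor[OF _ a_pos])

lemma AB: "\<forall>\<^sub>F e in at_right 0. 0 < A e \<and> 0 < B e"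
  using arcs by eventually_elim (auto simp: positive_arc_def)

lemma c_lim:
  assumes "((\<lambda>e. e * ln (h e)) \<longlongrightarrow> 0) (at_right 0)"
  shows "(c \<longlongrightarrow> 1) (at_right 0)"
  unfolding c_def[abs_def] using h_pos assms by (rule powr_small_exponent_lim)

lemma scaled_arc: "\<forall>\<^sub>F e in at_right 0. positive_arc a e (Y e) (W e) (A e / lam e) (B e / lam e)"
  using arcs h_pos unfolding Y_def[abs_def] W_def[abs_def]
  by eventually_elim (auto intro!: positive_arc_scale simp: lam_def)

lemma N_eq: "\<forall>\<^sub>F e in at_right 0. \<forall>s>0. pohozaev a e (Y e) (W e) (s / lam e)
    = c e * pohozaev a e (y e) (w e) s"
  using h_pos lam_pos c_eq
proof eventually_elim
  case (elim e)
  show ?case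
  proof (intro allI impI)
    fix s :: real assume "0 < s"
    then have "pohozaev a e (Y e) (W e) (s / lam e)
        = lam e / (h e)\<^sup>2 * pohozaev a e (y e) (w e) (lam e * (s / lam e))"
      unfolding Y_def[abs_def] W_def[abs_def] using elim a_pos
      by (intro pohozaev_scale) (auto simp: lam_def)
    then show "pohozaev a e (Y e) (W e) (s / lam e) = c e * pohozaev a e (y e) (w e) s"
      using elim by simp
  qed
qed

lemma N_diff_eq:
  "\<forall>\<^sub>F e in at_right 0. (NS e (A e / lam e) - NS e (B e / lam e)) / e / c e = (N e (A e) - N e (B e)) / e"
  using N_eq AB c_pos
proof eventually_elim
  case (elim e)
  then have "NS e (A e / lam e) = c e * N e (A e)" "NS e (B e / lam e) = c e * N e (B e)"
    by auto
  then show ?case using elim by (simp add: right_diff_distrib[symmetric])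
qed

lemma rising_step:
  assumes h_lim: "((\<lambda>e. e * ln (h e)) \<longlongrightarrow> 0) (at_right 0)"
    and y_start: "\<forall>\<^sub>F e in at_right 0. y e (A e) = 0"
    and w_stop: "\<forall>\<^sub>F e in at_right 0. 0 \<le> w e (B e)"
    and y_stop: "\<forall>\<^sub>F e in at_right 0. y e (B e) \<le> h e"
    and N_stop: "\<forall>\<^sub>F e in at_right 0. 0 \<le> N e (B e)"
    and B_lim: "filterlim (\<lambda>e. B e / lam e) at_top (at_right 0)"
    and y_lim: "((\<lambda>e. y e (B e) / h e) \<longlongrightarrow> 1) (at_right 0)"
    and w_lim: "((\<lambda>e. B e * w e (B e) / h e) \<longlongrightarrow> 0) (at_right 0)"
  shows "((\<lambda>e. h e * w e (A e)) \<longlongrightarrow> 1) (at_right 0)"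
    and "((\<lambda>e. (N e (A e) - N e (B e)) / e)
        \<longlongrightarrow> bubble_action a 1) (at_right 0)"
proof -
  interpret R: rising_family "at_right (0::real)" a "\<lambda>e. e" Y W "\<lambda>e. A e / lam e" "\<lambda>e. B e / lam e"
  proof
    show "\<forall>\<^sub>F e in at_right 0. rising_arc a e (Y e) (W e) (A e / lam e) (B e / lam e)"
      using scaled_arc h_pos lam_pos w_stop y_stop
      by eventually_elim (auto simp: rising_arc_def rising_arc_axioms_def Y_def W_def)
    show "\<forall>\<^sub>F e in at_right 0. Y e (A e / lam e) = 0"
      using y_start lam_pos by eventually_elim (simp add: Y_def)
    show "\<forall>\<^sub>F e in at_right 0. 0 \<le> pohozaev a e (Y e) (W e) (B e / lam e)"
      using N_eq N_stop AB c_pos by eventually_elim auto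
    show "\<forall>\<^sub>F e::real in at_right 0. 0 < e" by (rule eventually_at_right_less)
    have "\<forall>\<^sub>F e in at_right 0. y e (B e) / h e = Y e (B e / lam e)"
      using lam_pos by eventually_elim (simp add: Y_def)
    then show "((\<lambda>e. Y e (B e / lam e)) \<longlongrightarrow> 1) (at_right 0)"
      using y_lim by (rule Lim_transform_eventually[rotated])
    have "\<forall>\<^sub>F e in at_right 0. B e * w e (B e) / h e = B e / lam e * W e (B e / lam e)"
      using lam_pos by eventually_elim (simp add: W_def)
    then show "((\<lambda>e. B e / lam e * W e (B e / lam e)) \<longlongrightarrow> 0) (at_right 0)"
      using w_lim by (rule Lim_transform_eventually[rotated])
  qed (use a_pos B_lim in auto)
  have "((\<lambda>e. W e (A e / lam e) / c e) \<longlongrightarrow> 1 / 1) (at_right 0)"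
    by (intro tendsto_intros R.slope_lim c_lim h_lim) auto
  moreover have "\<forall>\<^sub>F e in at_right 0. W e (A e / lam e) / c e = h e * w e (A e)"
    using lam_pos h_pos c_eq
  proof eventually_elim
    case (elim e)
    then show ?case unfolding elim(3)[symmetric] W_def by (simp add: field_simps power2_eq_square)
  qed
  ultimately show "((\<lambda>e. h e * w e (A e)) \<longlongrightarrow> 1) (at_right 0)"
    using Lim_transform_eventually by fastforce
  have "((\<lambda>e. (NS e (A e / lam e) - NS e (B e / lam e)) / e / c e) \<longlongrightarrow> bubble_action a 1 / 1) (at_right 0)"
    by (intro tendsto_divide R.N_gain c_lim h_lim) auto
  from Lim_transform_eventually[OF this N_diff_eq]
  show "((\<lambda>e. (N e (A e) - N e (B e)) / e) \<longlongrightarrow> bubble_action a 1) (at_right 0)" by simp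
qed

text \<open>The rescaling is harmless only once \<open>e ln h \<rightarrow> 0\<close> is known, but the height \<open>h\<close> of the new hump is
  itself unknown. Concavity gives \<open>h \<le> S\<close> with \<open>S = - B w(B)\<close>, and \<open>slope_times_end_le'\<close> gives
  \<open>S \<le> C h\<^bsup>1-e/(1+a)\<^esup>\<close>; so \<open>ln h\<close> lies between \<open>2 (ln S - ln C)\<close> and \<open>ln S\<close>, and \<open>S\<close> only involves the zero \<open>B\<close>.\<close>
lemma falling_step:
  assumes start: "\<forall>\<^sub>F e in at_right 0. y e (A e) = h e \<and> w e (A e) = 0 \<and> y e (B e) = 0"
    and N_lim: "((\<lambda>e. B e * (w e (B e))\<^sup>2) \<longlongrightarrow> 0) (at_right 0)"
    and wB_le: "\<forall>\<^sub>F e in at_right 0. - w e (B e) * B e \<le> 1"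
    and wB_lim: "((\<lambda>e. e * ln (- w e (B e) * B e)) \<longlongrightarrow> 0) (at_right 0)"
  shows "((\<lambda>e. e * ln (h e)) \<longlongrightarrow> 0) (at_right 0)"
    and "filterlim (\<lambda>e. A e / lam e) at_top (at_right 0)"
    and "((\<lambda>e. - w e (B e) * B e / h e) \<longlongrightarrow> 1) (at_right 0)"
    and "((\<lambda>e. - w e (B e) * A e powr (1 + a) * h e powr (- 1 - 2 * a)) \<longlongrightarrow> 1) (at_right 0)"
    and "((\<lambda>e. (N e (A e) - N e (B e)) / e) \<longlongrightarrow> 0) (at_right 0)"
    and "\<forall>\<^sub>F e in at_right 0. 0 \<le> N e (A e)"
proof -
  have falling_arcs: "\<forall>\<^sub>F e in at_right 0. falling_arc a e (Y e) (W e) (A e / lam e) (B e / lam e)"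
    using scaled_arc h_pos lam_pos start
    by eventually_elim (auto simp: falling_arc_def falling_arc_axioms_def Y_def W_def)
  have WB: "\<forall>\<^sub>F e in at_right 0. - W e (B e / lam e) * (B e / lam e) = - w e (B e) * B e / h e"
    using lam_pos by eventually_elim (simp add: W_def)
  have WWB: "\<forall>\<^sub>F e in at_right 0. B e / lam e * (W e (B e / lam e))\<^sup>2 = c e * (B e * (w e (B e))\<^sup>2)"
    using lam_pos c_eq h_pos
  proof eventually_elim
    case (elim e)
    then show ?case unfolding elim(2)[symmetric] W_def by (simp add: field_simps power2_eq_square)
  qed
  have h_le: "\<forall>\<^sub>F e in at_right 0. h e \<le> - w e (B e) * B e"
    using falling_arcs WB h_pos
  proof eventually_elim
    case (elim e)
    have "1 \<le> - w e (B e) * B e / h e"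
      using falling_arc.slope_times_end[OF elim(1)] unfolding elim(2) .
    then show ?case using elim(3) by (simp add: field_simps)
  qed
  define C where "C = 1 + (1 + a) / a"
  have C: "1 \<le> C" using a_pos by (simp add: C_def)
  have N_le: "\<forall>\<^sub>F e in at_right 0. B e * (w e (B e))\<^sup>2 < 1"
    using N_lim by (rule order_tendstoD) simp
  have e_le: "\<forall>\<^sub>F e in at_right 0. e < (1 + a) / 2"
    using a_pos by (intro eventually_at_right_less[THEN eventually_mono] order_tendstoD(2)[OF tendsto_ident_at]) auto
  have h_ge: "\<forall>\<^sub>F e in at_right 0. 2 * (ln (- w e (B e) * B e) - ln C) \<le> ln (h e)"
    using falling_arcs WB WWB h_pos h_le wB_le N_le e_le AB eventually_at_right_less[of 0]
  proof eventually_elim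
    case (elim e)
    define S where "S = - w e (B e) * B e"
    \<comment> \<open>in scaled variables the Pohozaev function carries the factor \<open>c = h\<^bsup>-e/a\<^esup>\<close>, whose power \<open>a / (1 + a)\<close> is \<open>h\<^bsup>-p\<^esup>\<close>\<close>
    define p where "p = e / (1 + a)"
    have S: "0 < S" "S \<le> 1" "h e \<le> S" using elim by (auto simp: S_def)
    have p: "0 < p" "p < 1 / 2" using elim a_pos by (auto simp: p_def field_simps)
    have lnh: "ln (h e) \<le> 0" using elim S by simp
    have hp: "1 \<le> h e powr - p" using powr_mono2'[of "- p" "h e" 1] elim S p by auto
    have "(c e * (B e * (w e (B e))\<^sup>2)) powr (a / (1 + a)) \<le> (c e * 1) powr (a / (1 + a))"
      using elim a_pos by (intro powr_mono2 mult_left_mono) (auto simp: c_def)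
    also have "(c e * 1) powr (a / (1 + a)) = h e powr - p"
      using a_pos by (simp add: c_def p_def powr_powr)
    finally have "(1 + a) / a * (c e * (B e * (w e (B e))\<^sup>2)) powr (a / (1 + a))
        \<le> (1 + a) / a * h e powr - p"
      using a_pos by (intro mult_left_mono) auto
    moreover have "S / h e \<le> 1 + (1 + a) / a * (c e * (B e * (w e (B e))\<^sup>2)) powr (a / (1 + a))"
      using falling_arc.slope_times_end_le'[OF elim(1)] unfolding elim(2,3) S_def by simp
    ultimately have "S / h e \<le> 1 + (1 + a) / a * h e powr - p" by linarith
    also have "\<dots> \<le> C * h e powr - p" using hp by (simp add: C_def algebra_simps)
    finally have "ln (S / h e) \<le> ln (C * h e powr - p)" using S elim C by (intro ln_mono) auto
    then have *: "ln S - ln C \<le> (1 - p) * ln (h e)"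
      using S elim C by (simp add: ln_div ln_mult ln_powr algebra_simps)
    also have "\<dots> \<le> (1 / 2) * ln (h e)" using p lnh by (intro mult_right_mono_neg) auto
    finally show ?case by (simp add: S_def)
  qed
  show h_lim: "((\<lambda>e. e * ln (h e)) \<longlongrightarrow> 0) (at_right 0)"
  proof (rule tendsto_sandwich[OF _ _ _ wB_lim])
    show "\<forall>\<^sub>F e in at_right 0. 2 * (e * ln (- w e (B e) * B e) - e * ln C) \<le> e * ln (h e)"
      using h_ge eventually_at_right_less[of 0]
    proof eventually_elim
      case (elim e)
      have "e * (2 * (ln (- w e (B e) * B e) - ln C)) \<le> e * ln (h e)"
        using elim by (intro mult_left_mono) auto
      then show ?case by (simp add: algebra_simps)
    qed
    show "\<forall>\<^sub>F e in at_right 0. e * ln (h e) \<le> e * ln (- w e (B e) * B e)"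
      using h_le h_pos eventually_at_right_less[of 0]
      by eventually_elim (auto intro!: mult_left_mono ln_mono)
    have "((\<lambda>e. 2 * (e * ln (- w e (B e) * B e) - e * ln C)) \<longlongrightarrow> 2 * (0 - 0 * ln C)) (at_right 0)"
      by (intro tendsto_intros wB_lim)
    then show "((\<lambda>e. 2 * (e * ln (- w e (B e) * B e) - e * ln C)) \<longlongrightarrow> 0) (at_right 0)" by simp
  qed
  note c_lim = c_lim[OF h_lim]
  interpret R: falling_family "at_right (0::real)" a "\<lambda>e. e" Y W "\<lambda>e. A e / lam e" "\<lambda>e. B e / lam e"
  proof
    show "\<forall>\<^sub>F e::real in at_right 0. 0 < e" by (rule eventually_at_right_less)
    have "((\<lambda>e. c e * (B e * (w e (B e))\<^sup>2)) \<longlongrightarrow> 1 * 0) (at_right 0)"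
      by (intro tendsto_mult c_lim N_lim)
    then show "((\<lambda>e. B e / lam e * (W e (B e / lam e))\<^sup>2) \<longlongrightarrow> 0) (at_right 0)"
      using WWB by (simp add: filterlim_cong)
  qed (use a_pos falling_arcs in auto)
  show "filterlim (\<lambda>e. A e / lam e) at_top (at_right 0)" by (rule R.start_at_top)
  show "((\<lambda>e. - w e (B e) * B e / h e) \<longlongrightarrow> 1) (at_right 0)"
    using R.slope_times_end_lim WB by (rule Lim_transform_eventually)
  have "((\<lambda>e. - W e (B e / lam e) * (A e / lam e) powr (1 + a) * h e powr (- 1 * e)) \<longlongrightarrow> 1 * 1) (at_right 0)"
    by (intro tendsto_mult R.slope_times_start_lim powr_small_exponent_lim h_pos h_lim)
  moreover have "\<forall>\<^sub>F e in at_right 0. - W e (B e / lam e) * (A e / lam e) powr (1 + a) * h e powr (- 1 * e)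
      = - w e (B e) * A e powr (1 + a) * h e powr (- 1 - 2 * a)"
    using lam_pos h_pos AB
  proof eventually_elim
    case (elim e)
    have "lam e / h e * (1 / lam e powr (1 + a)) = lam e powr - a / h e"
      using elim by (simp add: powr_add powr_minus field_simps)
    also have "lam e powr - a = h e powr (e - 2 * a)"
      using a_pos by (simp add: lam_def powr_powr)
    also have "\<dots> / h e = h e powr (e - 2 * a - 1)"
      using elim powr_diff[of "h e" "e - 2 * a" 1] by simp
    finally have "lam e / h e * (1 / lam e powr (1 + a)) * h e powr (- 1 * e)
        = h e powr (e - 2 * a - 1 + - 1 * e)"
      by (simp only: powr_add)
    also have "e - 2 * a - 1 + - 1 * e = - 1 - 2 * a" by simp
    finally have "lam e / h e * (1 / lam e powr (1 + a)) * h e powr (- 1 * e)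
        = h e powr (- 1 - 2 * a)" .
    moreover have "- W e (B e / lam e) * (A e / lam e) powr (1 + a) * h e powr (- 1 * e)
       = - w e (B e) * A e powr (1 + a) * (lam e / h e * (1 / lam e powr (1 + a)) * h e powr (- 1 * e))"
      using elim by (simp add: W_def powr_divide)
    ultimately show ?case by simp
  qed
  ultimately show "((\<lambda>e. - w e (B e) * A e powr (1 + a) * h e powr (- 1 - 2 * a)) \<longlongrightarrow> 1) (at_right 0)"
    using Lim_transform_eventually by fastforce
  have "((\<lambda>e. (NS e (B e / lam e) - NS e (A e / lam e)) / e / c e) \<longlongrightarrow> 0 / 1) (at_right 0)"
    by (intro tendsto_divide R.N_rise_lim c_lim) auto
  from tendsto_minus[OF this]
  have "((\<lambda>e. (NS e (A e / lam e) - NS e (B e / lam e)) / e / c e) \<longlongrightarrow> 0) (at_right 0)"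
    by (simp add: diff_divide_distrib)
  from Lim_transform_eventually[OF this N_diff_eq]
  show "((\<lambda>e. (N e (A e) - N e (B e)) / e) \<longlongrightarrow> 0) (at_right 0)" .
  show "\<forall>\<^sub>F e in at_right 0. 0 \<le> N e (A e)"
    using start by eventually_elim (simp add: pohozaev_def)
qed

end

section \<open>Nodal solutions, hump by hump\<close>

text \<open>A solution on a half line with \<open>y(\<infinity>) = 1\<close> and zeros \<open>T 1 > \<dots> > T m\<close>, separated by the critical points
  \<open>\<tau> 1 > \<dots> > \<tau> (m - 1)\<close>. The outermost hump \<open>(T 1, \<infinity>)\<close> has its maximum at infinity; it corresponds to the
  origin of the ball.\<close>
definition nodal_solution ::
  "real \<Rightarrow> real \<Rightarrow> nat \<Rightarrow> (real \<Rightarrow> real) \<Rightarrow> (real \<Rightarrow> real) \<Rightarrow> (nat \<Rightarrow> real) \<Rightarrow> (nat \<Rightarrow> real) \<Rightarrow> bool"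
  where "nodal_solution a e m y w T \<tau> \<longleftrightarrow>
    (y \<longlongrightarrow> 1) at_top \<and> (w \<longlongrightarrow> 0) at_top \<and>
    (\<forall>S>T 1. positive_arc a e y w (T 1) S) \<and>
    (\<forall>j\<in>{1..m}. y (T j) = 0) \<and>
    (\<forall>j\<in>{1..<m}. T (Suc j) < \<tau> j \<and> \<tau> j < T j \<and> w (\<tau> j) = 0 \<and>
       positive_arc a e (\<lambda>t. (- 1) ^ j * y t) (\<lambda>t. (- 1) ^ j * w t) (T (Suc j)) (T j))"

text \<open>Hump number \<open>j\<close> lies between \<open>T (j + 1)\<close> and \<open>T j\<close>, with \<open>T 0 = \<infinity>\<close>.\<close>
definition height :: "(real \<Rightarrow> real) \<Rightarrow> (nat \<Rightarrow> real) \<Rightarrow> nat \<Rightarrow> real" where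
  "height y \<tau> j = (if j = 0 then 1 else \<bar>y (\<tau> j)\<bar>)"

lemma eps_ln_eps_lim: "((\<lambda>e::real. e * ln e) \<longlongrightarrow> 0) (at_right 0)"
proof -
  have "((\<lambda>x::real. ln (inverse x) / inverse x) \<longlongrightarrow> 0) (at_right 0)"
    using ln_x_over_x_tendsto_0 by (simp add: filterlim_at_top_to_right)
  then have "((\<lambda>x::real. - (ln (inverse x) / inverse x)) \<longlongrightarrow> - 0) (at_right 0)"
    by (rule tendsto_minus)
  moreover have "\<forall>\<^sub>F x in at_right (0::real). - (ln (inverse x) / inverse x) = x * ln x"
    using eventually_at_right_less[of 0] by eventually_elim (simp add: ln_div inverse_eq_divide)
  ultimately show ?thesis using Lim_transform_eventually by fastforce
qed

lemma eps_ln_lim: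
  fixes f :: "real \<Rightarrow> real"
  assumes "0 < K" "0 < L" and f: "((\<lambda>e. f e / (K * e) ^ k) \<longlongrightarrow> L) (at_right 0)"
  shows "((\<lambda>e. e * ln (f e)) \<longlongrightarrow> 0) (at_right 0)"
proof -
  have "((\<lambda>e. e * ln (f e / (K * e) ^ k) + real k * (e * ln K + e * ln e))
      \<longlongrightarrow> 0 * ln L + real k * (0 * ln K + 0)) (at_right 0)"
    using assms by (intro tendsto_intros f eps_ln_eps_lim) auto
  moreover have "\<forall>\<^sub>F e in at_right 0. 0 < f e / (K * e) ^ k"
    using f assms(2) by (rule order_tendstoD)
  then have "\<forall>\<^sub>F e in at_right 0. e * ln (f e / (K * e) ^ k) + real k * (e * ln K + e * ln e) = e * ln (f e)"
    using eventually_at_right_less[of 0]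
  proof eventually_elim
    case (elim e)
    have pos: "0 < (K * e) ^ k" using elim assms by simp
    have "0 < f e / (K * e) ^ k * (K * e) ^ k" using elim(1) pos by (rule mult_pos_pos)
    then have f0: "0 < f e" using pos elim assms by (simp split: if_splits)
    have "ln (f e / (K * e) ^ k) = ln (f e) - real k * (ln K + ln e)"
      using f0 elim assms by (simp add: ln_div ln_realpow ln_mult)
    then show ?case by (simp only:) (simp add: algebra_simps)
  qed
  ultimately show ?thesis using Lim_transform_eventually by fastforce
qed

text \<open>On the outermost hump every far point can serve as the right end point of a rising arc; it may be
  chosen so far out that all its data agree with those of the bubble up to an arbitrary \<open>d\<close>.\<close>
lemma first_arc_end:
  assumes yl: "(y \<longlongrightarrow> 1) at_top" and wl: "(w \<longlongrightarrow> 0) at_top"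
    and arcs: "\<And>S. T < S \<Longrightarrow> positive_arc a e y w T S" and d: "0 < d"
  shows "\<exists>S>T. 1 / d \<le> S \<and> 0 \<le> w S \<and> y S \<le> 1 \<and> 1 - d \<le> y S \<and> S * w S \<le> d
     \<and> 0 \<le> pohozaev a e y w S \<and> pohozaev a e y w S \<le> d"
proof -
  have a_pos: "0 < a" and T_pos: "0 < T" and e_less: "e < 2 * a"
    using arcs[of "T + 1"] by (auto simp: positive_arc_def)
  have w0: "0 \<le> w t" if "T \<le> t" for t
  proof (rule tendsto_upperbound[OF wl])
    show "\<forall>\<^sub>F s in at_top. w s \<le> w t" using eventually_gt_at_top[of t]
    proof eventually_elim
      case (elim s)
      then interpret positive_arc a e y w T s using arcs that by auto
      show ?case using w_antimono[of t s] elim that by auto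
    qed
  qed auto
  have y1: "y t \<le> 1" if "T < t" for t
  proof (rule tendsto_lowerbound[OF yl])
    show "\<forall>\<^sub>F s in at_top. y t \<le> y s" using eventually_gt_at_top[of t]
    proof eventually_elim
      case (elim s)
      then interpret positive_arc a e y w T s using arcs that by auto
      show ?case
        by (rule nondecreasing_by_derivative[OF cont_y _ _ _ deriv_y]) (use elim that w0 in auto)
    qed
  qed auto
  have rising: "rising_arc a e y w T s" if "T < s" for s
    using arcs[OF that] w0[of s] y1[OF that] that by (simp add: rising_arc_def rising_arc_axioms_def)
  have w_le: "w t \<le> t powr (- 1 - a)" if "T < t" for t
  proof (rule tendsto_lowerbound)
    show "((\<lambda>s. w s + t powr (- 1 - a)) \<longlongrightarrow> t powr (- 1 - a)) at_top"
      using tendsto_add[OF wl tendsto_const[of "t powr (- 1 - a)"]] by simp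
    show "\<forall>\<^sub>F s in at_top. w t \<le> w s + t powr (- 1 - a)" using eventually_gt_at_top[of t]
    proof eventually_elim
      case (elim s)
      then show ?case using rising_arc.w_le[OF rising[of s], of t] that by auto
    qed
  qed auto
  have sw: "((\<lambda>s. s * w s) \<longlongrightarrow> 0) at_top"
  proof (rule tendsto_sandwich[OF _ _ tendsto_const])
    show "\<forall>\<^sub>F s in at_top. 0 \<le> s * w s" using eventually_gt_at_top[of T]
      by eventually_elim (use w0 T_pos in auto)
    show "\<forall>\<^sub>F s in at_top. s * w s \<le> s powr - a" using eventually_gt_at_top[of T]
    proof eventually_elim
      case (elim s)
      then have "s * w s \<le> s * s powr (- 1 - a)" using w_le T_pos by (intro mult_left_mono) auto
      also have "\<dots> = s powr - a" using elim T_pos powr_add[of s 1 "- 1 - a"] by simp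
      finally show ?case .
    qed
    show "((\<lambda>s. s powr - a) \<longlongrightarrow> 0) at_top" using a_pos by (intro tendsto_neg_powr filterlim_ident) auto
  qed
  have Nl: "(pohozaev a e y w \<longlongrightarrow> 0) at_top"
  proof -
    have "((\<lambda>s. s powr (- 1 - a) * y s powr (2 + 2 * a - e)) \<longlongrightarrow> 0 * 1 powr (2 + 2 * a - e)) at_top"
      using a_pos by (intro tendsto_mult tendsto_powr yl tendsto_const tendsto_neg_powr filterlim_ident) auto
    then have "((\<lambda>s. (s * w s) * w s - y s * w s + s powr (- 1 - a) * y s powr (2 + 2 * a - e))
        \<longlongrightarrow> 0 * 0 - 1 * 0 + 0) at_top"
      by (intro tendsto_add tendsto_diff tendsto_mult yl wl sw) auto
    then show ?thesis by (simp add: pohozaev_def[abs_def] power2_eq_square mult.assoc)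
  qed
  have N0: "0 \<le> pohozaev a e y w t" if "T < t" for t
  proof (rule tendsto_upperbound[OF Nl])
    show "\<forall>\<^sub>F s in at_top. pohozaev a e y w s \<le> pohozaev a e y w t" using eventually_gt_at_top[of t]
    proof eventually_elim
      case (elim s)
      then show ?case using rising_arc.N_antimono[OF rising[of s], of t s] that by auto
    qed
  qed auto
  have "\<forall>\<^sub>F S in at_top. T < S \<and> 1 / d \<le> S \<and> 1 - d < y S \<and> S * w S < d \<and> pohozaev a e y w S < d"
    using d by (intro eventually_conj eventually_gt_at_top eventually_ge_at_top
      order_tendstoD(1)[OF yl] order_tendstoD(2)[OF sw] order_tendstoD(2)[OF Nl]) auto
  then obtain S where "T < S \<and> 1 / d \<le> S \<and> 1 - d < y S \<and> S * w S < d \<and> pohozaev a e y w S < d"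
    using eventually_happens'[OF trivial_limit_at_top_linorder] by blast
  then show ?thesis using w0[of S] y1[of S] N0[of S] by auto
qed

text \<open>The induction over the humps. Write \<open>\<sigma>\<^sub>j = \<bar>w (T j)\<bar>\<close> and let \<open>h\<^sub>j\<close> be the height of hump \<open>j\<close>. The rising part of
  hump \<open>j\<close> gives \<open>h\<^sub>j \<sigma>\<^sub>j\<^sub>+\<^sub>1 \<rightarrow> 1\<close> and adds \<open>K\<close> to \<open>T\<^sub>j \<sigma>\<^sub>j\<^sup>2 / e\<close>, the falling part of the next hump gives
  \<open>h\<^sub>j\<^sub>+\<^sub>1 \<approx> \<sigma>\<^sub>j\<^sub>+\<^sub>1 T\<^sub>j\<^sub>+\<^sub>1 \<approx> (j + 1) K e h\<^sub>j\<close>. This recursion is where the factorials come from.\<close>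
lemma nodal_limits:
  fixes a :: real and y w :: "real \<Rightarrow> real \<Rightarrow> real" and T \<tau> :: "real \<Rightarrow> nat \<Rightarrow> real"
  defines "K \<equiv> bubble_action a 1"
  assumes a_pos: "0 < a" and K_pos: "0 < K" and m: "1 \<le> m"
    and nodal: "\<forall>\<^sub>F e in at_right 0. nodal_solution a e m (y e) (w e) (T e) (\<tau> e)"
    and j: "j < m"
  shows "((\<lambda>e. height (y e) (\<tau> e) j / (K * e) ^ j) \<longlongrightarrow> fact j) (at_right 0)
    \<and> ((\<lambda>e. height (y e) (\<tau> e) j * \<bar>w e (T e (Suc j))\<bar>) \<longlongrightarrow> 1) (at_right 0)
    \<and> ((\<lambda>e. T e (Suc j) * (w e (T e (Suc j)))\<^sup>2 / e) \<longlongrightarrow> real (Suc j) * K) (at_right 0)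
    \<and> (1 \<le> j \<longrightarrow> ((\<lambda>e. \<bar>w e (T e j)\<bar> * \<tau> e j powr (1 + a)
          * height (y e) (\<tau> e) j powr (- 1 - 2 * a)) \<longlongrightarrow> 1) (at_right 0))"
  using j
proof (induction j)
  case 0
  \<comment> \<open>the accuracy \<open>e\<^sup>2\<close> makes the Pohozaev function at the end point negligible after division by \<open>e\<close>\<close>
  define P where "P e S \<longleftrightarrow> T e 1 < S \<and> 1 / e\<^sup>2 \<le> S \<and> 0 \<le> w e S \<and> y e S \<le> 1 \<and> 1 - e\<^sup>2 \<le> y e S
     \<and> S * w e S \<le> e\<^sup>2 \<and> 0 \<le> pohozaev a e (y e) (w e) S \<and> pohozaev a e (y e) (w e) S \<le> e\<^sup>2" for e S
  define S where "S e = (SOME S. P e S)" for e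
  have PS: "\<forall>\<^sub>F e in at_right 0. P e (S e)"
    using nodal eventually_at_right_less[of 0]
  proof eventually_elim
    case (elim e)
    then have "\<exists>S. P e S"
      using first_arc_end[of "y e" "w e" "T e 1" a e "e\<^sup>2"] unfolding P_def nodal_solution_def by auto
    then show ?case unfolding S_def by (rule someI_ex)
  qed
  have sq: "((\<lambda>e::real. e\<^sup>2) \<longlongrightarrow> 0) (at_right 0)"
    using tendsto_power[OF tendsto_ident_at[of 0 "{0<..}"], of 2] by simp
  have arcs: "\<forall>\<^sub>F e in at_right 0. positive_arc a e (y e) (w e) (T e 1) (S e)"
    using nodal PS by eventually_elim (auto simp: nodal_solution_def P_def)
  have yT: "\<forall>\<^sub>F e in at_right 0. y e (T e 1) = 0"
    using nodal by eventually_elim (use m in \<open>auto simp: nodal_solution_def\<close>)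
  have S_top: "filterlim S at_top (at_right 0)"
  proof (rule filterlim_at_top_mono)
    show "\<forall>\<^sub>F e in at_right 0. 1 / e\<^sup>2 \<le> S e" using PS by eventually_elim (simp add: P_def)
    have "filterlim (\<lambda>e::real. inverse (e\<^sup>2)) at_top (at_right 0)"
      by (intro filterlim_inverse_at_top sq eventually_mono[OF eventually_at_right_less]) auto
    then show "filterlim (\<lambda>e::real. 1 / e\<^sup>2) at_top (at_right 0)" by (simp add: inverse_eq_divide)
  qed
  have y_lim: "((\<lambda>e. y e (S e) / 1) \<longlongrightarrow> 1) (at_right 0)"
  proof (rule tendsto_sandwich[OF _ _ _ tendsto_const])
    show "\<forall>\<^sub>F e in at_right 0. 1 - e\<^sup>2 \<le> y e (S e) / 1" using PS by eventually_elim (simp add: P_def)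
    show "\<forall>\<^sub>F e in at_right 0. y e (S e) / 1 \<le> 1" using PS by eventually_elim (simp add: P_def)
    show "((\<lambda>e::real. 1 - e\<^sup>2) \<longlongrightarrow> 1) (at_right 0)" using tendsto_diff[OF tendsto_const[of 1] sq] by simp
  qed
  have w_lim: "((\<lambda>e. S e * w e (S e) / 1) \<longlongrightarrow> 0) (at_right 0)"
  proof (rule tendsto_sandwich[OF _ _ tendsto_const sq])
    show "\<forall>\<^sub>F e in at_right 0. 0 \<le> S e * w e (S e) / 1" using PS eventually_at_right_less[of 0]
    proof eventually_elim
      case (elim e)
      then have "0 \<le> S e" using order_trans[of 0 "1 / e\<^sup>2" "S e"] by (simp add: P_def)
      then show ?case using elim by (simp add: P_def)
    qed
    show "\<forall>\<^sub>F e in at_right 0. S e * w e (S e) / 1 \<le> e\<^sup>2" using PS by eventually_elim (simp add: P_def)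
  qed
  have N_lim: "((\<lambda>e. pohozaev a e (y e) (w e) (S e) / e) \<longlongrightarrow> 0) (at_right 0)"
  proof (rule tendsto_sandwich[OF _ _ tendsto_const tendsto_ident_at])
    show "\<forall>\<^sub>F e in at_right 0. 0 \<le> pohozaev a e (y e) (w e) (S e) / e"
      using PS eventually_at_right_less[of 0] by eventually_elim (simp add: P_def)
    show "\<forall>\<^sub>F e in at_right 0. pohozaev a e (y e) (w e) (S e) / e \<le> e"
      using PS eventually_at_right_less[of 0]
      by eventually_elim (simp add: P_def field_simps power2_eq_square)
  qed
  interpret H: scaled_arcs a y w "\<lambda>e. T e 1" S "\<lambda>_. 1"
    by unfold_locales (use a_pos arcs in auto)
  have S_lim: "filterlim (\<lambda>e. S e / H.lam e) at_top (at_right 0)"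
    using S_top by (simp add: H.lam_def)
  have ends: "\<forall>\<^sub>F e in at_right 0. 0 \<le> w e (S e)" "\<forall>\<^sub>F e in at_right 0. y e (S e) \<le> 1"
    "\<forall>\<^sub>F e in at_right 0. 0 \<le> pohozaev a e (y e) (w e) (S e)"
    using PS by (eventually_elim, simp add: P_def)+
  have "((\<lambda>e::real. e * ln 1) \<longlongrightarrow> 0) (at_right 0)" by simp
  note rs = H.rising_step[OF this yT ends S_lim y_lim w_lim, folded K_def]
  have "((\<lambda>e. \<bar>w e (T e 1)\<bar>) \<longlongrightarrow> 1) (at_right 0)" using tendsto_rabs[OF rs(1)] by simp
  moreover have "((\<lambda>e. T e 1 * (w e (T e 1))\<^sup>2 / e) \<longlongrightarrow> K) (at_right 0)"
  proof (rule Lim_transform_eventually)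
    show "((\<lambda>e. (pohozaev a e (y e) (w e) (T e 1) - pohozaev a e (y e) (w e) (S e)) / e
        + pohozaev a e (y e) (w e) (S e) / e) \<longlongrightarrow> K) (at_right 0)"
      using tendsto_add[OF rs(2) N_lim] by simp
    show "\<forall>\<^sub>F e in at_right 0. (pohozaev a e (y e) (w e) (T e 1) - pohozaev a e (y e) (w e) (S e)) / e
        + pohozaev a e (y e) (w e) (S e) / e = T e 1 * (w e (T e 1))\<^sup>2 / e"
      using yT by eventually_elim (simp add: pohozaev_def flip: add_divide_distrib)
  qed
  ultimately show ?case by (simp add: height_def)
next
  case (Suc j)
  define k where "k = Suc j"
  have k: "1 \<le> k" "k < m" using Suc by (auto simp: k_def)
  define h where "h e = height (y e) (\<tau> e) k" for e
  define Y where "Y e t = (- 1) ^ k * y e t" for e t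
  define W where "W e t = (- 1) ^ k * w e t" for e t
  have IH: "((\<lambda>e. height (y e) (\<tau> e) j / (K * e) ^ j) \<longlongrightarrow> fact j) (at_right 0)"
    "((\<lambda>e. height (y e) (\<tau> e) j * \<bar>w e (T e k)\<bar>) \<longlongrightarrow> 1) (at_right 0)"
    "((\<lambda>e. T e k * (w e (T e k))\<^sup>2 / e) \<longlongrightarrow> real k * K) (at_right 0)"
    using Suc by (simp_all add: k_def)
  have sqW: "(W e t)\<^sup>2 = (w e t)\<^sup>2" "\<bar>W e t\<bar> = \<bar>w e t\<bar>" "\<bar>Y e t\<bar> = \<bar>y e t\<bar>" for e t
    by (simp_all add: W_def Y_def power_mult_distrib abs_mult flip: power_mult)
  have arc: "\<forall>\<^sub>F e in at_right 0. positive_arc a e (Y e) (W e) (T e (Suc k)) (T e k)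
     \<and> T e (Suc k) < \<tau> e k \<and> \<tau> e k < T e k \<and> W e (\<tau> e k) = 0 \<and> Y e (T e (Suc k)) = 0 \<and> Y e (T e k) = 0"
    using nodal
  proof eventually_elim
    case (elim e)
    then show ?case using k
      unfolding nodal_solution_def Y_def[abs_def] W_def[abs_def] by force
  qed
  have more: "\<forall>\<^sub>F e in at_right 0. 0 < T e k \<and> 0 < h e \<and> Y e (\<tau> e k) = h e \<and> W e (T e k) < 0 \<and> 0 < W e (T e (Suc k))"
    using arc
  proof eventually_elim
    case (elim e)
    then interpret positive_arc a e "Y e" "W e" "T e (Suc k)" "T e k" by simp
    have "0 < Y e (\<tau> e k)" using y_pos elim by auto
    moreover have "h e = \<bar>Y e (\<tau> e k)\<bar>" using k by (simp add: h_def height_def sqW)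
    moreover have "W e (T e k) < 0" "0 < W e (T e (Suc k))"
      using elim w_strict_antimono[of "\<tau> e k" "T e k"] w_strict_antimono[of "T e (Suc k)" "\<tau> e k"] by auto
    ultimately show ?case using A_pos A_less_B by auto
  qed
  have arc1: "\<forall>\<^sub>F e in at_right 0. positive_arc a e (Y e) (W e) (\<tau> e k) (T e k)"
    using arc by eventually_elim (auto intro: positive_arc.subarc)
  have arc2: "\<forall>\<^sub>F e in at_right 0. positive_arc a e (Y e) (W e) (T e (Suc k)) (\<tau> e k)"
    using arc by eventually_elim (auto intro: positive_arc.subarc)
  have h_pos: "\<forall>\<^sub>F e in at_right 0. 0 < h e" using more by eventually_elim simp
  have start: "\<forall>\<^sub>F e in at_right 0. Y e (\<tau> e k) = h e \<and> W e (\<tau> e k) = 0 \<and> Y e (T e k) = 0"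
    using arc more by eventually_elim simp
  have N_lim: "((\<lambda>e. T e k * (W e (T e k))\<^sup>2) \<longlongrightarrow> 0) (at_right 0)"
  proof (rule Lim_transform_eventually)
    show "((\<lambda>e. T e k * (w e (T e k))\<^sup>2 / e * e) \<longlongrightarrow> 0) (at_right 0)"
      using tendsto_mult[OF IH(3) tendsto_ident_at] by simp
    show "\<forall>\<^sub>F e in at_right 0. T e k * (w e (T e k))\<^sup>2 / e * e = T e k * (W e (T e k))\<^sup>2"
      using eventually_at_right_less[of 0] by eventually_elim (simp add: sqW)
  qed
  have sT: "((\<lambda>e. - W e (T e k) * T e k / (K * e) ^ k) \<longlongrightarrow> fact k) (at_right 0)"
  proof (rule Lim_transform_eventually)
    show "((\<lambda>e. (T e k * (w e (T e k))\<^sup>2 / e) / K * (height (y e) (\<tau> e) j / (K * e) ^ j)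
        / (height (y e) (\<tau> e) j * \<bar>w e (T e k)\<bar>)) \<longlongrightarrow> fact k) (at_right 0)"
    proof -
      have "((\<lambda>e. (T e k * (w e (T e k))\<^sup>2 / e) / K * (height (y e) (\<tau> e) j / (K * e) ^ j)
        / (height (y e) (\<tau> e) j * \<bar>w e (T e k)\<bar>)) \<longlongrightarrow> (real k * K) / K * fact j / 1) (at_right 0)"
        using K_pos by (intro tendsto_divide tendsto_mult IH tendsto_const) auto
      then show ?thesis using K_pos by (simp add: k_def)
    qed
    have "\<forall>\<^sub>F e in at_right 0. 0 < height (y e) (\<tau> e) j * \<bar>w e (T e k)\<bar>"
      using IH(2) by (rule order_tendstoD) simp
    then show "\<forall>\<^sub>F e in at_right 0. (T e k * (w e (T e k))\<^sup>2 / e) / K * (height (y e) (\<tau> e) j / (K * e) ^ j)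
        / (height (y e) (\<tau> e) j * \<bar>w e (T e k)\<bar>) = - W e (T e k) * T e k / (K * e) ^ k"
      using more eventually_at_right_less[of 0]
    proof eventually_elim
      case (elim e)
      define s where "s = \<bar>w e (T e k)\<bar>"
      define g where "g = height (y e) (\<tau> e) j"
      have s: "- W e (T e k) = s" "(w e (T e k))\<^sup>2 = s * s"
        using elim sqW(2)[of e "T e k"] by (auto simp: s_def power2_eq_square)
      have "s \<noteq> 0" "g \<noteq> 0" using elim by (auto simp: s_def g_def)
      then show ?case unfolding s s_def[symmetric] g_def[symmetric] using K_pos elim
        by (simp add: k_def field_simps)
    qed
  qed
  have sT0: "((\<lambda>e. - W e (T e k) * T e k) \<longlongrightarrow> 0) (at_right 0)"
  proof (rule Lim_transform_eventually)
    have "((\<lambda>e. (K * e) ^ k) \<longlongrightarrow> (K * 0) ^ k) (at_right 0)" by (intro tendsto_intros)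
    from tendsto_mult[OF sT this] show "((\<lambda>e. - W e (T e k) * T e k / (K * e) ^ k * (K * e) ^ k) \<longlongrightarrow> 0) (at_right 0)"
      using k by (simp add: zero_power)
    show "\<forall>\<^sub>F e in at_right 0. - W e (T e k) * T e k / (K * e) ^ k * (K * e) ^ k = - W e (T e k) * T e k"
      using eventually_at_right_less[of 0] by eventually_elim (use K_pos in simp)
  qed
  have "\<forall>\<^sub>F e in at_right 0. - W e (T e k) * T e k < 1"
    using sT0 by (rule order_tendstoD) simp
  then have sT1: "\<forall>\<^sub>F e in at_right 0. - W e (T e k) * T e k \<le> 1" by eventually_elim simp
  have sTln: "((\<lambda>e. e * ln (- W e (T e k) * T e k)) \<longlongrightarrow> 0) (at_right 0)"
    using K_pos _ sT by (rule eps_ln_lim) simp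
  interpret F: scaled_arcs a Y W "\<lambda>e. \<tau> e k" "\<lambda>e. T e k" h
    by unfold_locales (rule a_pos arc1 h_pos)+
  interpret R: scaled_arcs a Y W "\<lambda>e. T e (Suc k)" "\<lambda>e. \<tau> e k" h
    by unfold_locales (rule a_pos arc2 h_pos)+
  note fs = F.falling_step[OF start N_lim sT1 sTln]
  have Y0: "\<forall>\<^sub>F e in at_right 0. Y e (T e (Suc k)) = 0" "\<forall>\<^sub>F e in at_right 0. 0 \<le> W e (\<tau> e k)"
    "\<forall>\<^sub>F e in at_right 0. Y e (\<tau> e k) \<le> h e"
    using arc more by (eventually_elim, simp)+
  have Yh: "((\<lambda>e. Y e (\<tau> e k) / h e) \<longlongrightarrow> 1) (at_right 0)"
    using tendsto_const by (rule Lim_transform_eventually) (use more in eventually_elim, simp)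
  have Wh: "((\<lambda>e. \<tau> e k * W e (\<tau> e k) / h e) \<longlongrightarrow> 0) (at_right 0)"
    using tendsto_const by (rule Lim_transform_eventually) (use arc in eventually_elim, simp)
  note rs = R.rising_step[OF fs(1) Y0 fs(6) fs(2) Yh Wh]
  have 1: "((\<lambda>e. h e / (K * e) ^ k) \<longlongrightarrow> fact k) (at_right 0)"
  proof (rule Lim_transform_eventually)
    show "((\<lambda>e. (- W e (T e k) * T e k / (K * e) ^ k) / (- W e (T e k) * T e k / h e)) \<longlongrightarrow> fact k) (at_right 0)"
      using tendsto_divide[OF sT fs(3)] by simp
    show "\<forall>\<^sub>F e in at_right 0. (- W e (T e k) * T e k / (K * e) ^ k) / (- W e (T e k) * T e k / h e) = h e / (K * e) ^ k"
      using more by eventually_elim auto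
  qed
  have 2: "((\<lambda>e. h e * \<bar>w e (T e (Suc k))\<bar>) \<longlongrightarrow> 1) (at_right 0)"
    using rs(1)
  proof (rule Lim_transform_eventually)
    show "\<forall>\<^sub>F e in at_right 0. h e * W e (T e (Suc k)) = h e * \<bar>w e (T e (Suc k))\<bar>"
      using more by eventually_elim (metis abs_of_pos sqW(2))
  qed
  have 3: "((\<lambda>e. T e (Suc k) * (w e (T e (Suc k)))\<^sup>2 / e) \<longlongrightarrow> real (Suc k) * K) (at_right 0)"
  proof (rule Lim_transform_eventually)
    let ?N = "\<lambda>e. pohozaev a e (Y e) (W e)"
    show "((\<lambda>e. (?N e (T e (Suc k)) - ?N e (\<tau> e k)) / e + (?N e (\<tau> e k) - ?N e (T e k)) / e
        + T e k * (w e (T e k))\<^sup>2 / e) \<longlongrightarrow> real (Suc k) * K) (at_right 0)"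
      using tendsto_add[OF tendsto_add[OF rs(2) fs(5)] IH(3)] by (simp add: K_def algebra_simps)
    show "\<forall>\<^sub>F e in at_right 0. (?N e (T e (Suc k)) - ?N e (\<tau> e k)) / e + (?N e (\<tau> e k) - ?N e (T e k)) / e
        + T e k * (w e (T e k))\<^sup>2 / e = T e (Suc k) * (w e (T e (Suc k)))\<^sup>2 / e"
      using arc
    proof eventually_elim
      case (elim e)
      then have "?N e (T e (Suc k)) = T e (Suc k) * (w e (T e (Suc k)))\<^sup>2"
        "?N e (T e k) = T e k * (w e (T e k))\<^sup>2" by (simp_all add: pohozaev_def sqW)
      then show ?case by (simp add: diff_divide_distrib)
    qed
  qed
  have 4: "((\<lambda>e. \<bar>w e (T e k)\<bar> * \<tau> e k powr (1 + a) * h e powr (- 1 - 2 * a)) \<longlongrightarrow> 1) (at_right 0)"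
    using fs(4)
  proof (rule Lim_transform_eventually)
    show "\<forall>\<^sub>F e in at_right 0. - W e (T e k) * \<tau> e k powr (1 + a) * h e powr (- 1 - 2 * a)
       = \<bar>w e (T e k)\<bar> * \<tau> e k powr (1 + a) * h e powr (- 1 - 2 * a)"
      using more by eventually_elim (metis abs_of_neg sqW(2))
  qed
  show ?case using 1 2 3 4 by (simp add: h_def k_def)
qed

section \<open>Radial functions and the Laplacian\<close>

lemma profile_eq:
  fixes u :: "'a::euclidean_space \<Rightarrow> real"
  assumes "radial u" "0 \<le> r" "r \<le> 1" "b \<in> Basis"
  shows "profile u r = u (r *\<^sub>R b)"
  unfolding profile_def
proof (rule the_equality)
  show "\<forall>x. norm x = r \<longrightarrow> u x = u (r *\<^sub>R b)"
    using assms unfolding radial_def by (auto intro!: bspec)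
  fix c assume "\<forall>x. norm x = r \<longrightarrow> u x = c"
  then show "c = u (r *\<^sub>R b)" using assms by auto
qed

lemma has_directional_derivative:
  fixes u :: "'a::euclidean_space \<Rightarrow> real"
  assumes "u differentiable (at (x + h *\<^sub>R v))"
  shows "((\<lambda>h. u (x + h *\<^sub>R v)) has_real_derivative frechet_derivative u (at (x + h *\<^sub>R v)) v) (at h)"
proof -
  let ?D = "frechet_derivative u (at (x + h *\<^sub>R v))"
  have D: "(u has_derivative ?D) (at (x + h *\<^sub>R v))"
    using assms by (simp add: frechet_derivative_works)
  have "((\<lambda>h. x + h *\<^sub>R v) has_derivative (\<lambda>k. k *\<^sub>R v)) (at h)"
    by (auto intro!: derivative_eq_intros)
  from has_derivative_compose[OF this D]
  have "((\<lambda>h. u (x + h *\<^sub>R v)) has_derivative (\<lambda>k. ?D (k *\<^sub>R v))) (at h)" .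
  moreover have "?D (k *\<^sub>R v) = ?D v * k" for k
    using linear_scale[OF has_derivative_linear[OF D]] by (simp add: mult.commute)
  ultimately show ?thesis by (simp add: has_field_derivative_def)
qed

lemma norm_two_axes:
  fixes b b' :: "'a::euclidean_space"
  assumes "b \<in> Basis" "b' \<in> Basis" "b \<noteq> b'"
  shows "norm (r *\<^sub>R b + h *\<^sub>R b') = sqrt (r\<^sup>2 + h\<^sup>2)"
  using assms by (simp add: norm_eq_sqrt_inner inner_add_left inner_add_right inner_Basis
    inner_not_same_Basis power2_eq_square)

text \<open>A radial function is studied along the coordinate axis spanned by a basis vector \<open>b\<close>.\<close>
locale radial_C2 =
  fixes u :: "'a::euclidean_space \<Rightarrow> real" and b :: 'a
  assumes radial: "radial u" and C2: "C2_on (ball 0 1) u" and b: "b \<in> Basis"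
begin

definition slope :: "real \<Rightarrow> real" where
  "slope r = frechet_derivative u (at (r *\<^sub>R b)) b"

lemma diff_u: "norm x < 1 \<Longrightarrow> u differentiable (at x)"
  using C2 by (auto simp: C2_on_def C1_on_def)

lemma diff_partial: "norm x < 1 \<Longrightarrow> c \<in> Basis \<Longrightarrow> (\<lambda>x. frechet_derivative u (at x) c) differentiable (at x)"
  using C2 by (auto simp: C2_on_def C1_on_def)

lemma axis_deriv:
  assumes "\<bar>r\<bar> < 1"
  shows "((\<lambda>r. u (r *\<^sub>R b)) has_real_derivative slope r) (at r)"
  using has_directional_derivative[of u 0 r b] diff_u[of "r *\<^sub>R b"] assms b by (simp add: slope_def)

lemma slope_deriv:
  assumes "\<bar>r\<bar> < 1"
  shows "(slope has_real_derivative
     frechet_derivative (\<lambda>x. frechet_derivative u (at x) b) (at (r *\<^sub>R b)) b) (at r)"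
  using has_directional_derivative[of "\<lambda>x. frechet_derivative u (at x) b" 0 r b]
    diff_partial[of "r *\<^sub>R b" b] assms b by (simp add: slope_def[abs_def])

lemma axis_even: "\<bar>r\<bar> \<le> 1 \<Longrightarrow> u ((- r) *\<^sub>R b) = u (r *\<^sub>R b)"
  using radial b unfolding radial_def by (auto intro!: bspec[of "cball 0 1"])

lemma slope_0: "slope 0 = 0"
proof -
  have d: "((\<lambda>r. u (r *\<^sub>R b)) has_real_derivative slope 0) (at 0)" by (intro axis_deriv) simp
  have "((\<lambda>r. u ((- r) *\<^sub>R b)) has_real_derivative slope 0 * - 1) (at 0)"
    by (rule DERIV_chain2[where f = "\<lambda>r. u (r *\<^sub>R b)" and g = uminus])
       (use d in \<open>auto intro!: derivative_eq_intros\<close>)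
  then have "((\<lambda>r. u (r *\<^sub>R b)) has_real_derivative slope 0 * - 1) (at 0)"
    by (rule has_field_derivative_transform_within_open[where S = "{-1<..<1}"]) (use axis_even in auto)
  from DERIV_unique[OF d this] show ?thesis by simp
qed

text \<open>In a direction \<open>b'\<close> orthogonal to the axis, \<open>u (r b + h b')\<close> is the profile at \<open>\<rho> = sqrt (r\<^sup>2 + h\<^sup>2)\<close>, so its
  derivative in \<open>h\<close> is \<open>slope \<rho> \<cdot> h / \<rho>\<close>. Differentiating once more at \<open>h = 0\<close> only requires continuity of
  the slope.\<close>
lemma tangential_second_derivative:
  assumes r: "0 < r" "r < 1" and b': "b' \<in> Basis" "b' \<noteq> b"
  shows "frechet_derivative (\<lambda>x. frechet_derivative u (at x) b') (at (r *\<^sub>R b)) b' = slope r / r"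
proof -
  define g where "g h = frechet_derivative u (at (r *\<^sub>R b + h *\<^sub>R b')) b'" for h
  define \<rho> where "\<rho> h = sqrt (r\<^sup>2 + h\<^sup>2)" for h
  let ?D2 = "frechet_derivative (\<lambda>x. frechet_derivative u (at x) b') (at (r *\<^sub>R b)) b'"
  have norm_eq: "norm (r *\<^sub>R b + h *\<^sub>R b') = \<rho> h" for h
    unfolding \<rho>_def using b b' by (intro norm_two_axes) auto
  have \<rho>_pos: "0 < \<rho> h" for h using r by (auto simp: \<rho>_def add_pos_nonneg)
  have cont_\<rho>: "continuous_on UNIV \<rho>" unfolding \<rho>_def by (intro continuous_intros)
  define S where "S = {h. \<rho> h < 1}"
  have "r\<^sup>2 < 1" using r by (simp add: power_less_one_iff)
  then have S: "open S" "0 \<in> S"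
    using r cont_\<rho> by (auto simp: S_def \<rho>_def intro!: open_Collect_less continuous_intros)
  have g_deriv: "(g has_real_derivative ?D2) (at 0)"
    using has_directional_derivative[of "\<lambda>x. frechet_derivative u (at x) b'" "r *\<^sub>R b" 0 b']
      diff_partial[of "r *\<^sub>R b" b'] r b b' by (simp add: g_def[abs_def])
  have g_eq: "g h = slope (\<rho> h) * (h / \<rho> h)" if h: "h \<in> S" for h
  proof -
    have h1: "\<rho> h < 1" using h by (simp add: S_def)
    have 1: "((\<lambda>h. u (r *\<^sub>R b + h *\<^sub>R b')) has_real_derivative g h) (at h)"
      unfolding g_def using h1 norm_eq by (intro has_directional_derivative diff_u) auto
    have d\<rho>: "(\<rho> has_real_derivative h / \<rho> h) (at h)"
    proof -
      have pos: "0 < r\<^sup>2 + h\<^sup>2" using r by (simp add: add_pos_nonneg)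
      have "((\<lambda>h. r\<^sup>2 + h\<^sup>2) has_real_derivative 2 * h) (at h)"
        by (auto intro!: derivative_eq_intros)
      from DERIV_chain2[OF DERIV_real_sqrt[OF pos] this]
      show ?thesis unfolding \<rho>_def by (simp add: field_simps)
    qed
    have "((\<lambda>h. u (\<rho> h *\<^sub>R b)) has_real_derivative slope (\<rho> h) * (h / \<rho> h)) (at h)"
      by (rule DERIV_chain2[where f = "\<lambda>r. u (r *\<^sub>R b)" and g = \<rho>, OF axis_deriv d\<rho>])
        (use h1 \<rho>_pos[of h] in auto)
    then have "((\<lambda>h. u (r *\<^sub>R b + h *\<^sub>R b')) has_real_derivative slope (\<rho> h) * (h / \<rho> h)) (at h)"
    proof (rule has_field_derivative_transform_within_open[OF _ S(1) h])
      fix k assume "k \<in> S"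
      then have k: "\<rho> k < 1" by (simp add: S_def)
      show "u (\<rho> k *\<^sub>R b) = u (r *\<^sub>R b + k *\<^sub>R b')"
        using radial norm_eq[of k] k b \<rho>_pos[of k] unfolding radial_def
        by (auto intro!: bspec[of "cball 0 1"] mem_cball_0[THEN iffD2])
    qed
    from DERIV_unique[OF 1 this] show ?thesis .
  qed
  have g0: "g 0 = 0" using g_eq[OF S(2)] by simp
  have "((\<lambda>h. g h / h) \<longlongrightarrow> ?D2) (at 0)"
    using g_deriv g0 by (simp add: DERIV_def)
  moreover have "((\<lambda>h. g h / h) \<longlongrightarrow> slope r / r) (at 0)"
  proof (rule Lim_transform_eventually)
    have \<rho>0: "\<rho> 0 = r" using r by (simp add: \<rho>_def)
    have t\<rho>: "(\<rho> \<longlongrightarrow> r) (at 0)"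
      using cont_\<rho> \<rho>0 by (metis UNIV_I continuous_on_def)
    have "isCont slope r" using slope_deriv[of r] r by (intro DERIV_isCont) auto
    from isCont_tendsto_compose[OF this t\<rho>]
    show "((\<lambda>h. slope (\<rho> h) / \<rho> h) \<longlongrightarrow> slope r / r) (at 0)"
      using r by (intro tendsto_divide t\<rho>) auto
    have "\<forall>\<^sub>F h in at 0. h \<in> S \<and> h \<noteq> 0"
      using S eventually_at_topological[of "\<lambda>h. h \<in> S \<and> h \<noteq> 0"] by auto
    then show "\<forall>\<^sub>F h in at 0. slope (\<rho> h) / \<rho> h = g h / h"
      by eventually_elim (simp add: g_eq)
  qed
  ultimately show ?thesis by (rule tendsto_unique[OF trivial_limit_at])
qed

lemma laplacian_radial:
  assumes r: "0 < r" "r < 1"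
  shows "(slope has_real_derivative laplacian u (r *\<^sub>R b) - (real DIM('a) - 1) * (slope r / r)) (at r)"
proof -
  let ?D = "\<lambda>c. frechet_derivative (\<lambda>x. frechet_derivative u (at x) c) (at (r *\<^sub>R b)) c"
  have "laplacian u (r *\<^sub>R b) = ?D b + (\<Sum>c\<in>Basis - {b}. ?D c)"
    unfolding laplacian_def using b by (subst sum.remove[of _ b]) auto
  also have "(\<Sum>c\<in>Basis - {b}. ?D c) = (\<Sum>c\<in>Basis - {b}. slope r / r)"
    using r by (intro sum.cong tangential_second_derivative) auto
  also have "\<dots> = (real DIM('a) - 1) * (slope r / r)"
    using b by (simp add: card_Diff_singleton of_nat_diff DIM_positive Suc_leI)
  finally show ?thesis using slope_deriv[of r] r by simp
qed

end

lemma deriv_abs_powr: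
  fixes x c :: real
  assumes "1 < c"
  shows "((\<lambda>x. \<bar>x\<bar> powr c) has_real_derivative c * (\<bar>x\<bar> powr (c - 2) * x)) (at x)"
proof (cases "x = 0")
  case True
  have "((\<lambda>h. \<bar>h\<bar> powr (c - 1)) \<longlongrightarrow> \<bar>0\<bar> powr (c - 1)) (at (0::real))"
    using assms by (intro tendsto_powr' tendsto_rabs tendsto_ident_at tendsto_const) auto
  then have "((\<lambda>h. norm (\<bar>h\<bar> powr c / h)) \<longlongrightarrow> 0) (at (0::real))"
  proof (subst tendsto_cong)
    show "\<forall>\<^sub>F h in at (0::real). norm (\<bar>h\<bar> powr c / h) = \<bar>h\<bar> powr (c - 1)"
      using eventually_at_topological[of "\<lambda>h::real. h \<noteq> 0" 0 UNIV]
      by (auto simp: powr_diff abs_mult elim!: eventually_mono)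
  qed auto
  then have "((\<lambda>h. \<bar>h\<bar> powr c / h) \<longlongrightarrow> 0) (at (0::real))"
    by (rule tendsto_norm_zero_cancel)
  then show ?thesis using True assms by (simp add: DERIV_def)
next
  case False
  then consider "0 < x" | "x < 0" by linarith
  then show ?thesis
  proof cases
    case 1
    then have "((\<lambda>x. x powr c) has_real_derivative c * x powr (c - 1)) (at x)"
      by (auto intro!: derivative_eq_intros)
    then have "((\<lambda>x. \<bar>x\<bar> powr c) has_real_derivative c * x powr (c - 1)) (at x)"
      by (rule has_field_derivative_transform_within_open[where S = "{0<..}"]) (use 1 in auto)
    moreover have "x powr (c - 1) = x powr (c - 2) * x"
      using 1 by (simp add: powr_diff power2_eq_square)
    ultimately show ?thesis using 1 by simp
  next
    case 2
    then have "((\<lambda>x. (- x) powr c) has_real_derivative c * (- x) powr (c - 1) * - 1) (at x)"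
      by (auto intro!: derivative_eq_intros)
    then have "((\<lambda>x. \<bar>x\<bar> powr c) has_real_derivative c * (- x) powr (c - 1) * - 1) (at x)"
      by (rule has_field_derivative_transform_within_open[where S = "{..<0}"]) (use 2 in auto)
    moreover have "(- x) powr (c - 1) = (- x) powr (c - 2) * - x"
      using 2 by (simp add: powr_diff power2_eq_square)
    ultimately show ?thesis using 2 by simp
  qed
qed

section \<open>Enumerating finite sets in decreasing order\<close>

lemma kth_largest_enumerates:
  assumes "finite S" "card S = m"
  shows "kth_largest S ` {1..m} = S"
    and "1 \<le> i \<Longrightarrow> i < j \<Longrightarrow> j \<le> m \<Longrightarrow> kth_largest S j < kth_largest S i"
proof -
  define xs where "xs = sorted_list_of_set S"
  have xs: "length xs = m" "set xs = S" "sorted_wrt (<) xs"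
    using assms by (simp_all add: xs_def)
  have nth: "kth_largest S k = xs ! (m - k)" if "1 \<le> k" "k \<le> m" for k
    using that xs(1) by (simp add: kth_largest_def flip: xs_def add: rev_nth)
  show "kth_largest S ` {1..m} = S"
  proof
    show "kth_largest S ` {1..m} \<subseteq> S" using nth xs by auto
    show "S \<subseteq> kth_largest S ` {1..m}"
    proof
      fix x assume "x \<in> S"
      then obtain i where i: "i < m" "x = xs ! i" using xs by (auto simp: in_set_conv_nth)
      then have "x = kth_largest S (m - i)" using nth[of "m - i"] by auto
      then show "x \<in> kth_largest S ` {1..m}" using i by auto
    qed
  qed
  show "kth_largest S j < kth_largest S i" if "1 \<le> i" "i < j" "j \<le> m"
    using nth[of i] nth[of j] that xs sorted_wrt_nth_less[of "(<)" xs "m - j" "m - i"] by auto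
qed

lemma kth_largest_image:
  assumes f: "\<And>i j. 1 \<le> i \<Longrightarrow> i < j \<Longrightarrow> j \<le> m \<Longrightarrow> f j < f i"
  shows "card (f ` {1..m}) = m" and "1 \<le> k \<Longrightarrow> k \<le> m \<Longrightarrow> kth_largest (f ` {1..m}) k = f k"
proof -
  have inj: "inj_on f {1..m}"
  proof (rule inj_onI)
    fix i j assume "i \<in> {1..m}" "j \<in> {1..m}" "f i = f j"
    then show "i = j" using f[of i j] f[of j i] by (cases i j rule: linorder_cases) auto
  qed
  show "card (f ` {1..m}) = m" using card_image[OF inj] by simp
  have "sorted_list_of_set (f ` {1..m}) = rev (map f [1..<Suc m])"
  proof (rule sorted_distinct_set_unique)
    show "sorted (rev (map f [1..<Suc m]))"
      unfolding sorted_wrt_rev sorted_wrt_map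
    proof (rule sorted_wrt_mono_rel[OF _ sorted_wrt_upt])
      fix i j assume "i \<in> set [1..<Suc m]" "j \<in> set [1..<Suc m]" "i < j"
      then have "1 \<le> i" "i < j" "j \<le> m" by auto
      then show "f j \<le> f i" using f[of i j] by simp
    qed
    show "distinct (rev (map f [1..<Suc m]))"
      using inj by (simp add: distinct_map atLeastLessThanSuc_atLeastAtMost del: upt_Suc)
  qed (auto simp: atLeastLessThanSuc_atLeastAtMost simp del: upt_Suc)
  then show "1 \<le> k \<Longrightarrow> k \<le> m \<Longrightarrow> kth_largest (f ` {1..m}) k = f k"
    by (simp add: kth_largest_def nth_map del: upt_Suc)
qed

section \<open>Nodal structure of the Emden--Fowler equation\<close>

text \<open>Solutions of either sign, on the closed half line that starts at the image \<open>b\<close> of the boundary of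
  the ball.\<close>
locale emden_fowler =
  fixes a e :: real and y w :: "real \<Rightarrow> real" and b :: real
  assumes a_pos: "0 < a" and e_nonneg: "0 \<le> e" and e_less: "e < 2 * a" and b_pos: "0 < b"
    and cont_y: "continuous_on {b..} y" and cont_w: "continuous_on {b..} w"
    and deriv_y: "\<And>t. b < t \<Longrightarrow> (y has_real_derivative w t) (at t)"
    and deriv_w: "\<And>t. b < t \<Longrightarrow>
      (w has_real_derivative - ((1 + a) * (t powr (- 2 - a) * (\<bar>y t\<bar> powr (2 * a - e) * y t)))) (at t)"
    and y_lim: "(y \<longlongrightarrow> 1) at_top" and w_lim: "(w \<longlongrightarrow> 0) at_top"
begin

definition energy :: "real \<Rightarrow> real" where
  "energy t = (w t)\<^sup>2 / 2 + (1 + a) / (2 + 2 * a - e) * (t powr (- 2 - a) * \<bar>y t\<bar> powr (2 + 2 * a - e))"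

text \<open>The potential energy carries the decreasing weight \<open>t\<^bsup>-2-a\<^esup>\<close>, so the total energy decreases.\<close>
lemma energy_antimono:
  assumes "b \<le> s" "s \<le> t" shows "energy t \<le> energy s"
proof (rule nonincreasing_by_derivative[of b t energy])
  have cy: "continuous_on {b..t} y" and cw: "continuous_on {b..t} w"
    by (auto intro: continuous_on_subset[OF cont_y] continuous_on_subset[OF cont_w])
  have 1: "continuous_on {b..t} (\<lambda>t. t powr (- 2 - a))"
    by (intro continuous_on_powr continuous_on_id continuous_on_const) (use b_pos in auto)
  have 2: "continuous_on {b..t} (\<lambda>t. \<bar>y t\<bar> powr (2 + 2 * a - e))"
    by (rule continuous_on_powr'[OF continuous_on_rabs[OF cy] continuous_on_const]) (use a_pos e_less in auto)
  show "continuous_on {b..t} energy"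
    unfolding energy_def[abs_def]
    by (intro continuous_on_add continuous_on_divide continuous_on_power continuous_on_mult_left
        continuous_on_mult cw 1 2 continuous_on_const) auto
  fix x assume x: "b < x" "x < t"
  let ?c = "2 + 2 * a - e"
  have p: "((\<lambda>t. t powr (- 2 - a)) has_real_derivative (- 2 - a) * x powr (- 3 - a)) (at x)"
    using x b_pos by (intro deriv_powr) auto
  have "((\<lambda>t. \<bar>y t\<bar> powr ?c) has_real_derivative ?c * (\<bar>y x\<bar> powr (?c - 2) * y x) * w x) (at x)"
    by (rule DERIV_chain2[OF deriv_abs_powr deriv_y]) (use x e_less in auto)
  then have q: "((\<lambda>t. \<bar>y t\<bar> powr ?c) has_real_derivative ?c * (\<bar>y x\<bar> powr (2 * a - e) * y x) * w x) (at x)"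
    by simp
  have r: "((\<lambda>t. (w t)\<^sup>2 / 2) has_real_derivative
      w x * - ((1 + a) * (x powr (- 2 - a) * (\<bar>y x\<bar> powr (2 * a - e) * y x)))) (at x)"
    unfolding power2_eq_square
    by (rule DERIV_cong[OF DERIV_cdivide[OF DERIV_mult[OF deriv_w[OF x(1)] deriv_w[OF x(1)]]]]) simp
  have alg: "W * - ((1 + a) * (P * Z)) + (1 + a) / c * ((- 2 - a) * Q * R + c * Z * W * P)
      = - ((1 + a) / c * (2 + a) * (Q * R))" if "c \<noteq> 0" for W P Z Q R c :: real
    using that by (simp add: field_simps)
  show "(energy has_real_derivative
      - ((1 + a) / ?c * (2 + a) * (x powr (- 3 - a) * \<bar>y x\<bar> powr ?c))) (at x)"
    unfolding energy_def[abs_def]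
    by (rule DERIV_cong[OF DERIV_add[OF r DERIV_cmult[OF DERIV_mult[OF p q]]] alg]) (use e_less a_pos in simp)
next
  show "- ((1 + a) / (2 + 2 * a - e) * (2 + a) * (x powr (- 3 - a) * \<bar>y x\<bar> powr (2 + 2 * a - e))) \<le> 0" for x
    using a_pos e_less by simp
qed (use assms in auto)

text \<open>At a double zero the energy vanishes. It is nonnegative and decreasing, hence vanishes from there on,
  against \<open>y(\<infinity>) = 1\<close>.\<close>
lemma simple_zero:
  assumes t: "b \<le> t" and "y t = 0" shows "w t \<noteq> 0"
proof
  assume "w t = 0"
  then have "energy t = 0" using assms e_less by (simp add: energy_def)
  have y0: "y s = 0" if s: "t \<le> s" for s
  proof -
    have "energy s \<le> 0" using energy_antimono[OF t s] \<open>energy t = 0\<close> by simp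
    moreover have "0 \<le> (1 + a) / (2 + 2 * a - e) * (s powr (- 2 - a) * \<bar>y s\<bar> powr (2 + 2 * a - e))"
      using a_pos e_less by simp
    ultimately have "(1 + a) / (2 + 2 * a - e) * (s powr (- 2 - a) * \<bar>y s\<bar> powr (2 + 2 * a - e)) = 0"
      unfolding energy_def using zero_le_power2[of "w s"] by linarith
    then show ?thesis using a_pos e_less s t b_pos by auto
  qed
  have "(y \<longlongrightarrow> 0) at_top"
    by (rule tendsto_eventually, rule eventually_mono[OF eventually_ge_at_top[of t]]) (rule y0)
  then show False using y_lim tendsto_unique[of at_top y 0 1] by simp
qed

lemma sign_constant:
  assumes "b \<le> A" "\<And>t. A < t \<Longrightarrow> t < B \<Longrightarrow> y t \<noteq> 0" "A < c" "c < B" "0 < s * y c" "A < t" "t < B"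
  shows "0 < s * y t"
proof (rule ccontr)
  assume "\<not> 0 < s * y t"
  then have neg: "s * y t \<le> 0" by simp
  have cont: "continuous_on {u..v} (\<lambda>t. s * y t)" if "A < u" for u v
    using assms that by (intro continuous_intros continuous_on_subset[OF cont_y]) auto
  have "\<exists>x. A < x \<and> x < B \<and> s * y x = 0"
  proof (cases "c \<le> t")
    case True
    then obtain x where "c \<le> x" "x \<le> t" "s * y x = 0"
      using IVT2'[of "\<lambda>t. s * y t" t 0 c] neg assms cont[of c t] by auto
    then show ?thesis using assms by (intro exI[of _ x]) auto
  next
    case False
    then obtain x where "t \<le> x" "x \<le> c" "s * y x = 0"
      using IVT'[of "\<lambda>t. s * y t" t 0 c] neg assms cont[of t c] by auto
    then show ?thesis using assms by (intro exI[of _ x]) auto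
  qed
  then show False using assms by auto
qed

lemma positive_arcI:
  assumes "b \<le> A" "A < B" "s = 1 \<or> s = - 1" and pos: "\<And>t. A < t \<Longrightarrow> t < B \<Longrightarrow> 0 < s * y t"
  shows "positive_arc a e (\<lambda>t. s * y t) (\<lambda>t. s * w t) A B"
proof
  fix t assume t: "A < t" "t < B"
  show "0 < s * y t" using pos t by simp
  show "((\<lambda>t. s * y t) has_real_derivative s * w t) (at t)"
    using t assms by (intro DERIV_cmult deriv_y) auto
  have "\<bar>y t\<bar> = s * y t" using pos[OF t] assms(3) by auto
  then have "s * (\<bar>y t\<bar> powr (2 * a - e) * y t) = (s * y t) * (s * y t) powr (2 * a - e)"
    by simp
  also have "\<dots> = (s * y t) powr (1 + 2 * a - e)"
    using pos[OF t] powr_add[of "s * y t" 1 "2 * a - e"] by (simp add: add_diff_eq)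
  finally have "s * (- ((1 + a) * (t powr (- 2 - a) * (\<bar>y t\<bar> powr (2 * a - e) * y t))))
      = - ((1 + a) * (t powr (- 2 - a) * (s * y t) powr (1 + 2 * a - e)))"
    by (simp add: mult_ac)
  then show "((\<lambda>t. s * w t) has_real_derivative
      - ((1 + a) * (t powr (- 2 - a) * (s * y t) powr (1 + 2 * a - e)))) (at t)"
    using t assms by (intro DERIV_cong[OF DERIV_cmult[OF deriv_w]]) auto
next
  have "{A..B} \<subseteq> {b..}" using assms by auto
  then show "continuous_on {A..B} (\<lambda>t. s * y t)" "continuous_on {A..B} (\<lambda>t. s * w t)"
    by (auto intro!: continuous_on_mult_left continuous_on_subset[OF cont_y] continuous_on_subset[OF cont_w])
qed (use assms a_pos e_nonneg e_less b_pos in auto)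

text \<open>The zeros are simple, so the signs of consecutive humps alternate, starting with a positive one at infinity; on
  each hump the solution or its negative is strictly concave, which leaves room for exactly one
  critical point between two consecutive zeros and for none beyond the largest zero.\<close>
lemma nodal_structure:
  assumes fin: "finite {t\<in>{b..}. y t = 0}" and card: "card {t\<in>{b..}. y t = 0} = m"
    and b0: "y b = 0"
  shows "\<exists>T \<tau>. nodal_solution a e m y w T \<tau> \<and> {t\<in>{b..}. y t = 0} = T ` {1..m} \<and> T m = b
     \<and> (\<forall>i j. 1 \<le> i \<longrightarrow> i < j \<longrightarrow> j \<le> m \<longrightarrow> T j < T i)
     \<and> {t\<in>{b..}. w t = 0} = \<tau> ` {1..<m}"
proof -
  define Z where "Z = {t\<in>{b..}. y t = 0}"
  define T where "T = kth_largest Z"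
  have Z: "finite Z" "card Z = m" using fin card by (auto simp: Z_def)
  have TZ: "T ` {1..m} = Z" unfolding T_def using kth_largest_enumerates[OF Z] by simp
  have T_less: "T j < T i" if "1 \<le> i" "i < j" "j \<le> m" for i j
    unfolding T_def using kth_largest_enumerates(2)[OF Z] that by simp
  have T_le: "T j \<le> T i" if "1 \<le> i" "i \<le> j" "j \<le> m" for i j
    using T_less[of i j] that by (cases "i = j") auto
  have "b \<in> Z" using b0 by (simp add: Z_def)
  then have m: "1 \<le> m" using Z by (metis One_nat_def Suc_leI card_gt_0_iff empty_iff)
  have TinZ: "b \<le> T j" "y (T j) = 0" if "j \<in> {1..m}" for j
    using TZ that by (auto simp: Z_def)
  have Tm: "T m = b"
  proof -
    obtain i where "i \<in> {1..m}" "b = T i" using \<open>b \<in> Z\<close> TZ by auto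
    then have "T m \<le> b" using T_le[of i m] by auto
    then show ?thesis using TinZ(1)[of m] m by auto
  qed
  have T_between: "\<exists>j\<in>{1..<m}. T (Suc j) < t \<and> t < T j" if t: "b \<le> t" "t < T 1" "t \<notin> Z" for t
  proof -
    define j where "j = Max {i\<in>{1..m}. t < T i}"
    have j: "j \<in> {i\<in>{1..m}. t < T i}" unfolding j_def using t m by (intro Max_in) auto
    have "j \<noteq> m" using j Tm t by auto
    then have "j < m" using j by auto
    have "\<not> t < T (Suc j)"
    proof
      assume "t < T (Suc j)"
      then have "Suc j \<le> j" unfolding j_def
        using \<open>j < m\<close> j_def by (intro Max_ge) auto
      then show False by simp
    qed
    moreover have "t \<noteq> T (Suc j)" using t TZ \<open>j < m\<close> by auto
    ultimately show ?thesis using j \<open>j < m\<close> by (intro bexI[of _ j]) auto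
  qed
  have no_zero: "y t \<noteq> 0" if "T (Suc j) < t" "j = 0 \<or> t < T j" "j < m" for j t
  proof
    assume "y t = 0"
    moreover have "b \<le> T (Suc j)" using TinZ[of "Suc j"] that by auto
    ultimately have "t \<in> Z" using that by (auto simp: Z_def)
    then obtain i where i: "i \<in> {1..m}" "t = T i" using TZ by auto
    have "i < Suc j"
    proof (rule ccontr)
      assume "\<not> i < Suc j"
      then show False using T_le[of "Suc j" i] that i by auto
    qed
    moreover have "j < i"
    proof (rule ccontr)
      assume "\<not> j < i"
      then have "i \<le> j" "j \<noteq> 0" using i by auto
      then show False using T_le[of i j] that i by auto
    qed
    ultimately show False by simp
  qed
  have sign: "0 < (- 1) ^ j * y t" if "j < m" "T (Suc j) < t" "j = 0 \<or> t < T j" for j t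
    using that
  proof (induction j arbitrary: t)
    case 0
    have "\<forall>\<^sub>F s in at_top. 0 < y s" using y_lim by (rule order_tendstoD) simp
    then have "\<forall>\<^sub>F s in at_top. 0 < y s \<and> t < s" by (intro eventually_conj eventually_gt_at_top)
    then obtain s where s: "0 < y s" "t < s"
      using eventually_happens'[OF trivial_limit_at_top_linorder] by blast
    have "0 < 1 * y t"
    proof (rule sign_constant[of "T 1" "s + 1" s])
      show "y x \<noteq> 0" if "T 1 < x" for x using no_zero[of 0 x] that m by simp
    qed (use "0.prems" s TinZ(1)[of 1] m in simp_all)
    then show ?case by simp
  next
    case (Suc j)
    define B where "B = T (Suc j)"
    have B: "b < B" "y B = 0"
      using T_less[of "Suc j" m] Tm Suc.prems(1) TinZ[of "Suc j"] by (simp_all add: B_def)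
    have dB: "((\<lambda>t. (- 1) ^ j * y t) has_real_derivative (- 1) ^ j * w B) (at B)"
      by (intro DERIV_cmult deriv_y B)
    have sj: "Suc j < m" "T (Suc (Suc j)) < t" "t < T (Suc j)" using Suc.prems by auto
    have right: "0 < (- 1) ^ j * y s" if "B < s" "j = 0 \<or> s < T j" for s
      using Suc.IH[of s] sj(1) that by (simp add: B_def)
    have "\<not> (- 1) ^ j * w B < 0"
    proof
      assume "(- 1) ^ j * w B < 0"
      from DERIV_neg_dec_right[OF dB this] obtain d where
        d: "0 < d" "\<And>h. 0 < h \<Longrightarrow> h < d \<Longrightarrow> (- 1) ^ j * y (B + h) < (- 1) ^ j * y B" by blast
      define h where "h = (if j = 0 then d / 2 else min (d / 2) ((T j - B) / 2))"
      have "j \<noteq> 0 \<Longrightarrow> B < T j" using T_less[of j "Suc j"] sj(1) by (simp add: B_def)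
      then have "0 < h" "h < d" "j = 0 \<or> B + h < T j" using d(1) by (auto simp: h_def min_def field_simps)
      then show False using d(2)[of h] right[of "B + h"] B by auto
    qed
    moreover have "w B \<noteq> 0" using simple_zero[of B] B by simp
    then have "(- 1) ^ j * w B \<noteq> 0" by simp
    ultimately have "0 < (- 1) ^ j * w B" by linarith
    from DERIV_pos_inc_left[OF dB this] obtain d where
      d: "0 < d" "\<And>h. 0 < h \<Longrightarrow> h < d \<Longrightarrow> (- 1) ^ j * y (B - h) < (- 1) ^ j * y B" by blast
    define A where "A = T (Suc (Suc j))"
    have A: "b \<le> A" "A < B" using TinZ[of "Suc (Suc j)"] T_less[of "Suc j" "Suc (Suc j)"] sj(1)
      by (simp_all add: A_def B_def)
    define h where "h = min (d / 2) ((B - A) / 2)"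
    have h: "0 < h" "h < d" "A < B - h" "B - h < B" using d(1) A by (auto simp: h_def min_def field_simps)
    have "0 < (- 1) ^ Suc j * y t"
    proof (rule sign_constant[of A B "B - h"])
      show "y s \<noteq> 0" if "A < s" "s < B" for s
        using no_zero[of "Suc j" s] that sj(1) by (simp add: A_def B_def)
      show "0 < (- 1) ^ Suc j * y (B - h)" using d(2)[OF h(1,2)] B by simp
      show "A < t" "t < B" using sj by (simp_all add: A_def B_def)
    qed (use A h in simp_all)
    then show ?case .
  qed
  have arc: "positive_arc a e (\<lambda>t. (- 1) ^ j * y t) (\<lambda>t. (- 1) ^ j * w t) (T (Suc j)) (T j)"
    if "j \<in> {1..<m}" for j
  proof (rule positive_arcI)
    show "b \<le> T (Suc j)" using that by (intro TinZ) auto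
    show "T (Suc j) < T j" using that by (intro T_less) auto
    show "(- 1) ^ j = (1::real) \<or> (- 1) ^ j = (- 1 :: real)" by (cases "even j") simp_all
    show "0 < (- 1) ^ j * y t" if "T (Suc j) < t" "t < T j" for t
      using \<open>j \<in> {1..<m}\<close> that by (intro sign) auto
  qed
  have arc0: "positive_arc a e y w (T 1) S" if "T 1 < S" for S
  proof -
    have "positive_arc a e (\<lambda>t. 1 * y t) (\<lambda>t. 1 * w t) (T 1) S"
    proof (rule positive_arcI)
      show "0 < 1 * y t" if "T 1 < t" for t using sign[of 0 t] that m by simp
    qed (use that TinZ(1)[of 1] m in simp_all)
    then show ?thesis by simp
  qed
  have w_pos: "0 < w t" if t: "T 1 \<le> t" for t
  proof -
    have anti: "w s' < w s" if s: "T 1 \<le> s" "s < s'" for s s'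
    proof -
      interpret positive_arc a e y w "T 1" "s' + 1" using arc0 s by auto
      show ?thesis using w_strict_antimono[of s s'] s by auto
    qed
    have "0 \<le> w (t + 1)"
    proof (rule tendsto_upperbound[OF w_lim])
      show "\<forall>\<^sub>F s in at_top. w s \<le> w (t + 1)"
        using eventually_gt_at_top[of "t + 1"] by eventually_elim (use anti[of "t + 1"] t in force)
    qed auto
    then show ?thesis using anti[of t "t + 1"] t by linarith
  qed
  have "\<forall>j\<in>{1..<m}. \<exists>x. T (Suc j) < x \<and> x < T j \<and> w x = 0"
  proof
    fix j assume j: "j \<in> {1..<m}"
    have lt: "T (Suc j) < T j" using T_less j by auto
    have bT: "b \<le> T (Suc j)" using TinZ[of "Suc j"] j by auto
    obtain x where x: "T (Suc j) < x" "x < T j" "(y has_real_derivative 0) (at x)"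
    proof -
      have "\<exists>z. T (Suc j) < z \<and> z < T j \<and> (y has_real_derivative 0) (at z)"
      proof (rule Rolle[OF lt])
        show "y (T (Suc j)) = y (T j)" using TinZ(2)[of j] TinZ(2)[of "Suc j"] j by auto
        show "continuous_on {T (Suc j)..T j} y"
          using bT by (intro continuous_on_subset[OF cont_y]) auto
        show "y differentiable (at x)" if "T (Suc j) < x" "x < T j" for x
          using deriv_y[of x] that bT unfolding real_differentiable_def by auto
      qed
      then show ?thesis using that by blast
    qed
    then show "\<exists>x. T (Suc j) < x \<and> x < T j \<and> w x = 0"
      using DERIV_unique[OF x(3) deriv_y[of x]] bT by (intro exI[of _ x]) auto
  qed
  then obtain \<tau> where tau: "\<And>j. j \<in> {1..<m} \<Longrightarrow> T (Suc j) < \<tau> j \<and> \<tau> j < T j \<and> w (\<tau> j) = 0"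
    by metis
  have "{t\<in>{b..}. w t = 0} = \<tau> ` {1..<m}"
  proof
    show "\<tau> ` {1..<m} \<subseteq> {t\<in>{b..}. w t = 0}"
    proof
      fix t assume "t \<in> \<tau> ` {1..<m}"
      then obtain j where j: "j \<in> {1..<m}" "t = \<tau> j" by blast
      then show "t \<in> {t\<in>{b..}. w t = 0}" using tau[OF j(1)] TinZ(1)[of "Suc j"] by simp
    qed
    show "{t\<in>{b..}. w t = 0} \<subseteq> \<tau> ` {1..<m}"
    proof
      fix t assume "t \<in> {t\<in>{b..}. w t = 0}"
      then have t: "b \<le> t" "w t = 0" by auto
      then have "t \<notin> Z" using simple_zero by (auto simp: Z_def)
      moreover have "t < T 1" using w_pos[of t] t by force
      ultimately obtain j where j: "j \<in> {1..<m}" "T (Suc j) < t" "t < T j" using T_between t by blast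
      interpret positive_arc a e "\<lambda>t. (- 1) ^ j * y t" "\<lambda>t. (- 1) ^ j * w t" "T (Suc j)" "T j"
        using arc j by simp
      have "\<not> t < \<tau> j" using w_strict_antimono[of t "\<tau> j"] tau[OF j(1)] t j(2) by auto
      moreover have "\<not> \<tau> j < t" using w_strict_antimono[of "\<tau> j" t] tau[OF j(1)] t j(3) by auto
      ultimately have "t = \<tau> j" by simp
      then show "t \<in> \<tau> ` {1..<m}" using j by auto
    qed
  qed
  moreover have "nodal_solution a e m y w T \<tau>"
    unfolding nodal_solution_def
  proof (intro conjI ballI allI impI)
    show "(y \<longlongrightarrow> 1) at_top" "(w \<longlongrightarrow> 0) at_top" by (rule y_lim w_lim)+
    show "positive_arc a e y w (T 1) S" if "T 1 < S" for S using that by (rule arc0)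
    show "y (T j) = 0" if "j \<in> {1..m}" for j using that by (rule TinZ)
    fix j assume j: "j \<in> {1..<m}"
    show "T (Suc j) < \<tau> j" "\<tau> j < T j" "w (\<tau> j) = 0" using tau[OF j] by blast+
    show "positive_arc a e (\<lambda>t. (- 1) ^ j * y t) (\<lambda>t. (- 1) ^ j * w t) (T (Suc j)) (T j)"
      using j by (rule arc)
  qed
  moreover have "{t\<in>{b..}. y t = 0} = T ` {1..m}" by (simp only: TZ Z_def)
  ultimately show ?thesis
    by (intro exI[of _ T] exI[of _ \<tau>] conjI allI impI Tm T_less)
qed

end

section \<open>From the profile to the Emden--Fowler variable\<close>

text \<open>The properties of one solution \<open>u\<close> that enter the limit, with \<open>e\<close> in the role of \<open>\<epsilon>\<close>. They hold for
  \<open>\<alpha> = \<bar>u(0)\<bar>\<close> and \<open>y = \<plusminus> u / \<alpha>\<close> as a function of \<open>t = b r\<^bsup>2-n\<^esup>\<close>. The value of \<open>b\<close> is the one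
  that normalises the coefficient of the equation to \<open>1 + a\<close>. The \<open>k\<close>-th largest zero corresponds to
  \<open>T (m + 1 - k)\<close> and the \<open>k\<close>-th largest critical point to \<open>\<tau> (m - k)\<close>, since \<open>r\<close> decreases in \<open>t\<close>.\<close>
definition nodal_data ::
  "nat \<Rightarrow> nat \<Rightarrow> real \<Rightarrow> real \<Rightarrow> ('a::euclidean_space \<Rightarrow> real) \<Rightarrow> real \<Rightarrow> real \<Rightarrow> (real \<Rightarrow> real) \<Rightarrow> (real \<Rightarrow> real)
    \<Rightarrow> (nat \<Rightarrow> real) \<Rightarrow> (nat \<Rightarrow> real) \<Rightarrow> bool"
  where "nodal_data n m a e u \<alpha> b y w T \<tau> \<longleftrightarrow>
    0 < \<alpha> \<and> 0 < b \<and> b = (real n * (real n - 2)) powr (1 / a) * \<alpha> powr (- ((2 * a - e) / a)) \<and>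
    nodal_solution a e m y w T \<tau> \<and> T m = b \<and> (\<forall>j\<in>{1..m}. b \<le> T j) \<and> (\<forall>j\<in>{1..<m}. b \<le> \<tau> j) \<and>
    finite (crit_points u) \<and> card (crit_points u) = m \<and> finite (zeros u) \<and> card (zeros u) = m \<and>
    crit_pt u m = 0 \<and> zero_pt u 1 = 1 \<and>
    (\<forall>k\<in>{1..m}. crit_pt u k < zero_pt u k) \<and> (\<forall>k\<in>{1..m-1}. zero_pt u (k + 1) < crit_pt u k) \<and>
    (\<forall>k\<in>{1..m}. zero_pt u k = (b / T (m + 1 - k)) powr (a / 2)) \<and>
    (\<forall>k\<in>{1..m-1}. crit_pt u k = (b / \<tau> (m - k)) powr (a / 2)) \<and>
    (\<forall>k\<in>{1..m}. \<bar>profile u (crit_pt u k)\<bar> = \<alpha> * height y \<tau> (m - k)) \<and>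
    (\<forall>k\<in>{1..m}. \<bar>profile_deriv u (zero_pt u k)\<bar>
         = \<alpha> * (2 / a) * b * \<bar>w (T (m + 1 - k))\<bar> / zero_pt u k ^ (n - 1))"

locale radial_solution =
  fixes u :: "'a::euclidean_space \<Rightarrow> real" and n m :: nat and e a :: real
  assumes n_eq: "n = DIM('a)" and n: "3 \<le> n" and m: "1 \<le> m"
    and eps: "0 < e" "e < 2 * a" and a_eq: "a = 2 / (real n - 2)"
    and radial: "radial u" and sol: "dirichlet_solution (2 * a - e) u"
    and zeros_count: "has_interior_zeros u (m - 1)"
begin

definition axis_vec :: 'a where "axis_vec = (SOME i. i \<in> Basis)"

definition \<phi> :: "real \<Rightarrow> real" where "\<phi> r = u (r *\<^sub>R axis_vec)"

lemma axis_vec: "axis_vec \<in> Basis"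
  unfolding axis_vec_def by (rule someI_ex) (use nonempty_Basis in blast)

sublocale radial_C2 u axis_vec
  using radial sol axis_vec by unfold_locales (auto simp: dirichlet_solution_def)

definition source :: "real \<Rightarrow> real" where
  "source r = r ^ (n - 1) * (\<bar>\<phi> r\<bar> powr (2 * a - e) * \<phi> r)"

definition flux :: "real \<Rightarrow> real" where
  "flux r = - integral {0..r} source"

lemma a_pos: "0 < a" using n by (simp add: a_eq)

lemma profile_\<phi>: "0 \<le> r \<Longrightarrow> r \<le> 1 \<Longrightarrow> profile u r = \<phi> r"
  using profile_eq[OF radial _ _ axis_vec] by (simp add: \<phi>_def)

lemma cont_\<phi>: "continuous_on {0..1} \<phi>"
proof -
  have "continuous_on (cball 0 1) u" using sol by (simp add: dirichlet_solution_def)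
  then show ?thesis unfolding \<phi>_def
    by (rule continuous_on_compose2) (use axis_vec in \<open>auto intro!: continuous_intros\<close>)
qed

lemma \<phi>_1: "\<phi> 1 = 0"
  using sol axis_vec by (simp add: dirichlet_solution_def \<phi>_def)

lemma deriv_\<phi>: "\<bar>r\<bar> < 1 \<Longrightarrow> (\<phi> has_real_derivative slope r) (at r)"
  using axis_deriv by (simp add: \<phi>_def[abs_def])

lemma deriv_slope:
  assumes "0 < r" "r < 1"
  shows "(slope has_real_derivative - (\<bar>\<phi> r\<bar> powr (2 * a - e) * \<phi> r) - (real n - 1) * (slope r / r)) (at r)"
proof -
  have "- laplacian u (r *\<^sub>R axis_vec) = \<bar>\<phi> r\<bar> powr (2 * a - e) * \<phi> r"
    using sol assms axis_vec by (simp add: dirichlet_solution_def \<phi>_def)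
  then have "laplacian u (r *\<^sub>R axis_vec) = - (\<bar>\<phi> r\<bar> powr (2 * a - e) * \<phi> r)" by linarith
  then show ?thesis using laplacian_radial[OF assms] n_eq by simp
qed

lemma cont_slope: "r < 1 \<Longrightarrow> continuous_on {0..r} slope"
  by (intro continuous_at_imp_continuous_on ballI DERIV_isCont[OF slope_deriv]) auto

text \<open>In the variable \<open>r\<close> the energy is damped by the first order term. If the profile vanished at the
  origin, the energy would be \<open>0\<close> there, hence everywhere, and \<open>u\<close> would have infinitely many zeros.\<close>
lemma phi_0_nonzero: "\<phi> 0 \<noteq> 0"
proof
  assume 0: "\<phi> 0 = 0"
  let ?c = "2 + 2 * a - e"
  define E where "E r = slope r * slope r / 2 + \<bar>\<phi> r\<bar> powr ?c / ?c" for r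
  have "\<phi> r = 0" if r: "0 \<le> r" "r < 1" for r
  proof -
    have c\<phi>: "continuous_on {0..r} \<phi>" using cont_\<phi> r by (auto intro: continuous_on_subset)
    have c1: "continuous_on {0..r} (\<lambda>r. \<bar>\<phi> r\<bar> powr ?c)"
      by (rule continuous_on_powr'[OF continuous_on_rabs[OF c\<phi>] continuous_on_const]) (use eps a_pos in auto)
    have "E r \<le> E 0"
    proof (rule nonincreasing_by_derivative[of 0 r E])
      show "continuous_on {0..r} E" unfolding E_def[abs_def] using eps
        by (intro continuous_on_add continuous_on_divide continuous_on_mult c1 cont_slope[OF r(2)]
            continuous_on_const) auto
      fix x assume x: "0 < x" "x < r"
      have d: "((\<lambda>r. \<bar>\<phi> r\<bar> powr ?c) has_real_derivative ?c * (\<bar>\<phi> x\<bar> powr (?c - 2) * \<phi> x) * slope x) (at x)"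
        by (rule DERIV_chain2[OF deriv_abs_powr deriv_\<phi>]) (use x r eps in auto)
      have x1: "x < 1" using x r by simp
      have alg: "((- F - k * (V / x)) * V + (- F - k * (V / x)) * V) / 2 + c * F * V / c = - (k * (V * V) / x)"
        if "c \<noteq> 0" for c k V F :: real using that x by (simp add: field_simps)
      have "2 * a - e = ?c - 2" by simp
      then have dV: "(slope has_real_derivative - (\<bar>\<phi> x\<bar> powr (?c - 2) * \<phi> x) - (real n - 1) * (slope x / x)) (at x)"
        using deriv_slope[OF x(1) x1] by metis
      show "(E has_real_derivative - ((real n - 1) * (slope x * slope x) / x)) (at x)"
        unfolding E_def[abs_def]
        by (rule DERIV_cong[OF DERIV_add[OF DERIV_cdivide[OF DERIV_mult[OF dV dV]] DERIV_cdivide[OF d]]])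
          (rule alg, use eps in simp)
      show "- ((real n - 1) * (slope x * slope x) / x) \<le> 0" using x n by simp
    qed (use r in auto)
    also have "E 0 = 0" using eps 0 by (simp add: E_def slope_0)
    finally have "\<bar>\<phi> r\<bar> powr ?c / ?c \<le> 0" unfolding E_def using zero_le_square[of "slope r"] by linarith
    then have "\<bar>\<phi> r\<bar> powr ?c \<le> 0" using eps by (simp add: divide_le_0_iff)
    then show ?thesis by simp
  qed
  then have "{0<..<1} \<subseteq> zeros u \<inter> {0<..<1}" using profile_\<phi> by (auto simp: zeros_def)
  moreover have "finite (zeros u \<inter> {0<..<1})" using zeros_count by (simp add: has_interior_zeros_def)
  ultimately have "finite {0<..<1::real}" by (rule finite_subset)
  then show False using infinite_Ioo[of 0 "1::real"] by simp
qed

lemma cont_source: "continuous_on {0..1} source"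
proof -
  have "continuous_on {0..1} (\<lambda>r. \<bar>\<phi> r\<bar> powr (2 * a - e))"
    by (rule continuous_on_powr'[OF continuous_on_rabs[OF cont_\<phi>] continuous_on_const]) (use eps in auto)
  then show ?thesis unfolding source_def[abs_def]
    by (intro continuous_on_mult continuous_on_power continuous_on_id cont_\<phi>)
qed

lemma cont_flux: "continuous_on {0..1} flux"
  unfolding flux_def[abs_def]
  by (intro continuous_on_minus indefinite_integral_continuous_1 integrable_continuous_real cont_source)

lemma deriv_flux:
  assumes "0 < r" "r < 1" shows "(flux has_real_derivative - source r) (at r)"
proof -
  have "((\<lambda>r. integral {0..r} source) has_real_derivative source r) (at r within {0..1})"
    using assms by (intro integral_has_real_derivative cont_source) auto
  then have "((\<lambda>r. integral {0..r} source) has_real_derivative source r) (at r)"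
    using assms at_within_interior[of r "{0..1}"] by simp
  then show ?thesis unfolding flux_def[abs_def] by (rule DERIV_minus)
qed

lemma flux_0: "flux 0 = 0" by (simp add: flux_def)

text \<open>The divergence form of the equation. Unlike \<open>slope\<close>, the flux makes sense up to \<open>r = 1\<close>.\<close>
lemma flux_eq:
  assumes r: "0 \<le> r" "r < 1" shows "r ^ (n - 1) * slope r = flux r"
proof -
  have "r ^ (n - 1) * slope r - flux r = 0 ^ (n - 1) * slope 0 - flux 0" 
  proof (cases "r = 0")
    case False
    with r have r0: "0 < r" by simp
    show ?thesis
    proof (rule DERIV_isconst2[OF r0])
      show "continuous_on {0..r} (\<lambda>r. r ^ (n - 1) * slope r - flux r)"
        using r by (intro continuous_on_diff continuous_on_mult continuous_on_power continuous_on_id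
            cont_slope continuous_on_subset[OF cont_flux]) auto
      fix x assume x: "0 < x" "x < r"
      obtain k where k: "n - 1 = Suc k" using n by (cases "n - 1") auto
      then have nk: "real n - 1 = real (Suc k)" "n - Suc 0 = Suc k" using n by linarith+
      have p: "((\<lambda>x. x ^ Suc k) has_real_derivative real (Suc k) * x ^ k) (at x)"
        using DERIV_pow[of "Suc k" x] by simp
      have x1: "x < 1" using x r by simp
      show "((\<lambda>r. r ^ (n - 1) * slope r - flux r) has_real_derivative 0) (at x)"
        unfolding k
        by (rule DERIV_cong[OF DERIV_diff[OF DERIV_mult[OF p deriv_slope[OF x(1) x1]] deriv_flux[OF x(1) x1]]])
          (use x in \<open>simp add: source_def k nk field_simps\<close>)
    qed (use r in auto)
  qed simp
  then show ?thesis using slope_0 flux_0 by simp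
qed

lemma deriv_profile_0: "(profile u has_real_derivative 0) (at 0 within {0..1})"
proof -
  have "(\<phi> has_real_derivative 0) (at 0 within {0..1})"
    using deriv_\<phi>[of 0] slope_0 by (auto intro: has_field_derivative_at_within)
  then show ?thesis
    by (rule has_field_derivative_transform_within[where d = 1]) (auto simp: profile_\<phi>)
qed

text \<open>At \<open>r = 1\<close> a classical solution is merely continuous. There the derivative exists because \<open>u\<close> differs by a
  constant from the integral of \<open>flux r / r\<^bsup>n-1\<^esup>\<close>, which is continuous up to the boundary.\<close>
lemma deriv_profile:
  assumes r: "0 < r" "r \<le> 1"
  shows "(profile u has_real_derivative flux r / r ^ (n - 1)) (at r within {0..1})"
proof -
  define V where "V r = flux r / r ^ (n - 1)" for r
  define c where "c = r / 2"
  have c: "0 < c" "c < r" "c < 1" using r by (auto simp: c_def)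
  have cV: "continuous_on {c..1} V" unfolding V_def[abs_def]
    using c by (intro continuous_on_divide continuous_on_power continuous_on_id continuous_on_subset[OF cont_flux]) auto
  have dJ: "((\<lambda>x. integral {c..x} V) has_real_derivative V x) (at x within {c..1})" if "x \<in> {c..1}" for x
    using cV that by (rule integral_has_real_derivative)
  have const: "\<phi> x - integral {c..x} V = \<phi> c - integral {c..c} V" if x: "c \<le> x" "x \<le> 1" for x
  proof (rule DERIV_isconst2[OF c(3) _ _ x])
    show "continuous_on {c..1} (\<lambda>x. \<phi> x - integral {c..x} V)"
      using c by (intro continuous_on_diff continuous_on_subset[OF cont_\<phi>] indefinite_integral_continuous_1
          integrable_continuous_real cV) auto
    fix x assume x: "c < x" "x < 1"
    have "((\<lambda>x. integral {c..x} V) has_real_derivative V x) (at x)"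
      using dJ[of x] x at_within_interior[of x "{c..1}"] by simp
    moreover have "slope x = V x" using flux_eq[of x] x c by (simp add: V_def field_simps)
    ultimately show "((\<lambda>x. \<phi> x - integral {c..x} V) has_real_derivative 0) (at x)"
      using DERIV_diff[OF deriv_\<phi>[of x], of "\<lambda>x. integral {c..x} V" "V x"] x c by simp
  qed
  have "((\<lambda>x. integral {c..x} V + \<phi> c) has_real_derivative V r + 0) (at r within {c..1})"
    using r c by (intro DERIV_add dJ DERIV_const) auto
  then have "((\<lambda>x. integral {c..x} V + \<phi> c) has_real_derivative V r) (at r within {c..1})" by simp
  then have "(profile u has_real_derivative V r) (at r within {c..1})"
  proof (rule has_field_derivative_transform_within)
    show "r \<in> {c..1}" using r c by simp
    show "integral {c..x} V + \<phi> c = profile u x" if "x \<in> {c..1}" for x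
      using const[of x] that c by (simp add: profile_\<phi>)
  qed (rule zero_less_one)
  moreover have "at r within {c..1} = at r within {0..1}"
    by (rule at_within_nhd[where S = "{c<..}"]) (use c r in auto)
  ultimately show ?thesis by (simp add: V_def)
qed

lemma profile_deriv_eq:
  assumes r: "0 < r" "r \<le> 1"
  shows "profile_deriv u r = flux r / r ^ (n - 1)"
  unfolding profile_deriv_def
  by (rule vector_derivative_within_cbox[of 0 1, simplified])
     (use deriv_profile[OF r] r in \<open>auto simp: has_real_derivative_iff_has_vector_derivative\<close>)

lemma zeros_eq: "zeros u = {r\<in>{0<..1}. \<phi> r = 0}"
  using phi_0_nonzero by (auto simp: zeros_def profile_\<phi> order_less_le)

lemma crit_points_eq: "crit_points u = insert 0 {r\<in>{0<..1}. flux r = 0}"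
proof (intro set_eqI iffI)
  fix r assume "r \<in> crit_points u"
  then have r: "0 \<le> r" "r \<le> 1" and d: "(profile u has_real_derivative 0) (at r within {0..1})"
    by (auto simp: crit_points_def)
  show "r \<in> insert 0 {r\<in>{0<..1}. flux r = 0}"
  proof (cases "r = 0")
    case False
    with r have r0: "0 < r" by simp
    have "profile_deriv u r = 0"
      unfolding profile_deriv_def
      by (rule vector_derivative_within_cbox[of 0 1, simplified])
         (use d r in \<open>auto simp: has_real_derivative_iff_has_vector_derivative\<close>)
    then show ?thesis using profile_deriv_eq[OF r0 r(2)] r0 r by simp
  qed simp
next
  fix r assume "r \<in> insert 0 {r\<in>{0<..1}. flux r = 0}"
  then show "r \<in> crit_points u"
    using deriv_profile_0 deriv_profile[of r] by (auto simp: crit_points_def)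
qed

lemma zeros_finite: "finite (zeros u)" "card (zeros u) = m"
proof -
  have *: "zeros u = insert 1 (zeros u \<inter> {0<..<1})"
    using \<phi>_1 by (auto simp: zeros_eq)
  have fin: "finite (zeros u \<inter> {0<..<1})" "card (zeros u \<inter> {0<..<1}) = m - 1"
    using zeros_count by (auto simp: has_interior_zeros_def)
  show "finite (zeros u)" using fin(1) by (subst *) simp
  show "card (zeros u) = m" using fin m by (subst *) simp
qed

definition \<alpha> :: real where "\<alpha> = \<bar>\<phi> 0\<bar>"

definition b :: real where
  "b = (real n * (real n - 2)) powr (1 / a) * \<alpha> powr (- ((2 * a - e) / a))"

text \<open>The inverse of \<open>r \<mapsto> b r\<^bsup>2-n\<^esup>\<close>, as \<open>a / 2 = 1 / (n - 2)\<close>.\<close>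
definition radius :: "real \<Rightarrow> real" where "radius t = (b / t) powr (a / 2)"

definition y :: "real \<Rightarrow> real" where "y t = sgn (\<phi> 0) / \<alpha> * \<phi> (radius t)"

definition w :: "real \<Rightarrow> real" where
  "w t = - (sgn (\<phi> 0) / \<alpha> * (a / 2) / b) * flux (radius t)"

lemma \<alpha>_pos: "0 < \<alpha>" using phi_0_nonzero by (simp add: \<alpha>_def)

lemma b_pos: "0 < b" using \<alpha>_pos n by (auto simp: b_def)

lemma b_powr: "b powr a = real n * (real n - 2) * \<alpha> powr - (2 * a - e)"
  using n \<alpha>_pos a_pos by (simp add: b_def powr_mult powr_powr)

lemma radius_pos: "b \<le> t \<Longrightarrow> 0 < radius t"
  using b_pos by (simp add: radius_def)

lemma radius_strict: "b \<le> s \<Longrightarrow> s < t \<Longrightarrow> radius t < radius s"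
  unfolding radius_def using b_pos a_pos
  by (intro powr_less_mono2) (auto intro!: divide_strict_left_mono mult_pos_pos)

lemma radius_b: "radius b = 1" using b_pos by (simp add: radius_def)

lemma radius_le: "b \<le> t \<Longrightarrow> radius t \<le> 1"
  using radius_strict[of b t] radius_b by (cases "t = b") auto

lemma radius_surj:
  assumes "0 < r" "r \<le> 1" shows "\<exists>t\<ge>b. radius t = r"
proof (intro exI conjI)
  show "b \<le> b * r powr (- (2 / a))"
    using powr_mono2'[of "- (2 / a)" r 1] assms b_pos a_pos by auto
  have "b / (b * r powr (- (2 / a))) = r powr (2 / a)" using b_pos by (simp add: powr_minus divide_inverse)
  then show "radius (b * r powr (- (2 / a))) = r"
    unfolding radius_def using assms a_pos by (simp add: powr_powr)
qed

lemma deriv_radius: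
  assumes "b \<le> t"
  shows "(radius has_real_derivative - (a / 2) * (radius t / t)) (at t)"
proof -
  have t: "0 < t" using assms b_pos by simp
  have e: "radius = (\<lambda>s. b powr (a / 2) * s powr (- (a / 2)))"
    by (rule ext) (simp add: radius_def powr_divide powr_minus_divide)
  have p: "((\<lambda>s. s powr (- (a / 2))) has_real_derivative - (a / 2) * t powr (- (a / 2) - 1)) (at t)"
    using t by (intro deriv_powr) auto
  have "b powr (a / 2) * (- (a / 2) * t powr (- (a / 2) - 1)) = - (a / 2) * (radius t / t)"
    unfolding e powr_diff using t by simp
  from DERIV_cong[OF DERIV_cmult[OF p] this] show ?thesis unfolding e .
qed

lemma radius_power:
  assumes "b \<le> t" shows "radius t ^ k = (b / t) powr (a / 2 * real k)"
  using radius_pos[OF assms] by (simp add: powr_realpow[symmetric] radius_def powr_powr)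

lemma radius_power': 
  assumes "b \<le> t" shows "radius t ^ (n - 2) = b / t" "radius t ^ n = (b / t) powr (1 + a)"
proof -
  have 1: "a / 2 * real (n - 2) = 1" and 2: "a / 2 * real n = 1 + a"
    using n by (auto simp: a_eq of_nat_diff field_simps)
  show "radius t ^ (n - 2) = b / t" "radius t ^ n = (b / t) powr (1 + a)"
    unfolding radius_power[OF assms] 1 2 using assms b_pos by simp_all
qed

lemma cont_radius: "continuous_on {b..} radius"
  by (intro continuous_at_imp_continuous_on ballI DERIV_isCont[OF deriv_radius]) auto

lemma radius_lim: "(radius \<longlongrightarrow> 0) at_top"
proof -
  have e: "radius s = b powr (a / 2) * s powr (- (a / 2))" for s
    by (simp add: radius_def powr_divide powr_minus_divide)
  have "((\<lambda>s. b powr (a / 2) * s powr (- (a / 2))) \<longlongrightarrow> b powr (a / 2) * 0) at_top"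
    using a_pos by (intro tendsto_mult tendsto_const tendsto_neg_powr filterlim_ident) auto
  then show ?thesis unfolding e[abs_def] by simp
qed

lemma compose_radius_lim:
  assumes "continuous_on {0..1} f" shows "((\<lambda>t. f (radius t)) \<longlongrightarrow> f 0) at_top"
proof (rule continuous_on_tendsto_compose[OF assms radius_lim])
  show "\<forall>\<^sub>F t in at_top. radius t \<in> {0..1}"
    using eventually_ge_at_top[of b] by eventually_elim (use radius_pos radius_le in force)
qed simp

lemma compose_radius_cont:
  assumes "continuous_on {0..1} f" shows "continuous_on {b..} (\<lambda>t. f (radius t))"
  by (rule continuous_on_compose2[OF assms cont_radius]) (use radius_pos radius_le in force)

sublocale EF: emden_fowler a e y w b
proof
  show "continuous_on {b..} y" unfolding y_def[abs_def]
    by (intro continuous_on_mult_left compose_radius_cont cont_\<phi>)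
  show "continuous_on {b..} w" unfolding w_def[abs_def]
    by (intro continuous_on_mult_left compose_radius_cont cont_flux)
  have "((\<lambda>t. sgn (\<phi> 0) / \<alpha> * \<phi> (radius t)) \<longlongrightarrow> sgn (\<phi> 0) / \<alpha> * \<phi> 0) at_top"
    by (intro tendsto_mult_left compose_radius_lim cont_\<phi>)
  moreover have "sgn (\<phi> 0) / \<alpha> * \<phi> 0 = 1" using phi_0_nonzero by (simp add: \<alpha>_def sgn_if)
  ultimately show "(y \<longlongrightarrow> 1) at_top" by (simp only: y_def[abs_def])
  have "((\<lambda>t. - (sgn (\<phi> 0) / \<alpha> * (a / 2) / b) * flux (radius t)) \<longlongrightarrow>
      - (sgn (\<phi> 0) / \<alpha> * (a / 2) / b) * flux 0) at_top"
    by (intro tendsto_mult_left compose_radius_lim cont_flux)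
  then show "(w \<longlongrightarrow> 0) at_top" by (simp add: w_def[abs_def] flux_0)
  fix t assume t: "b < t"
  then have t0: "0 < t" and bt: "b \<le> t" using b_pos by auto
  define g where "g = radius t"
  have g: "0 < g" "g < 1" using radius_pos[OF bt] radius_strict[of b t] radius_b t by (auto simp: g_def)
  note dr = deriv_radius[OF bt]
  have n1: "g ^ (n - 1) = g * (b / t)" "g ^ (n - 1) * g = (b / t) powr (1 + a)"
    using power_Suc[of g "n - 2"] power_Suc[of g "n - 1"] n radius_power'[OF bt]
    by (simp_all add: g_def Suc_diff_Suc numeral_2_eq_2 mult.commute)
  have fl: "flux g = g * (b / t) * slope g" using flux_eq[of g] g n1 by simp
  have "((\<lambda>t. \<phi> (radius t)) has_real_derivative slope g * (- (a / 2) * (g / t))) (at t)"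
    unfolding g_def by (rule DERIV_chain2[OF deriv_\<phi> dr]) (use g in \<open>auto simp: g_def\<close>)
  from DERIV_cmult[OF this, of "sgn (\<phi> 0) / \<alpha>"]
  show "(y has_real_derivative w t) (at t)"
    unfolding y_def[abs_def]
    by (rule DERIV_cong) (use b_pos t0 in \<open>simp add: w_def fl mult_ac flip: g_def\<close>)
  have "((\<lambda>t. flux (radius t)) has_real_derivative - source g * (- (a / 2) * (g / t))) (at t)"
    unfolding g_def by (rule DERIV_chain2[OF deriv_flux dr]) (use g in \<open>auto simp: g_def\<close>)
  from DERIV_cmult[OF this, of "- (sgn (\<phi> 0) / \<alpha> * (a / 2) / b)"]
  show "(w has_real_derivative - ((1 + a) * (t powr (- 2 - a) * (\<bar>y t\<bar> powr (2 * a - e) * y t)))) (at t)"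
    unfolding w_def[abs_def]
  proof (rule DERIV_cong)
    define F where "F = \<bar>\<phi> g\<bar> powr (2 * a - e) * \<phi> g"
    have sgn: "\<bar>sgn (\<phi> 0)\<bar> = 1" using phi_0_nonzero by (simp add: sgn_if)
    have ya: "\<bar>y t\<bar> = \<bar>\<phi> g\<bar> / \<alpha>"
      unfolding y_def g_def[symmetric] abs_mult abs_divide sgn using \<alpha>_pos by simp
    have "\<bar>y t\<bar> powr (2 * a - e) * y t
        = \<bar>\<phi> g\<bar> powr (2 * a - e) * (1 / \<alpha> powr (2 * a - e)) * (sgn (\<phi> 0) / \<alpha> * \<phi> g)"
      unfolding ya powr_divide by (simp add: y_def g_def)
    then have yF: "\<bar>y t\<bar> powr (2 * a - e) * y t = sgn (\<phi> 0) / \<alpha> * \<alpha> powr - (2 * a - e) * F"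
      unfolding powr_minus_divide[symmetric] F_def by (simp only: mult_ac)
    have sg: "source g * g = (b / t) powr (1 + a) * F"
      unfolding source_def F_def[symmetric] n1(2)[symmetric] by (simp add: mult_ac)
    have t2: "t powr (- 2 - a) = 1 / (t * t * t powr a)"
    proof -
      have "- 2 - a = - (2 + a)" by simp
      then have "t powr (- 2 - a) = 1 / t powr (2 + a)" by (metis powr_minus_divide)
      also have "t powr (2 + a) = t * t * t powr a"
        using t0 by (simp add: powr_add power2_eq_square)
      finally show ?thesis .
    qed
    have "(b / t) powr (1 + a) = (b * b powr a) / (t * t powr a)"
      using b_pos t0 by (simp add: powr_divide powr_add)
    then have bb: "(b / t) powr (1 + a) / (b * t) = b powr a * t powr (- 2 - a)"
      unfolding t2 using b_pos t0 by simp
    \<comment> \<open>this identity is the reason for the value of \<open>b\<close>\<close>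
    have an: "(a / 2) * (a / 2) * (real n * (real n - 2)) = 1 + a"
    proof -
      define k where "k = real n - 2"
      have k: "0 < k" "real n = k + 2" "a = 2 / k" using n by (auto simp: k_def a_eq)
      then show ?thesis unfolding k(2,3) by (simp add: field_simps)
    qed
    have "- (sgn (\<phi> 0) / \<alpha> * (a / 2) / b) * (- source g * (- (a / 2) * (g / t)))
       = - (sgn (\<phi> 0) / \<alpha>) * ((a / 2) * (a / 2)) * ((source g * g) / (b * t))"
      by (simp add: field_simps)
    also have "\<dots> = - (sgn (\<phi> 0) / \<alpha>) * ((a / 2) * (a / 2)) * (((b / t) powr (1 + a) / (b * t)) * F)"
      unfolding sg by simp
    also have "\<dots> = - (((a / 2) * (a / 2) * (real n * (real n - 2))) *
        (t powr (- 2 - a) * (sgn (\<phi> 0) / \<alpha> * \<alpha> powr - (2 * a - e) * F)))"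
      unfolding bb b_powr by (simp add: mult_ac)
    finally show "- (sgn (\<phi> 0) / \<alpha> * (a / 2) / b) * (- source g * (- (a / 2) * (g / t)))
       = - ((1 + a) * (t powr (- 2 - a) * (\<bar>y t\<bar> powr (2 * a - e) * y t)))"
      unfolding an yF .
  qed
qed (use a_pos eps b_pos in auto)

lemma radius_inj: "inj_on radius {b..}"
proof (rule inj_onI)
  fix s t assume "s \<in> {b..}" "t \<in> {b..}" "radius s = radius t"
  then show "s = t" using radius_strict[of s t] radius_strict[of t s]
    by (cases s t rule: linorder_cases) auto
qed

lemma y_zero_iff: "b \<le> t \<Longrightarrow> y t = 0 \<longleftrightarrow> \<phi> (radius t) = 0"
  using \<alpha>_pos phi_0_nonzero by (simp add: y_def sgn_if)

lemma w_zero_iff: "b \<le> t \<Longrightarrow> w t = 0 \<longleftrightarrow> flux (radius t) = 0"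
  using \<alpha>_pos phi_0_nonzero b_pos a_pos by (simp add: w_def sgn_if)

lemma image_zero_set:
  assumes "\<And>t. b \<le> t \<Longrightarrow> f t = 0 \<longleftrightarrow> h (radius t) = 0"
  shows "radius ` {t\<in>{b..}. f t = 0} = {r\<in>{0<..1}. h r = 0}"
proof (intro set_eqI iffI)
  fix r assume "r \<in> radius ` {t\<in>{b..}. f t = 0}"
  then show "r \<in> {r\<in>{0<..1}. h r = 0}" using assms radius_pos radius_le by auto
next
  fix r assume r: "r \<in> {r\<in>{0<..1}. h r = 0}"
  then obtain t where "b \<le> t" "radius t = r" using radius_surj[of r] by auto
  then show "r \<in> radius ` {t\<in>{b..}. f t = 0}" using r assms by (intro image_eqI[of _ _ t]) auto
qed

lemma nodal_data_exists: "\<exists>T \<tau>. nodal_data n m a e u \<alpha> b y w T \<tau>"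
proof -
  have zset: "radius ` {t\<in>{b..}. y t = 0} = zeros u"
    unfolding zeros_eq by (rule image_zero_set) (rule y_zero_iff)
  have cset: "radius ` {t\<in>{b..}. w t = 0} = {r\<in>{0<..1}. flux r = 0}"
    by (rule image_zero_set) (rule w_zero_iff)
  have inj: "inj_on radius {t\<in>{b..}. y t = 0}" by (rule inj_on_subset[OF radius_inj]) auto
  have fin: "finite {t\<in>{b..}. y t = 0}" using zset zeros_finite(1) finite_imageD[OF _ inj] by simp
  have card: "card {t\<in>{b..}. y t = 0} = m" using card_image[OF inj] zset zeros_finite(2) by simp
  have yb: "y b = 0" using y_zero_iff[of b] radius_b \<phi>_1 by simp
  from EF.nodal_structure[OF fin card yb] obtain T \<tau> where nodal: "nodal_solution a e m y w T \<tau>"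
    and TZ: "{t\<in>{b..}. y t = 0} = T ` {1..m}" and Tm: "T m = b"
    and T_less': "\<forall>i j. 1 \<le> i \<longrightarrow> i < j \<longrightarrow> j \<le> m \<longrightarrow> T j < T i"
    and tauZ: "{t\<in>{b..}. w t = 0} = \<tau> ` {1..<m}"
    by (elim exE conjE)
  have T_less: "T j < T i" if "1 \<le> i" "i < j" "j \<le> m" for i j using T_less' that by simp
  have Tb: "b \<le> T j" if "j \<in> {1..m}" for j using TZ that by auto
  have taub: "b \<le> \<tau> j" if "j \<in> {1..<m}" for j using tauZ that by auto
  have tau: "T (Suc j) < \<tau> j" "\<tau> j < T j" if "j \<in> {1..<m}" for j
    using nodal that unfolding nodal_solution_def by auto
  define \<rho> where "\<rho> k = radius (T (m + 1 - k))" for k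
  define \<delta> where "\<delta> k = (if k = m then 0 else radius (\<tau> (m - k)))" for k
  have idx: "(\<lambda>k. m + 1 - k) ` {1..m} = {1..m}"
  proof
    show "{1..m} \<subseteq> (\<lambda>k. m + 1 - k) ` {1..m}"
    proof
      fix j assume "j \<in> {1..m}"
      then show "j \<in> (\<lambda>k. m + 1 - k) ` {1..m}" by (intro image_eqI[of _ _ "m + 1 - j"]) auto
    qed
  qed auto
  have idx': "(\<lambda>k. m - k) ` {1..<m} = {1..<m}"
  proof
    show "{1..<m} \<subseteq> (\<lambda>k. m - k) ` {1..<m}"
    proof
      fix j assume "j \<in> {1..<m}"
      then show "j \<in> (\<lambda>k. m - k) ` {1..<m}" by (intro image_eqI[of _ _ "m - j"]) auto
    qed
  qed auto
  have zeros_\<rho>: "zeros u = \<rho> ` {1..m}"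
  proof -
    have "zeros u = radius ` T ` (\<lambda>k. m + 1 - k) ` {1..m}" unfolding zset[symmetric] TZ idx ..
    also have "\<dots> = \<rho> ` {1..m}" by (simp only: image_image \<rho>_def[abs_def])
    finally show ?thesis .
  qed
  have "{1..m} = insert m {1..<m}" using m by auto
  then have "\<delta> ` {1..m} = insert 0 ((\<lambda>k. radius (\<tau> (m - k))) ` {1..<m})" by (auto simp: \<delta>_def)
  also have "(\<lambda>k. radius (\<tau> (m - k))) ` {1..<m} = radius ` \<tau> ` (\<lambda>k. m - k) ` {1..<m}"
    by (simp add: image_image)
  also have "\<dots> = {r\<in>{0<..1}. flux r = 0}" unfolding idx' tauZ[symmetric] by (rule cset)
  finally have crit_\<delta>: "crit_points u = \<delta> ` {1..m}" by (simp add: crit_points_eq)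
  have \<rho>\<delta>: "\<delta> k < \<rho> k" if k: "k \<in> {1..m}" for k
  proof (cases "k = m")
    case True
    moreover have "b \<le> T (m + 1 - k)" using k by (intro Tb) auto
    ultimately show ?thesis using radius_pos by (simp add: \<delta>_def \<rho>_def)
  next
    case False
    have "m - k \<in> {1..<m}" "m + 1 - k = Suc (m - k)" using k False by auto
    then have "T (m + 1 - k) < \<tau> (m - k)" using tau(1)[of "m - k"] by simp
    moreover have "b \<le> T (m + 1 - k)" using k by (intro Tb) auto
    ultimately show ?thesis using False by (auto simp: \<delta>_def \<rho>_def intro!: radius_strict)
  qed
  \<comment> \<open>the critical point \<open>\<delta> k\<close> lies between the zeros \<open>\<rho> (k + 1)\<close> and \<open>\<rho> k\<close>\<close>
  have \<delta>\<rho>: "\<rho> (k + 1) < \<delta> k" if k: "k \<in> {1..m-1}" for k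
  proof -
    have "\<tau> (m - k) < T (m - k)" "b \<le> \<tau> (m - k)" using tau(2)[of "m - k"] taub[of "m - k"] k by auto
    moreover have "k \<noteq> m" "m + 1 - (k + 1) = m - k" using k m by auto
    ultimately show ?thesis by (auto simp: \<delta>_def \<rho>_def intro!: radius_strict)
  qed
  have \<rho>_less: "\<rho> j < \<rho> i" if "1 \<le> i" "i < j" "j \<le> m" for i j
    unfolding \<rho>_def
  proof (rule radius_strict)
    show "b \<le> T (m + 1 - i)" using that by (intro Tb) auto
    have "1 \<le> m + 1 - j" "m + 1 - j < m + 1 - i" "m + 1 - i \<le> m" using that by auto
    then show "T (m + 1 - i) < T (m + 1 - j)" by (rule T_less)
  qed
  have \<delta>_less: "\<delta> j < \<delta> i" if "1 \<le> i" "i < j" "j \<le> m" for i j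
  proof -
    have "\<delta> j < \<rho> j" using that by (intro \<rho>\<delta>) auto
    also have "\<rho> j \<le> \<rho> (i + 1)" using \<rho>_less[of "i + 1" j] that by (cases "j = i + 1") auto
    also have "\<rho> (i + 1) < \<delta> i" using that by (intro \<delta>\<rho>) auto
    finally show ?thesis .
  qed
  have zpt: "zero_pt u k = \<rho> k" if "k \<in> {1..m}" for k
    unfolding zero_pt_def zeros_\<rho> using kth_largest_image(2)[of m \<rho> k] \<rho>_less that by simp
  have cpt: "crit_pt u k = \<delta> k" if "k \<in> {1..m}" for k
    unfolding crit_pt_def crit_\<delta> using kth_largest_image(2)[of m \<delta> k] \<delta>_less that by simp
  have 1: "finite (crit_points u)" "card (crit_points u) = m"
    unfolding crit_\<delta> using kth_largest_image(1)[of m \<delta>] \<delta>_less by auto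
  have 2: "crit_pt u m = 0" "zero_pt u 1 = 1"
    using cpt[of m] zpt[of 1] m Tm radius_b by (auto simp: \<delta>_def \<rho>_def)
  have 3: "\<bar>profile u (crit_pt u k)\<bar> = \<alpha> * height y \<tau> (m - k)" if k: "k \<in> {1..m}" for k
  proof (cases "k = m")
    case True
    then show ?thesis using 2 profile_\<phi>[of 0] by (simp add: \<alpha>_def height_def)
  next
    case False
    have t: "b \<le> \<tau> (m - k)" using taub[of "m - k"] k False by auto
    have "\<bar>y (\<tau> (m - k))\<bar> = \<bar>\<phi> (radius (\<tau> (m - k)))\<bar> / \<alpha>"
      using phi_0_nonzero \<alpha>_pos by (simp add: y_def abs_mult sgn_if)
    then show ?thesis using False k cpt[OF k] \<alpha>_pos radius_pos[OF t] radius_le[OF t]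
      by (simp add: height_def \<delta>_def profile_\<phi>)
  qed
  have 4: "\<bar>profile_deriv u (zero_pt u k)\<bar>
         = \<alpha> * (2 / a) * b * \<bar>w (T (m + 1 - k))\<bar> / zero_pt u k ^ (n - 1)" if k: "k \<in> {1..m}" for k
  proof -
    have t: "b \<le> T (m + 1 - k)" using k by (intro Tb) auto
    have "\<bar>w (T (m + 1 - k))\<bar> = \<bar>flux (\<rho> k)\<bar> * (a / 2) / (\<alpha> * b)"
      using phi_0_nonzero \<alpha>_pos b_pos a_pos by (simp add: w_def \<rho>_def abs_mult sgn_if mult_ac)
    then have "\<bar>flux (\<rho> k)\<bar> = \<alpha> * (2 / a) * b * \<bar>w (T (m + 1 - k))\<bar>"
      using \<alpha>_pos b_pos a_pos by (simp add: field_simps)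
    moreover have "0 < \<rho> k" "\<rho> k \<le> 1" using radius_pos[OF t] radius_le[OF t] by (auto simp: \<rho>_def)
    ultimately show ?thesis using profile_deriv_eq[of "\<rho> k"] zpt[OF k] by simp
  qed
  have 5: "zero_pt u k = (b / T (m + 1 - k)) powr (a / 2)" if "k \<in> {1..m}" for k
    using zpt[OF that] by (simp add: \<rho>_def radius_def)
  have 6: "crit_pt u k = (b / \<tau> (m - k)) powr (a / 2)" if k: "k \<in> {1..m-1}" for k
  proof -
    have "k \<in> {1..m}" "k \<noteq> m" using k m by auto
    then show ?thesis using cpt[of k] by (simp add: \<delta>_def radius_def)
  qed
  have 7: "crit_pt u k < zero_pt u k" if "k \<in> {1..m}" for k using \<rho>\<delta> zpt cpt that by simp
  have 8: "zero_pt u (k + 1) < crit_pt u k" if k: "k \<in> {1..m-1}" for k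
    using \<delta>\<rho>[OF k] zpt[of "k + 1"] cpt[of k] k by auto
  have "b = (real n * (real n - 2)) powr (1 / a) * \<alpha> powr (- ((2 * a - e) / a))" by (rule b_def)
  then have "nodal_data n m a e u \<alpha> b y w T \<tau>"
    unfolding nodal_data_def by (intro conjI ballI \<alpha>_pos b_pos nodal Tm Tb taub 1 2 zeros_finite 3 4 5 6 7 8)
  then show ?thesis by blast
qed

end

section \<open>Functions asymptotic to a power\<close>

text \<open>\<open>f \<sim> c (K e)\<^bsup>p\<^esup>\<close> as \<open>e \<rightarrow> 0+\<close>, with a positive coefficient. Such functions can be multiplied, divided and raised
  to real powers, so that all the limits of the theorem follow from a few of them by bookkeeping.\<close>
definition power_rate :: "real \<Rightarrow> (real \<Rightarrow> real) \<Rightarrow> real \<Rightarrow> real \<Rightarrow> bool" where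
  "power_rate K f p c \<longleftrightarrow> 0 < c \<and> ((\<lambda>e. f e * (K * e) powr - p) \<longlongrightarrow> c) (at_right 0)"

lemma power_rate_pos:
  assumes "0 < K" "power_rate K f p c" shows "\<forall>\<^sub>F e in at_right 0. 0 < f e"
proof -
  have "\<forall>\<^sub>F e in at_right 0. 0 < f e * (K * e) powr - p"
    using assms by (intro order_tendstoD(1)[of _ c]) (auto simp: power_rate_def)
  then show ?thesis by eventually_elim (simp add: zero_less_mult_iff)
qed

lemma power_rate_cong:
  assumes "power_rate K f p c" "\<forall>\<^sub>F e in at_right 0. f e = g e" shows "power_rate K g p c"
proof -
  have "((\<lambda>e. g e * (K * e) powr - p) \<longlongrightarrow> c) (at_right 0)"
  proof (rule Lim_transform_eventually)
    show "((\<lambda>e. f e * (K * e) powr - p) \<longlongrightarrow> c) (at_right 0)" using assms by (simp add: power_rate_def)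
    show "\<forall>\<^sub>F e in at_right 0. f e * (K * e) powr - p = g e * (K * e) powr - p"
      using assms(2) by eventually_elim simp
  qed
  then show ?thesis using assms by (simp add: power_rate_def)
qed

lemma power_rate_mult:
  assumes "power_rate K f p c" "power_rate K g q d"
  shows "power_rate K (\<lambda>e. f e * g e) (p + q) (c * d)"
proof -
  have "((\<lambda>e. (f e * (K * e) powr - p) * (g e * (K * e) powr - q)) \<longlongrightarrow> c * d) (at_right 0)"
    using assms by (intro tendsto_mult) (auto simp: power_rate_def)
  moreover have "(f e * (K * e) powr - p) * (g e * (K * e) powr - q)
      = f e * g e * (K * e) powr - (p + q)" for e
    using powr_add[of "K * e" "- p" "- q"] by (simp add: mult_ac)
  ultimately show ?thesis using assms by (simp add: power_rate_def)
qed

lemma power_rate_powr: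
  assumes "0 < K" "power_rate K f p c"
  shows "power_rate K (\<lambda>e. f e powr s) (p * s) (c powr s)"
proof -
  have "((\<lambda>e. (f e * (K * e) powr - p) powr s) \<longlongrightarrow> c powr s) (at_right 0)"
    using assms by (intro tendsto_powr tendsto_const) (auto simp: power_rate_def)
  moreover have "(f e * (K * e) powr - p) powr s = f e powr s * (K * e) powr - (p * s)" for e
    by (simp add: powr_mult powr_powr)
  ultimately show ?thesis using assms by (simp add: power_rate_def)
qed

lemma power_rate_const: "0 < c \<Longrightarrow> 0 < K \<Longrightarrow> power_rate K (\<lambda>_. c) 0 c"
proof -
  assume "0 < c" "0 < K"
  have "((\<lambda>e::real. c) \<longlongrightarrow> c) (at_right 0)" by simp
  moreover have "\<forall>\<^sub>F e in at_right 0. c = c * (K * e) powr - 0"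
    using eventually_at_right_less[of 0] by eventually_elim (use \<open>0 < K\<close> in simp)
  ultimately show ?thesis using \<open>0 < c\<close> unfolding power_rate_def by (auto intro: Lim_transform_eventually)
qed

lemma power_rate_0:
  assumes "0 < c" "0 < K" "(f \<longlongrightarrow> c) (at_right 0)" shows "power_rate K f 0 c"
proof -
  have "\<forall>\<^sub>F e in at_right 0. f e = f e * (K * e) powr - 0"
    using eventually_at_right_less[of 0] by eventually_elim (use \<open>0 < K\<close> in simp)
  then show ?thesis using assms unfolding power_rate_def by (auto intro: Lim_transform_eventually)
qed

lemma power_rate_ident: assumes "0 < K" shows "power_rate K (\<lambda>e. e) 1 (1 / K)"
proof -
  have "((\<lambda>e::real. 1 / K) \<longlongrightarrow> 1 / K) (at_right 0)" by simp
  moreover have "\<forall>\<^sub>F e in at_right 0. 1 / K = e * (K * e) powr - 1"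
    using eventually_at_right_less[of 0]
    by eventually_elim (use assms in \<open>simp add: powr_minus field_simps\<close>)
  ultimately show ?thesis using assms unfolding power_rate_def by (auto intro: Lim_transform_eventually)
qed

lemma power_rate_divide:
  assumes "0 < K" "power_rate K f p c" "power_rate K g q d"
  shows "power_rate K (\<lambda>e. f e / g e) (p - q) (c / d)"
proof -
  have g: "power_rate K (\<lambda>e. g e powr - 1) (q * - 1) (d powr - 1)"
    using assms by (intro power_rate_powr)
  have "power_rate K (\<lambda>e. f e * g e powr - 1) (p + q * - 1) (c * d powr - 1)"
    using assms(2) g by (rule power_rate_mult)
  moreover have "\<forall>\<^sub>F e in at_right 0. f e * g e powr - 1 = f e / g e"
    using power_rate_pos[OF assms(1,3)] by eventually_elim (simp add: powr_minus divide_inverse)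
  ultimately have "power_rate K (\<lambda>e. f e / g e) (p + q * - 1) (c * d powr - 1)"
    by (rule power_rate_cong)
  moreover have "0 < d" using assms by (simp add: power_rate_def)
  ultimately show ?thesis by (simp add: powr_minus divide_inverse)
qed

lemma power_rate_same_rate:
  assumes "0 < K" "power_rate K (\<lambda>e. \<bar>f e\<bar>) p c" shows "same_rate f (\<lambda>e. e powr p)"
proof -
  have "((\<lambda>e. \<bar>f e\<bar> * (K * e) powr - p * K powr p) \<longlongrightarrow> c * K powr p) (at_right 0)"
    using assms by (intro tendsto_mult tendsto_const) (auto simp: power_rate_def)
  moreover have "\<forall>\<^sub>F e in at_right 0. \<bar>f e\<bar> * (K * e) powr - p * K powr p = \<bar>f e\<bar> / e powr p"
    using eventually_at_right_less[of 0]
    by eventually_elim (use assms in \<open>simp add: powr_mult powr_minus field_simps\<close>)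
  ultimately have "((\<lambda>e. \<bar>f e\<bar> / e powr p) \<longlongrightarrow> c * K powr p) (at_right 0)"
    by (rule Lim_transform_eventually)
  moreover have "0 < c * K powr p" using assms by (simp add: power_rate_def)
  ultimately show ?thesis unfolding same_rate_def by blast
qed

lemma power_rateD: "power_rate K f p c \<Longrightarrow> q = - p \<Longrightarrow> c = d \<Longrightarrow> ((\<lambda>e. f e * (K * e) powr q) \<longlongrightarrow> d) (at_right 0)"
  by (simp add: power_rate_def)

lemma Gamma_diff_fact: "k \<le> m \<Longrightarrow> Gamma (real m - real k + 1) = fact (m - k)"
  using Gamma_fact[of "m - k", where 'a = real] by (simp add: of_nat_diff add.commute)

lemma Gamma_pred_fact: "1 \<le> m \<Longrightarrow> Gamma (real m) = fact (m - 1)"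
  using Gamma_fact[of "m - 1", where 'a = real] by (simp add: of_nat_diff)

lemma kappa_pos: "3 \<le> n \<Longrightarrow> 0 < kappa n"
  unfolding kappa_def by (intro mult_pos_pos divide_pos_pos zero_less_power Gamma_real_pos) auto

section \<open>The coefficients\<close>

text \<open>The four identities below turn the coefficients of the theorem into the form in which the calculus of
  power rates produces them. Both sides are positive products of powers, so it suffices to compare logarithms.\<close>
lemma coeff_D_eq:
  assumes "3 \<le> n" "1 \<le> k" "k \<le> m" and a: "a = 2 / (real n - 2)"
  shows "coeff_D n k m =
    ((real n * (real n - 2)) powr (1 / a) / (real m * (fact (m - 1))\<^sup>2)) powr (1 / 2) * fact (m - k)"
proof -
  define N where "N = real n - 2"
  define M F :: real where "M = fact (m - 1)" and "F = fact (m - k)"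
  have pos: "0 < N" "0 < real n" "0 < real m" "0 < M" "0 < F" using assms by (auto simp: N_def M_def F_def)
  have G: "Gamma (real m - real k + 1) = F" "Gamma (real m) = M"
    using assms Gamma_diff_fact Gamma_pred_fact by (auto simp: M_def F_def)
  have "ln ((real n * N) powr (N / 4) * (F / (real m powr (1 / 2) * M)))
      = ln (((real n * N) powr (N / 2) / (real m * M\<^sup>2)) powr (1 / 2) * F)"
    using pos by (simp add: ln_mult ln_div ln_powr ln_realpow field_simps)
  then have "(real n * N) powr (N / 4) * (F / (real m powr (1 / 2) * M))
      = ((real n * N) powr (N / 2) / (real m * M\<^sup>2)) powr (1 / 2) * F"
    using pos by (subst (asm) ln_inj_iff) auto
  then show ?thesis unfolding coeff_D_def G a N_def[symmetric] M_def[symmetric] F_def[symmetric] by simp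
qed

lemma coeff_z_eq:
  assumes "3 \<le> n" "1 \<le> k" "k \<le> m" and a: "a = 2 / (real n - 2)"
  shows "coeff_z n k m = (real m * (fact (m - 1))\<^sup>2 / (real (Suc (m - k)) * (fact (m - k))\<^sup>2)) powr (a / 2)"
proof -
  define N where "N = real n - 2"
  define M F :: real where "M = fact (m - 1)" and "F = fact (m - k)"
  define j where "j = real m - real k + 1"
  have pos: "0 < N" "0 < real n" "0 < real m" "0 < M" "0 < F" "0 < j"
    using assms by (auto simp: N_def M_def F_def j_def)
  have G: "Gamma (real m - real k + 1) = F" "Gamma (real m) = M"
    using assms Gamma_diff_fact Gamma_pred_fact by (auto simp: M_def F_def)
  have G': "Gamma j = F" using G by (simp add: j_def)
  have j: "real (Suc (m - k)) = j" using assms by (simp add: j_def of_nat_diff)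
  have "ln (j powr (- 1 / N) * (real m powr (1 / 2) * M / F) powr (2 / N))
      = ln ((real m * M\<^sup>2 / (j * F\<^sup>2)) powr (1 / N))"
    using pos by (simp add: ln_mult ln_div ln_powr ln_realpow field_simps)
  then have "j powr (- 1 / N) * (real m powr (1 / 2) * M / F) powr (2 / N)
      = (real m * M\<^sup>2 / (j * F\<^sup>2)) powr (1 / N)"
    using pos by (subst (asm) ln_inj_iff) auto
  then show ?thesis
    unfolding coeff_z_def j j_def[symmetric] G' G(2) a N_def[symmetric] M_def[symmetric] F_def[symmetric] by simp
qed

lemma coeff_d_eq:
  assumes "3 \<le> n" "1 \<le> k" "k < m" and a: "a = 2 / (real n - 2)"
  shows "coeff_d n k m = (real m * (fact (m - 1))\<^sup>2
     / (fact (m - k - 1) * fact (m - k) powr (1 + 2 * a)) powr (1 / (1 + a))) powr (a / 2)"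
proof -
  define N where "N = real n - 2"
  define M F :: real where "M = fact (m - 1)" and "F = fact (m - k)"
  define j where "j = real m - real k"
  have pos: "0 < N" "0 < real n" "0 < real m" "0 < M" "0 < F" "0 < j"
    using assms by (auto simp: N_def M_def F_def j_def)
  have G: "Gamma (real m - real k + 1) = F" "Gamma (real m) = M"
    using assms Gamma_diff_fact Gamma_pred_fact by (auto simp: M_def F_def)
  have "F = j * fact (m - k - 1)"
    using assms fact_reduce[of "m - k", where 'a = real] by (simp add: F_def j_def of_nat_diff)
  then have F': "fact (m - k - 1) = F / j" using pos by (simp add: field_simps)
  have nN: "real n = N + 2" by (simp add: N_def)
  have e: "1 / (1 + 2 / N) = N / (N + 2)" "1 + 2 * (2 / N) = (N + 4) / N" "2 / N / 2 = 1 / N" using pos by (simp_all add: field_simps)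
  have "ln (j powr (1 / (N + 2)) * (real m powr (1 / 2) * M / F) powr (2 / N))
      = ln ((real m * M\<^sup>2 / (F / j * F powr ((N + 4) / N)) powr (N / (N + 2))) powr (1 / N))"
  proof -
    have 1: "ln ((F / j * F powr ((N + 4) / N)) powr (N / (N + 2))) = 2 * ln F - N / (N + 2) * ln j"
    proof -
      have "ln ((F / j * F powr ((N + 4) / N)) powr (N / (N + 2)))
          = N / (N + 2) * (ln F - ln j + (N + 4) / N * ln F)"
        using pos by (simp add: ln_mult ln_div ln_powr)
      also have "\<dots> = N / (N + 2) * ((2 * (N + 2) / N) * ln F - ln j)"
        using pos by (simp add: field_simps)
      also have "\<dots> = (N / (N + 2) * (2 * (N + 2) / N)) * ln F - N / (N + 2) * ln j"
        by (simp only: right_diff_distrib mult.assoc)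
      also have "N / (N + 2) * (2 * (N + 2) / N) = 2"
      proof -
        have "N + 2 \<noteq> 0" using pos by simp
        then show ?thesis using pos by (simp add: divide_simps)
      qed
      finally show ?thesis .
    qed
    define X where "X = (F / j * F powr ((N + 4) / N)) powr (N / (N + 2))"
    have "0 < X" using pos by (simp add: X_def)
    then have "ln ((real m * M\<^sup>2 / X) powr (1 / N)) = 1 / N * (ln (real m) + 2 * ln M - ln X)"
      using pos by (simp add: ln_div ln_mult ln_realpow ln_powr)
    then have "ln ((real m * M\<^sup>2 / (F / j * F powr ((N + 4) / N)) powr (N / (N + 2))) powr (1 / N))
        = 1 / N * (ln (real m) + 2 * ln M - (2 * ln F - N / (N + 2) * ln j))"
      by (simp only: X_def 1)
    also have "\<dots> = 1 / (N + 2) * ln j + 2 / N * (1 / 2 * ln (real m) + ln M - ln F)"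
    proof -
      have alg: "1 / N * (A + 2 * B - (2 * C - N * E)) = E + 2 / N * (1 / 2 * A + B - C)" for A B C E :: real
        using pos by (simp add: field_simps)
      have eq: "N / (N + 2) * ln j = N * (1 / (N + 2) * ln j)" by simp
      show ?thesis unfolding eq by (rule alg)
    qed
    also have "\<dots> = ln (j powr (1 / (N + 2)) * (real m powr (1 / 2) * M / F) powr (2 / N))"
      using pos by (simp add: ln_mult ln_div ln_powr)
    finally show ?thesis ..
  qed
  then have "j powr (1 / (N + 2)) * (real m powr (1 / 2) * M / F) powr (2 / N)
      = (real m * M\<^sup>2 / (F / j * F powr ((N + 4) / N)) powr (N / (N + 2))) powr (1 / N)"
    using pos by (subst (asm) ln_inj_iff) auto
  then show ?thesis
    by (simp only: coeff_d_def F' G a N_def[symmetric] M_def[symmetric] F_def[symmetric],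
        simp only: j_def[symmetric] e, simp only: nN)
qed

lemma coeff_Z_eq:
  assumes "3 \<le> n" "1 \<le> k" "k \<le> m" and a: "a = 2 / (real n - 2)"
  shows "coeff_Z n k m =
    ((real n * (real n - 2)) powr (1 / a) / (real m * (fact (m - 1))\<^sup>2)) powr (1 / 2) * (2 / a)
     * (real m * (fact (m - 1))\<^sup>2) * (1 / fact (m - k))
     / ((real m * (fact (m - 1))\<^sup>2 / (real (Suc (m - k)) * (fact (m - k))\<^sup>2)) powr (a / 2)) powr (real n - 1)"
proof -
  define N where "N = real n - 2"
  define M F :: real where "M = fact (m - 1)" and "F = fact (m - k)"
  define j where "j = real m - real k + 1"
  have pos: "0 < N" "0 < real n" "0 < real m" "0 < M" "0 < F" "0 < j"
    using assms by (auto simp: N_def M_def F_def j_def)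
  have G: "Gamma j = F" "Gamma (real m) = M"
    using assms Gamma_diff_fact Gamma_pred_fact by (auto simp: M_def F_def j_def)
  have j: "real (Suc (m - k)) = j" using assms by (simp add: j_def of_nat_diff)
  have n1: "real n - 1 = N + 1" "real n + 2 = N + 4" by (simp_all add: N_def)
  have "ln (real n powr (N / 4) * N powr ((N + 4) / 4) * j powr ((N + 1) / N)
        * (F / (real m powr (1 / 2) * M)) powr (real n / N))
      = N / 4 * ln (real n) + (N + 4) / 4 * ln N + (N + 1) / N * ln j
        + (N + 2) / N * (ln F - 1 / 2 * ln (real m) - ln M)"
    using pos by (simp add: ln_mult ln_div ln_powr) (simp add: N_def algebra_simps)
  also have "\<dots> = 1 / 2 * (N / 2 * (ln (real n) + ln N) - ln (real m) - 2 * ln M) + ln N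
        + (ln (real m) + 2 * ln M) - ln F - (N + 1) * (1 / N * (ln (real m) + 2 * ln M - ln j - 2 * ln F))"
    using pos by (simp add: field_simps)
  also have "\<dots> = ln (((real n * N) powr (N / 2) / (real m * M\<^sup>2)) powr (1 / 2) * N
     * (real m * M\<^sup>2) * (1 / F) / ((real m * M\<^sup>2 / (j * F\<^sup>2)) powr (1 / N)) powr (N + 1))"
    using pos by (simp add: ln_mult ln_div ln_powr ln_realpow) (simp add: algebra_simps)
  finally have "real n powr (N / 4) * N powr ((N + 4) / 4) * j powr ((N + 1) / N)
        * (F / (real m powr (1 / 2) * M)) powr (real n / N)
      = ((real n * N) powr (N / 2) / (real m * M\<^sup>2)) powr (1 / 2) * N
     * (real m * M\<^sup>2) * (1 / F) / ((real m * M\<^sup>2 / (j * F\<^sup>2)) powr (1 / N)) powr (N + 1)"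
    using pos by (subst (asm) ln_inj_iff) auto
  then show ?thesis
    unfolding coeff_Z_def j j_def[symmetric] G a N_def[symmetric] M_def[symmetric] F_def[symmetric] n1 by simp
qed

section \<open>Rates of the zeros, critical points, values and slopes\<close>

locale nodal_data_family =
  fixes n m :: nat and a K :: real and u :: "real \<Rightarrow> 'a::euclidean_space \<Rightarrow> real"
    and \<alpha> b :: "real \<Rightarrow> real" and y w :: "real \<Rightarrow> real \<Rightarrow> real" and T \<tau> :: "real \<Rightarrow> nat \<Rightarrow> real"
  assumes n: "3 \<le> n" and m: "1 \<le> m" and a_eq: "a = 2 / (real n - 2)" and K_eq: "K = kappa n"
    and nodal_data: "\<And>e. 0 < e \<Longrightarrow> e < 2 * a \<Longrightarrow>
      nodal_data n m a e (u e) (\<alpha> e) (b e) (y e) (w e) (T e) (\<tau> e)"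
begin

lemma a_pos: "0 < a" using n by (simp add: a_eq)

lemma K_pos: "0 < K" using kappa_pos[OF n] by (simp add: K_eq)

lemma K_action: "K = bubble_action a 1" using bubble_action_eq_kappa[OF n a_eq] K_eq by simp

lemma data: "\<forall>\<^sub>F e in at_right 0. nodal_data n m a e (u e) (\<alpha> e) (b e) (y e) (w e) (T e) (\<tau> e)"
proof -
  have "0 < 2 * a" using a_pos by simp
  from eventually_at_right_real[OF this] show ?thesis by eventually_elim (auto intro: nodal_data)
qed

lemma limits:
  assumes "j < m"
  shows "((\<lambda>e. height (y e) (\<tau> e) j / (K * e) ^ j) \<longlongrightarrow> fact j) (at_right 0)"
    "((\<lambda>e. height (y e) (\<tau> e) j * \<bar>w e (T e (Suc j))\<bar>) \<longlongrightarrow> 1) (at_right 0)"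
    "((\<lambda>e. T e (Suc j) * (w e (T e (Suc j)))\<^sup>2 / e) \<longlongrightarrow> real (Suc j) * K) (at_right 0)"
    "1 \<le> j \<Longrightarrow> ((\<lambda>e. \<bar>w e (T e j)\<bar> * \<tau> e j powr (1 + a)
          * height (y e) (\<tau> e) j powr (- 1 - 2 * a)) \<longlongrightarrow> 1) (at_right 0)"
proof -
  have nodal: "\<forall>\<^sub>F e in at_right 0. nodal_solution a e m (y e) (w e) (T e) (\<tau> e)"
    using data by eventually_elim (simp add: nodal_data_def)
  have K0: "0 < bubble_action a 1" using K_pos by (simp add: K_action)
  note L = nodal_limits[OF a_pos K0 m nodal assms, folded K_action]
  show "((\<lambda>e. height (y e) (\<tau> e) j / (K * e) ^ j) \<longlongrightarrow> fact j) (at_right 0)"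
    "((\<lambda>e. height (y e) (\<tau> e) j * \<bar>w e (T e (Suc j))\<bar>) \<longlongrightarrow> 1) (at_right 0)"
    "((\<lambda>e. T e (Suc j) * (w e (T e (Suc j)))\<^sup>2 / e) \<longlongrightarrow> real (Suc j) * K) (at_right 0)"
    "1 \<le> j \<Longrightarrow> ((\<lambda>e. \<bar>w e (T e j)\<bar> * \<tau> e j powr (1 + a)
          * height (y e) (\<tau> e) j powr (- 1 - 2 * a)) \<longlongrightarrow> 1) (at_right 0)"
    using L by blast+
qed

lemma rate_height:
  assumes "j < m" shows "power_rate K (\<lambda>e. height (y e) (\<tau> e) j) (real j) (fact j)"
proof -
  have "\<forall>\<^sub>F e in at_right 0. height (y e) (\<tau> e) j / (K * e) ^ j
      = height (y e) (\<tau> e) j * (K * e) powr - real j"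
    using eventually_at_right_less[of 0]
    by eventually_elim (use K_pos in \<open>simp add: powr_minus powr_realpow divide_inverse\<close>)
  then show ?thesis using limits(1)[OF assms] unfolding power_rate_def
    by (auto intro: Lim_transform_eventually)
qed

lemma rate_slope:
  assumes "j < m" shows "power_rate K (\<lambda>e. \<bar>w e (T e (Suc j))\<bar>) (- real j) (1 / fact j)"
proof -
  have R: "power_rate K (\<lambda>e. height (y e) (\<tau> e) j * \<bar>w e (T e (Suc j))\<bar> / height (y e) (\<tau> e) j)
      (0 - real j) (1 / fact j)"
    by (intro power_rate_divide K_pos power_rate_0 limits(2) rate_height assms zero_less_one)
  have ev: "\<forall>\<^sub>F e in at_right 0. height (y e) (\<tau> e) j * \<bar>w e (T e (Suc j))\<bar> / height (y e) (\<tau> e) j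
      = \<bar>w e (T e (Suc j))\<bar>"
    using power_rate_pos[OF K_pos rate_height[OF assms]] by eventually_elim simp
  from power_rate_cong[OF R ev] show ?thesis by simp
qed

text \<open>From the limits of \<open>T w\<^sup>2 / e\<close> and of \<open>w\<close>.\<close>
lemma rate_T:
  assumes "j < m" shows "power_rate K (\<lambda>e. T e (Suc j)) (2 * real j + 1) (real (Suc j) * (fact j)\<^sup>2)"
proof -
  have jK: "0 < real (Suc j) * K" using K_pos by simp
  have R: "power_rate K (\<lambda>e. (T e (Suc j) * (w e (T e (Suc j)))\<^sup>2 / e) * e * \<bar>w e (T e (Suc j))\<bar> powr - 2)
      (0 + 1 + - real j * - 2) (real (Suc j) * K * (1 / K) * (1 / fact j) powr - 2)"
    by (intro power_rate_mult power_rate_powr power_rate_ident power_rate_0 limits(3) rate_slope assms K_pos jK)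
  have p: "0 + 1 + - real j * - 2 = 2 * real j + 1" by simp
  have c: "real (Suc j) * K * (1 / K) * (1 / fact j) powr - 2 = real (Suc j) * (fact j)\<^sup>2"
    using K_pos by (simp add: powr_minus_divide power_divide)
  have ev: "\<forall>\<^sub>F e in at_right 0. (T e (Suc j) * (w e (T e (Suc j)))\<^sup>2 / e) * e * \<bar>w e (T e (Suc j))\<bar> powr - 2
      = T e (Suc j)"
    using power_rate_pos[OF K_pos rate_slope[OF assms]] eventually_at_right_less[of 0]
    by eventually_elim (simp add: powr_minus_divide)
  from power_rate_cong[OF R ev] show ?thesis by (simp only: p c)
qed

text \<open>The last limit in \<open>nodal_limits\<close>, solved for \<open>\<tau>\<close>.\<close>
lemma rate_\<tau>:
  assumes "1 \<le> j" "j < m"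
  shows "power_rate K (\<lambda>e. \<tau> e j) ((2 * real j + 2 * a * real j - 1) / (1 + a))
    ((fact (j - 1) * fact j powr (1 + 2 * a)) powr (1 / (1 + a)))"
proof -
  have j: "j - 1 < m" "Suc (j - 1) = j" "real (j - 1) = real j - 1" using assms by auto
  let ?X = "\<lambda>e. \<bar>w e (T e j)\<bar> * \<tau> e j powr (1 + a) * height (y e) (\<tau> e) j powr (- 1 - 2 * a)"
  note rs = rate_slope[OF j(1), unfolded j(2)]
  have R: "power_rate K (\<lambda>e. (?X e * height (y e) (\<tau> e) j powr (1 + 2 * a) / \<bar>w e (T e j)\<bar>) powr (1 / (1 + a)))
     ((0 + real j * (1 + 2 * a) - (- real (j - 1))) * (1 / (1 + a)))
     ((1 * fact j powr (1 + 2 * a) / (1 / fact (j - 1))) powr (1 / (1 + a)))"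
    by (intro power_rate_powr power_rate_divide power_rate_mult K_pos power_rate_0 zero_less_one
        limits(4) rate_height rs assms)
  have "0 + real j * (1 + 2 * a) - (- real (j - 1)) = 2 * real j + 2 * a * real j - 1"
    unfolding j(3) by (simp add: algebra_simps)
  then have p: "(0 + real j * (1 + 2 * a) - (- real (j - 1))) * (1 / (1 + a))
      = (2 * real j + 2 * a * real j - 1) / (1 + a)"
    by simp
  have c: "1 * fact j powr (1 + 2 * a) / (1 / fact (j - 1)) = (fact (j - 1) :: real) * fact j powr (1 + 2 * a)"
    by simp
  have ev: "\<forall>\<^sub>F e in at_right 0.
      (?X e * height (y e) (\<tau> e) j powr (1 + 2 * a) / \<bar>w e (T e j)\<bar>) powr (1 / (1 + a)) = \<tau> e j"
    using power_rate_pos[OF K_pos rs] power_rate_pos[OF K_pos rate_height[OF assms(2)]] data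
  proof eventually_elim
    case (elim e)
    have "j \<in> {1..<m}" using assms by simp
    then have "0 < b e" "b e \<le> \<tau> e j" using elim(3) unfolding nodal_data_def by blast+
    then have "0 < \<tau> e j" by simp
    have "height (y e) (\<tau> e) j powr (- 1 - 2 * a) * height (y e) (\<tau> e) j powr (1 + 2 * a) = 1"
      using elim powr_add[of "height (y e) (\<tau> e) j" "- 1 - 2 * a" "1 + 2 * a"] by simp
    then have "?X e * height (y e) (\<tau> e) j powr (1 + 2 * a) / \<bar>w e (T e j)\<bar> = \<tau> e j powr (1 + a)"
      using elim by (simp add: mult.assoc)
    then show ?case using \<open>0 < \<tau> e j\<close> a_pos by (simp only:) (simp add: powr_powr)
  qed
  from power_rate_cong[OF R ev] show ?thesis by (simp only: p c)
qed

lemma rate_b: "power_rate K b (2 * real m - 1) (real m * (fact (m - 1))\<^sup>2)"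
proof -
  have "power_rate K (\<lambda>e. T e (Suc (m - 1))) (2 * real (m - 1) + 1) (real (Suc (m - 1)) * (fact (m - 1))\<^sup>2)"
    using m by (intro rate_T) auto
  moreover have "\<forall>\<^sub>F e in at_right 0. T e (Suc (m - 1)) = b e"
    using data by eventually_elim (use m in \<open>simp add: nodal_data_def\<close>)
  ultimately have "power_rate K b (2 * real (m - 1) + 1) (real (Suc (m - 1)) * (fact (m - 1))\<^sup>2)"
    by (rule power_rate_cong)
  moreover have "2 * real (m - 1) + 1 = 2 * real m - 1" "Suc (m - 1) = m" using m by auto
  ultimately show ?thesis by (simp only:)
qed

text \<open>The definition of \<open>b\<close> in terms of \<open>\<alpha>\<close> reads \<open>\<alpha>\<^sup>2 b = l \<alpha>\<^bsup>e/a\<^esup>\<close> with \<open>l\<^bsup>a\<^esup> = n (n - 2)\<close>. As \<open>b\<close> behaves like a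
  power of \<open>e\<close>, the last factor tends to \<open>1\<close>, which determines \<open>\<alpha>\<close> from \<open>b\<close>.\<close>
lemma rate_\<alpha>: "power_rate K \<alpha> (- (2 * real m - 1) / 2)
   (((real n * (real n - 2)) powr (1 / a) / (real m * (fact (m - 1))\<^sup>2)) powr (1 / 2))"
proof -
  define l where "l = (real n * (real n - 2)) powr (1 / a)"
  have l: "0 < l" using n by (simp add: l_def)
  have b_lim: "((\<lambda>e. e * ln (b e)) \<longlongrightarrow> 0) (at_right 0)"
  proof (rule eps_ln_lim[OF K_pos])
    show "0 < real m * (fact (m - 1))\<^sup>2" using m by simp
    have "\<forall>\<^sub>F e in at_right 0. b e * (K * e) powr - (2 * real m - 1) = b e / (K * e) ^ (2 * m - 1)"
      using eventually_at_right_less[of 0]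
    proof eventually_elim
      case (elim e)
      have "2 * real m - 1 = real (2 * m - 1)" using m by (simp add: of_nat_diff)
      then have "(K * e) powr (2 * real m - 1) = (K * e) ^ (2 * m - 1)"
        using elim K_pos by (simp only: powr_realpow mult_pos_pos)
      then show ?case unfolding powr_minus_divide by simp
    qed
    then show "((\<lambda>e. b e / (K * e) ^ (2 * m - 1)) \<longlongrightarrow> real m * (fact (m - 1))\<^sup>2) (at_right 0)"
      using rate_b unfolding power_rate_def by (auto intro: Lim_transform_eventually)
  qed
  have \<alpha>_pos: "\<forall>\<^sub>F e in at_right 0. 0 < \<alpha> e" using data by eventually_elim (simp add: nodal_data_def)
  have \<alpha>_lim: "((\<lambda>e. e * ln (\<alpha> e)) \<longlongrightarrow> 0) (at_right 0)"
  proof (rule Lim_transform_eventually)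
    have "((\<lambda>e. a / (2 * a - e) * (e * ln l - e * ln (b e))) \<longlongrightarrow> a / (2 * a - 0) * (0 * ln l - 0)) (at_right 0)"
      using a_pos by (intro tendsto_intros b_lim) auto
    then show "((\<lambda>e. a / (2 * a - e) * (e * ln l - e * ln (b e))) \<longlongrightarrow> 0) (at_right 0)" by simp
    have "0 < 2 * a" using a_pos by simp
    from eventually_at_right_real[OF this] data
    show "\<forall>\<^sub>F e in at_right 0. a / (2 * a - e) * (e * ln l - e * ln (b e)) = e * ln (\<alpha> e)"
    proof eventually_elim
      case (elim e)
      then have "b e = l * \<alpha> e powr (- ((2 * a - e) / a))" "0 < \<alpha> e" by (auto simp: nodal_data_def l_def)
      then have lb: "ln (b e) = ln l - (2 * a - e) / a * ln (\<alpha> e)"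
        using l by (simp add: ln_mult ln_powr)
      have q: "2 * a - e \<noteq> 0" using elim by auto
      have "e * ln l - e * ln (b e) = (2 * a - e) / a * (e * ln (\<alpha> e))"
        unfolding lb by (simp add: right_diff_distrib)
      then show ?case using q a_pos by simp
    qed
  qed
  have "((\<lambda>e. l * \<alpha> e powr (1 / a * e)) \<longlongrightarrow> l * 1) (at_right 0)"
    by (intro tendsto_mult tendsto_const powr_small_exponent_lim \<alpha>_pos \<alpha>_lim)
  then have "power_rate K (\<lambda>e. (l * \<alpha> e powr (1 / a * e) / b e) powr (1 / 2)) ((0 - (2 * real m - 1)) * (1 / 2))
      ((l / (real m * (fact (m - 1))\<^sup>2)) powr (1 / 2))"
    using l by (intro power_rate_powr power_rate_divide K_pos power_rate_0 rate_b) auto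
  moreover have "\<forall>\<^sub>F e in at_right 0. (l * \<alpha> e powr (1 / a * e) / b e) powr (1 / 2) = \<alpha> e"
    using data
  proof eventually_elim
    case (elim e)
    then have b: "b e = l * \<alpha> e powr (- ((2 * a - e) / a))" and \<alpha>: "0 < \<alpha> e" by (auto simp: nodal_data_def l_def)
    have "1 / a * e - - ((2 * a - e) / a) = 2" using a_pos by (simp add: field_simps)
    then have "\<alpha> e powr (1 / a * e) / \<alpha> e powr (- ((2 * a - e) / a)) = (\<alpha> e)\<^sup>2"
      using \<alpha> by (simp only: powr_diff[symmetric]) simp
    then have "l * \<alpha> e powr (1 / a * e) / b e = (\<alpha> e)\<^sup>2" unfolding b using l by simp
    then show ?case using \<alpha> by (simp add: powr_half_sqrt)
  qed
  ultimately have "power_rate K \<alpha> ((0 - (2 * real m - 1)) * (1 / 2)) ((l / (real m * (fact (m - 1))\<^sup>2)) powr (1 / 2))"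
    by (rule power_rate_cong)
  then show ?thesis by (simp add: l_def)
qed

lemma rate_value:
  assumes k: "k \<in> {1..m}"
  shows "power_rate K (\<lambda>e. \<bar>profile (u e) (crit_pt (u e) k)\<bar>) (- (2 * real k - 1) / 2) (coeff_D n k m)"
proof -
  have k': "1 \<le> k" "k \<le> m" "m - k < m" using k by auto
  have R: "power_rate K (\<lambda>e. \<alpha> e * height (y e) (\<tau> e) (m - k)) (- (2 * real m - 1) / 2 + real (m - k))
      (coeff_D n k m)"
    unfolding coeff_D_eq[OF n k'(1,2) a_eq] by (intro power_rate_mult rate_\<alpha> rate_height k')
  have p: "- (2 * real m - 1) / 2 + real (m - k) = - (2 * real k - 1) / 2"
    using k by (simp add: of_nat_diff field_simps)
  have ev: "\<forall>\<^sub>F e in at_right 0. \<alpha> e * height (y e) (\<tau> e) (m - k) = \<bar>profile (u e) (crit_pt (u e) k)\<bar>"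
    using data
  proof eventually_elim
    case (elim e)
    then have "\<bar>profile (u e) (crit_pt (u e) k)\<bar> = \<alpha> e * height (y e) (\<tau> e) (m - k)"
      using k unfolding nodal_data_def by blast
    then show ?case by simp
  qed
  from power_rate_cong[OF R ev] show ?thesis by (simp only: p)
qed

lemma rate_zero:
  assumes k: "k \<in> {1..m}"
  shows "power_rate K (\<lambda>e. zero_pt (u e) k) ((real k - 1) * a) (coeff_z n k m)"
proof -
  have k': "1 \<le> k" "k \<le> m" "m - k < m" "m + 1 - k = Suc (m - k)" using k by auto
  have R: "power_rate K (\<lambda>e. (b e / T e (Suc (m - k))) powr (a / 2))
     (((2 * real m - 1) - (2 * real (m - k) + 1)) * (a / 2)) (coeff_z n k m)"
    unfolding coeff_z_eq[OF n k'(1,2) a_eq]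
    by (intro power_rate_powr power_rate_divide K_pos rate_b rate_T k')
  have p: "((2 * real m - 1) - (2 * real (m - k) + 1)) * (a / 2) = (real k - 1) * a"
    using k by (simp add: of_nat_diff field_simps)
  have ev: "\<forall>\<^sub>F e in at_right 0. (b e / T e (Suc (m - k))) powr (a / 2) = zero_pt (u e) k"
    using data
  proof eventually_elim
    case (elim e)
    then have "zero_pt (u e) k = (b e / T e (m + 1 - k)) powr (a / 2)"
      using k unfolding nodal_data_def by blast
    then show ?case unfolding k'(4) by (rule sym)
  qed
  from power_rate_cong[OF R ev] show ?thesis by (simp only: p)
qed

lemma rate_crit:
  assumes k: "k \<in> {1..m-1}"
  shows "power_rate K (\<lambda>e. crit_pt (u e) k) (2 * (real k * real n - 1) / (real n * (real n - 2))) (coeff_d n k m)"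
proof -
  have k': "1 \<le> k" "k < m" "1 \<le> m - k" "m - k < m" using k by auto
  let ?p = "(2 * real (m - k) + 2 * a * real (m - k) - 1) / (1 + a)"
  have R: "power_rate K (\<lambda>e. (b e / \<tau> e (m - k)) powr (a / 2)) (((2 * real m - 1) - ?p) * (a / 2)) (coeff_d n k m)"
    unfolding coeff_d_eq[OF n k'(1,2) a_eq]
    by (intro power_rate_powr power_rate_divide K_pos rate_b rate_\<tau> k')
  have p: "((2 * real m - 1) - ?p) * (a / 2) = 2 * (real k * real n - 1) / (real n * (real n - 2))"
  proof -
    define N where "N = real n - 2"
    define x where "x = real (m - k)"
    have N: "0 < N" "real n = N + 2" "a = 2 / N" using n by (auto simp: N_def a_eq)
    have mk: "x = real m - real k" using k' by (simp add: x_def of_nat_diff)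
    have "2 * x + 2 * (2 / N) * x - 1 = (2 * x * (N + 2) - N) / N" "1 + 2 / N = (N + 2) / N"
      using N(1) by (simp_all add: field_simps)
    then have "(2 * x + 2 * a * x - 1) / (1 + a) = (2 * x * (N + 2) - N) / (N + 2)"
      unfolding N(3) using N(1) by simp
    also have "\<dots> = 2 * x - N / (N + 2)" using N(1) by (simp add: diff_divide_distrib)
    finally have "((2 * real m - 1) - ?p) * (a / 2) = (2 * real k - 1 + N / (N + 2)) * (1 / N)"
      unfolding x_def[symmetric] by (simp add: mk N(3))
    also have "\<dots> = 2 * (real k * (N + 2) - 1) / ((N + 2) * N)" using N(1) by (simp add: field_simps)
    also have "\<dots> = 2 * (real k * real n - 1) / (real n * (real n - 2))"
      by (simp only: N_def[symmetric]) (simp only: N(2))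
    finally show ?thesis .
  qed
  have ev: "\<forall>\<^sub>F e in at_right 0. (b e / \<tau> e (m - k)) powr (a / 2) = crit_pt (u e) k"
    using data
  proof eventually_elim
    case (elim e)
    then have "crit_pt (u e) k = (b e / \<tau> e (m - k)) powr (a / 2)"
      using k unfolding nodal_data_def by blast
    then show ?case by (rule sym)
  qed
  from power_rate_cong[OF R ev] show ?thesis by (simp only: p)
qed

lemma rate_deriv:
  assumes k: "k \<in> {1..m}"
  shows "power_rate K (\<lambda>e. \<bar>profile_deriv (u e) (zero_pt (u e) k)\<bar>)
     (- (2 * real k * real n - 3 * real n + 2) / (2 * (real n - 2))) (coeff_Z n k m)"
proof -
  have k': "1 \<le> k" "k \<le> m" "m - k < m" using k by auto
  have a2: "0 < 2 / a" using a_pos by simp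
  let ?p = "- (2 * real m - 1) / 2 + 0 + (2 * real m - 1) + - real (m - k) - (real k - 1) * a * (real n - 1)"
  have R: "power_rate K (\<lambda>e. \<alpha> e * (2 / a) * b e * \<bar>w e (T e (Suc (m - k)))\<bar> / zero_pt (u e) k powr (real n - 1))
     ?p (coeff_Z n k m)"
    unfolding coeff_Z_eq[OF n k'(1,2) a_eq] coeff_z_eq[OF n k'(1,2) a_eq, symmetric]
    by (intro power_rate_divide power_rate_mult power_rate_powr K_pos rate_\<alpha> rate_b rate_slope k'
        rate_zero[OF k] power_rate_const a2)
  have p: "?p = - (2 * real k * real n - 3 * real n + 2) / (2 * (real n - 2))"
  proof -
    define N where "N = real n - 2"
    have N: "0 < N" "real n = N + 2" "a = 2 / N" using n by (auto simp: N_def a_eq)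
    have mk: "real (m - k) = real m - real k" using k' by (simp add: of_nat_diff)
    have "- (2 * real m - 1) / 2 + 0 + (2 * real m - 1) + - (real m - real k) - (real k - 1) * (2 / N) * (N + 1)
        = - (2 * real k * (N + 2) - 3 * (N + 2) + 2) / (2 * N)"
      using N(1) by (simp add: field_simps)
    moreover have "real n - 1 = N + 1" "real n - 2 = N" by (simp_all add: N_def)
    ultimately show ?thesis by (simp only: mk N(3) N(2)[symmetric])
  qed
  have ev: "\<forall>\<^sub>F e in at_right 0.
      \<alpha> e * (2 / a) * b e * \<bar>w e (T e (Suc (m - k)))\<bar> / zero_pt (u e) k powr (real n - 1)
      = \<bar>profile_deriv (u e) (zero_pt (u e) k)\<bar>"
    using data power_rate_pos[OF K_pos rate_zero[OF k]]
  proof eventually_elim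
    case (elim e)
    have "real n - 1 = real (n - 1)" using n by (simp add: of_nat_diff)
    then have "zero_pt (u e) k powr (real n - 1) = zero_pt (u e) k ^ (n - 1)"
      using elim(2) by (simp only: powr_realpow)
    moreover have "m + 1 - k = Suc (m - k)" using k' by simp
    moreover have "\<bar>profile_deriv (u e) (zero_pt (u e) k)\<bar>
         = \<alpha> e * (2 / a) * b e * \<bar>w e (T e (m + 1 - k))\<bar> / zero_pt (u e) k ^ (n - 1)"
      using elim(1) k unfolding nodal_data_def by blast
    ultimately show ?case by simp
  qed
  from power_rate_cong[OF R ev] show ?thesis by (simp only: p)
qed

end

theorem theorem1p1:
  fixes n m :: nat and u :: "real \<Rightarrow> real ^ 'n \<Rightarrow> real"
  assumes "n = CARD('n)" and "n \<ge> 3" and "m \<ge> 1"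
    and "\<And>\<epsilon>. 0 < \<epsilon> \<Longrightarrow> \<epsilon> < 4 / (real n - 2) \<Longrightarrow>
           radial (u \<epsilon>) \<and> dirichlet_solution (4 / (real n - 2) - \<epsilon>) (u \<epsilon>) \<and>
           has_interior_zeros (u \<epsilon>) (m - 1)"
  shows
    "(\<forall>\<epsilon>. 0 < \<epsilon> \<and> \<epsilon> < 4 / (real n - 2) \<longrightarrow>
        finite (crit_points (u \<epsilon>)) \<and> card (crit_points (u \<epsilon>)) = m \<and>
        finite (zeros (u \<epsilon>)) \<and> card (zeros (u \<epsilon>)) = m \<and>
        crit_pt (u \<epsilon>) m = 0 \<and>
        (\<forall>k\<in>{1..m}. crit_pt (u \<epsilon>) k < zero_pt (u \<epsilon>) k) \<and>
        (\<forall>k\<in>{1..m-1}. zero_pt (u \<epsilon>) (k + 1) < crit_pt (u \<epsilon>) k) \<and>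
        zero_pt (u \<epsilon>) 1 = 1) \<and>
     (\<forall>k\<in>{1..m}.
        ((\<lambda>\<epsilon>. \<bar>profile (u \<epsilon>) (crit_pt (u \<epsilon>) k)\<bar> *
              (kappa n * \<epsilon>) powr ((2 * real k - 1) / 2))
          \<longlongrightarrow> coeff_D n k m) (at_right 0)) \<and>
     (\<forall>k\<in>{1..m-1}.
        ((\<lambda>\<epsilon>. crit_pt (u \<epsilon>) k *
              (kappa n * \<epsilon>) powr (- (2 * (real k * real n - 1) / (real n * (real n - 2)))))
          \<longlongrightarrow> coeff_d n k m) (at_right 0)) \<and>
     (\<forall>k\<in>{1..m}.
        ((\<lambda>\<epsilon>. \<bar>profile_deriv (u \<epsilon>) (zero_pt (u \<epsilon>) k)\<bar> *
              (kappa n * \<epsilon>) powr ((2 * real k * real n - 3 * real n + 2) / (2 * (real n - 2))))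
          \<longlongrightarrow> coeff_Z n k m) (at_right 0)) \<and>
     (\<forall>k\<in>{2..m}.
        ((\<lambda>\<epsilon>. zero_pt (u \<epsilon>) k *
              (kappa n * \<epsilon>) powr (- (2 * (real k - 1) / (real n - 2))))
          \<longlongrightarrow> coeff_z n k m) (at_right 0)) \<and>
     (\<forall>k\<in>{1..m}.
        same_rate (\<lambda>\<epsilon>. profile (u \<epsilon>) (crit_pt (u \<epsilon>) k))
                  (\<lambda>\<epsilon>. \<epsilon> powr (- 1/2 - (real k - 1)))) \<and>
     (\<forall>k\<in>{1..m-1}.
        same_rate (\<lambda>\<epsilon>. crit_pt (u \<epsilon>) k)
                  (\<lambda>\<epsilon>. \<epsilon> powr (2 * (real n - 1) / (real n * (real n - 2)) +
                               2 / (real n - 2) * (real k - 1)))) \<and>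
     (\<forall>k\<in>{1..m}.
        same_rate (\<lambda>\<epsilon>. profile_deriv (u \<epsilon>) (zero_pt (u \<epsilon>) k))
                  (\<lambda>\<epsilon>. \<epsilon> powr (1/2 - real n / (real n - 2) * (real k - 1)))) \<and>
     (\<forall>k\<in>{2..m}.
        same_rate (\<lambda>\<epsilon>. zero_pt (u \<epsilon>) k)
                  (\<lambda>\<epsilon>. \<epsilon> powr (2 / (real n - 2) * (real k - 1))))"
proof -
  define a where "a = 2 / (real n - 2)"
  have a2: "4 / (real n - 2) = 2 * a" by (simp add: a_def)
  have "\<exists>\<alpha> b y w T \<tau>. nodal_data n m a \<epsilon> (u \<epsilon>) \<alpha> b y w T \<tau>" if "0 < \<epsilon>" "\<epsilon> < 2 * a" for \<epsilon>
  proof -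
    interpret radial_solution "u \<epsilon>" n m \<epsilon> a
      using assms(4)[of \<epsilon>] that assms(1-3) unfolding a2 by unfold_locales (auto simp: a_def)
    show ?thesis using nodal_data_exists by blast
  qed
  then obtain \<alpha> b y w T \<tau> where D: "\<And>\<epsilon>. 0 < \<epsilon> \<Longrightarrow> \<epsilon> < 2 * a \<Longrightarrow>
      nodal_data n m a \<epsilon> (u \<epsilon>) (\<alpha> \<epsilon>) (b \<epsilon>) (y \<epsilon>) (w \<epsilon>) (T \<epsilon>) (\<tau> \<epsilon>)"
    by metis
  interpret nodal_data_family n m a "kappa n" u \<alpha> b y w T \<tau>
    using assms(2,3) D by unfold_locales (auto simp: a_def)
  have n2: "0 < real n - 2" "0 < real n" using assms(2) by auto
  have eD: "- 1 / 2 - (real k - 1) = - (2 * real k - 1) / 2" for k by (simp add: field_simps)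
  have ed: "2 * (real n - 1) / (real n * (real n - 2)) + 2 / (real n - 2) * (real k - 1)
      = 2 * (real k * real n - 1) / (real n * (real n - 2))" for k
  proof -
    define N where "N = real n - 2"
    have N: "0 < N" "0 < N + 2" "real n = N + 2" using n2 by (auto simp: N_def)
    have "2 * (N + 1) / ((N + 2) * N) + 2 / N * (real k - 1) = 2 * (real k * (N + 2) - 1) / ((N + 2) * N)"
    proof -
      have "2 / N * (real k - 1) = 2 * (real k - 1) * (N + 2) / ((N + 2) * N)" using N(1,2) by simp
      then show ?thesis by (simp only: add_divide_distrib[symmetric]) (simp add: algebra_simps)
    qed
    moreover have "real n - 1 = N + 1" "real n - 2 = N" by (simp_all add: N_def)
    ultimately show ?thesis by (simp only: N(3)[symmetric])
  qed
  have eZ: "1 / 2 - real n / (real n - 2) * (real k - 1)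
      = - (2 * real k * real n - 3 * real n + 2) / (2 * (real n - 2))" for k
    using n2 by (simp add: field_simps)
  have ez: "2 / (real n - 2) * (real k - 1) = (real k - 1) * a" for k by (simp add: a_def)
  have crit: "power_rate (kappa n) (\<lambda>\<epsilon>. \<bar>crit_pt (u \<epsilon>) k\<bar>)
      (2 * (real k * real n - 1) / (real n * (real n - 2))) (coeff_d n k m)" if "k \<in> {1..m-1}" for k
    using rate_crit[OF that]
  proof (rule power_rate_cong)
    show "\<forall>\<^sub>F \<epsilon> in at_right 0. crit_pt (u \<epsilon>) k = \<bar>crit_pt (u \<epsilon>) k\<bar>"
      using power_rate_pos[OF K_pos rate_crit[OF that]] by eventually_elim simp
  qed
  have zero: "power_rate (kappa n) (\<lambda>\<epsilon>. \<bar>zero_pt (u \<epsilon>) k\<bar>) ((real k - 1) * a) (coeff_z n k m)"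
    if "k \<in> {1..m}" for k
    using rate_zero[OF that]
  proof (rule power_rate_cong)
    show "\<forall>\<^sub>F \<epsilon> in at_right 0. zero_pt (u \<epsilon>) k = \<bar>zero_pt (u \<epsilon>) k\<bar>"
      using power_rate_pos[OF K_pos rate_zero[OF that]] by eventually_elim simp
  qed
  show ?thesis
  proof (intro conjI allI ballI impI)
    fix \<epsilon> assume "0 < \<epsilon> \<and> \<epsilon> < 4 / (real n - 2)"
    then have "nodal_data n m a \<epsilon> (u \<epsilon>) (\<alpha> \<epsilon>) (b \<epsilon>) (y \<epsilon>) (w \<epsilon>) (T \<epsilon>) (\<tau> \<epsilon>)"
      using D[of \<epsilon>] a2 by simp
    note d = this[unfolded nodal_data_def]
    show "finite (crit_points (u \<epsilon>))" "card (crit_points (u \<epsilon>)) = m"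
      "finite (zeros (u \<epsilon>))" "card (zeros (u \<epsilon>)) = m" "crit_pt (u \<epsilon>) m = 0" "zero_pt (u \<epsilon>) 1 = 1"
      using d by blast+
    show "crit_pt (u \<epsilon>) k < zero_pt (u \<epsilon>) k" if "k \<in> {1..m}" for k using d that by blast
    show "zero_pt (u \<epsilon>) (k + 1) < crit_pt (u \<epsilon>) k" if "k \<in> {1..m-1}" for k using d that by blast
  next
    fix k assume k: "k \<in> {1..m}"
    show "((\<lambda>\<epsilon>. \<bar>profile (u \<epsilon>) (crit_pt (u \<epsilon>) k)\<bar> * (kappa n * \<epsilon>) powr ((2 * real k - 1) / 2))
        \<longlongrightarrow> coeff_D n k m) (at_right 0)"
      by (rule power_rateD[OF rate_value[OF k] _ refl]) (simp only: minus_divide_left minus_minus)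
    show "same_rate (\<lambda>\<epsilon>. profile (u \<epsilon>) (crit_pt (u \<epsilon>) k)) (\<lambda>\<epsilon>. \<epsilon> powr (- 1/2 - (real k - 1)))"
      unfolding eD by (rule power_rate_same_rate[OF K_pos rate_value[OF k]])
    show "((\<lambda>\<epsilon>. \<bar>profile_deriv (u \<epsilon>) (zero_pt (u \<epsilon>) k)\<bar> *
        (kappa n * \<epsilon>) powr ((2 * real k * real n - 3 * real n + 2) / (2 * (real n - 2))))
        \<longlongrightarrow> coeff_Z n k m) (at_right 0)"
      by (rule power_rateD[OF rate_deriv[OF k] _ refl]) (simp only: minus_divide_left minus_minus)
    show "same_rate (\<lambda>\<epsilon>. profile_deriv (u \<epsilon>) (zero_pt (u \<epsilon>) k))
        (\<lambda>\<epsilon>. \<epsilon> powr (1/2 - real n / (real n - 2) * (real k - 1)))"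
      unfolding eZ by (rule power_rate_same_rate[OF K_pos rate_deriv[OF k]])
  next
    fix k assume k: "k \<in> {1..m-1}"
    show "((\<lambda>\<epsilon>. crit_pt (u \<epsilon>) k *
        (kappa n * \<epsilon>) powr (- (2 * (real k * real n - 1) / (real n * (real n - 2)))))
        \<longlongrightarrow> coeff_d n k m) (at_right 0)"
      by (rule power_rateD[OF rate_crit[OF k]]) simp_all
    show "same_rate (\<lambda>\<epsilon>. crit_pt (u \<epsilon>) k)
        (\<lambda>\<epsilon>. \<epsilon> powr (2 * (real n - 1) / (real n * (real n - 2)) + 2 / (real n - 2) * (real k - 1)))"
      unfolding ed by (rule power_rate_same_rate[OF K_pos crit[OF k]])
  next
    fix k assume "k \<in> {2..m}"
    then have k: "k \<in> {1..m}" by simp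
    show "((\<lambda>\<epsilon>. zero_pt (u \<epsilon>) k * (kappa n * \<epsilon>) powr (- (2 * (real k - 1) / (real n - 2))))
        \<longlongrightarrow> coeff_z n k m) (at_right 0)"
      by (rule power_rateD[OF rate_zero[OF k]]) (simp_all add: a_def)
    show "same_rate (\<lambda>\<epsilon>. zero_pt (u \<epsilon>) k) (\<lambda>\<epsilon>. \<epsilon> powr (2 / (real n - 2) * (real k - 1)))"
      unfolding ez by (rule power_rate_same_rate[OF K_pos zero[OF k]])
  qed
qed

end
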